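(* Let $X$ be a metric space and let $\mathrm{Bd}(X)\subset 2^X$ be the hyperspace of all non-empty closed bounded subsets of $X$. The following conditions are equivalent: (1) $\mathrm{Bd}(X)$ is an ANR; (2) $\mathrm{Bd}(X)$ is locally path connected; (3) $\mathrm{Bd}(X)$ is locally chain connected; (4) $\mathrm{Bd}(X)$ is locally chain connected at $\mathrm{Bd}(X)\cap\mathcal{D}_0(X)$; (5) $X$ is uniformly locally chain equi-connected at each bounded subset of $X$; (6) $X$ is uniformly locally trace equi-connected at each bounded subset of $X$.
   Context: For a metric space $(X,d)$, $2^X$ is the set of all non-empty closed subsets of $X$ with the topology (and uniformity) generated by $\min\{1,d_H\}$, where $d_H(A,B)=\max\{\sup_{x\in B}d(x,A),\sup_{x\in A}d(x,B)\}\in[0,\infty]$. The subspace $\mathrm{Bd}(X)$ carries the Hausdorff metric $d_H$. A subset $D\subset X$ is uniformly discrete if there is $\varepsilon>0$ with $|D\cap B(x,\varepsilon)|\le1$ for all $x\in X$, where $B(x,\varepsilon)$ is the open ball. $\mathcal{D}_0(X)$ is the set of all $D\in 2^X$ that are discrete, at most countable, and totally bounded or uniformly discrete in $X$. A metric space $Y$ is an ANR if for each metric space $M$ containing $Y$ isometrically as a closed subset there is a (continuous) retraction $r:U\to Y$ from some open neighborhood $U$ of $Y$ in $M$. A space $Y$ is locally path connected if for each $x_0\in Y$ and neighborhood $U$ of $x_0$ there is a neighborhood $V$ of $x_0$ such that each $x\in V$ can be linked with $x_0$ by a continuous path $f:[0,1]\to U$, $f(0)=x_0$, $f(1)=x$.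 Let $(Y,\rho)$ be a metric space and $Y_0\subset Y$. For $\eta>0$, an $\eta$-chain of length $l$ linking $x$ and $y$ is a sequence $x=x_0,\dots,x_l=y$ of points of $Y$ with $\rho(x_i,x_{i-1})<\eta$ for $1\le i\le l$; its diameter is $\operatorname{diam}\{x_0,\dots,x_l\}$. - $Y$ is locally chain connected at $Y_0$ if for each $x_0\in Y_0$ and $\varepsilon>0$ there is $\delta>0$ such that for each $\eta>0$ and each $x\in Y_0$ with $\rho(x,x_0)<\delta$ there is an $\eta$-chain in $Y$ of diameter $<\varepsilon$ linking $x_0$ and $x$. $Y$ is locally chain connected if this holds with $Y_0=Y$. - $Y$ is uniformly locally chain equi-connected at $Y_0$ if $\forall\varepsilon>0\ \exists\delta>0\ \forall\eta>0\ \exists l\in\mathbb{N}$ such that any $x,y\in Y_0$ with $\rho(x,y)<\delta$ can be linked by an $\eta$-chain in $Y$ of diameter $<\varepsilon$ and length $\le l$. - A continuity modulus is a non-decreasing function $\omega:(0,\infty)\to(0,\infty)$ with $\lim_{t\to+0}\omega(t)=0$. For a map $f$ between metric spaces, $\omega_f(t)$ is the supremum of the distances between $f(x)$ and $f(x')$ over all $x,x'$ in the domain at distance $\le t$. $Y$ is uniformly locally trace equi-connected at $Y_0$ if there are $\varepsilon_0>0$ and a continuity modulus $\omega$ such that for any $x,y\in Y_0$ with $\rho(x,y)<\varepsilon_0$ and any countable dense subset $Q\supset\{0,\rho(x,y)\}$ of $[0,\rho(x,y)]$ there is a uniformly continuous $f:Q\to Y$ with $f(0)=x$, $f(\rho(x,y))=y$,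 $\omega_f\le\omega$. *)

theory Defs
  imports "HOL-Analysis.Analysis"
begin

section \<open>Hyperspaces\<close>

definition closed_hyperspace :: "'a metric \<Rightarrow> 'a set set" where
  "closed_hyperspace X = {A. A \<noteq> {} \<and> closedin (mtopology_of X) A}"

definition bounded_in :: "'a metric \<Rightarrow> 'a set \<Rightarrow> bool" where
  "bounded_in X S \<longleftrightarrow> Metric_space.mbounded (mspace X) (mdist X) S"

definition totally_bounded_in :: "'a metric \<Rightarrow> 'a set \<Rightarrow> bool" where
  "totally_bounded_in X S \<longleftrightarrow> Metric_space.mtotally_bounded (mspace X) (mdist X) S"

definition dist_to_set :: "'a metric \<Rightarrow> 'a \<Rightarrow> 'a set \<Rightarrow> ennreal" where
  "dist_to_set X x A = (INF a\<in>A. ennreal (mdist X x a))"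

definition hausdorff_dist :: "'a metric \<Rightarrow> 'a set \<Rightarrow> 'a set \<Rightarrow> ennreal" where
  "hausdorff_dist X A B = max (SUP x\<in>B. dist_to_set X x A) (SUP x\<in>A. dist_to_set X x B)"

definition bounded_hyperspace :: "'a metric \<Rightarrow> 'a set set" where
  "bounded_hyperspace X = {A \<in> closed_hyperspace X. bounded_in X A}"

text \<open>\<^const>\<open>metric\<close> is meaningful only on arguments that form a metric space; lemmas
  \<open>mspace_Bd\<close>, \<open>mdist_Bd\<close> and \<open>hausdorff_dist_finite\<close> below show that this is the case here,
  and that \<^const>\<open>enn2real\<close> loses no information.\<close>

definition Bd :: "'a metric \<Rightarrow> 'a set metric" where
  "Bd X = metric (bounded_hyperspace X, \<lambda>A B. enn2real (hausdorff_dist X A B))"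

definition uniformly_discrete_in :: "'a metric \<Rightarrow> 'a set \<Rightarrow> bool" where
  "uniformly_discrete_in X D \<longleftrightarrow>
     D \<subseteq> mspace X \<and>
     (\<exists>\<epsilon>>0. \<forall>x\<in>mspace X. finite (D \<inter> mball_of X x \<epsilon>) \<and> card (D \<inter> mball_of X x \<epsilon>) \<le> 1)"

definition D0 :: "'a metric \<Rightarrow> 'a set set" where
  "D0 X = {D \<in> closed_hyperspace X.
     subtopology (mtopology_of X) D = discrete_topology D \<and> countable D \<and>
     (totally_bounded_in X D \<or> uniformly_discrete_in X D)}"


subsection \<open>The Hausdorff distance is a metric on the bounded hyperspace\<close>

lemma dist_to_set_le: "a \<in> A \<Longrightarrow> dist_to_set X x A \<le> ennreal (mdist X x a)"
  unfolding dist_to_set_def by (rule INF_lower)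

lemma dist_to_set_lessE:
  assumes "dist_to_set X x A < r"
  obtains a where "a \<in> A" "ennreal (mdist X x a) < r"
  using assms unfolding dist_to_set_def by (auto simp: INF_less_iff)

lemma bounded_hyperspaceD:
  assumes "A \<in> bounded_hyperspace X"
  shows "A \<noteq> {}" "A \<subseteq> mspace X" "closedin (mtopology_of X) A" "bounded_in X A"
  using assms closedin_subset[of "mtopology_of X" A]
  by (auto simp: bounded_hyperspace_def closed_hyperspace_def)

lemma hausdorff_dist_le_iff:
  "hausdorff_dist X A B \<le> r \<longleftrightarrow>
    (\<forall>x\<in>B. dist_to_set X x A \<le> r) \<and> (\<forall>x\<in>A. dist_to_set X x B \<le> r)"
  unfolding hausdorff_dist_def by (simp add: SUP_le_iff)

lemma hausdorff_dist_commute: "hausdorff_dist X A B = hausdorff_dist X B A"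
  by (simp add: hausdorff_dist_def max.commute)

lemma dist_to_set_le_hausdorff_dist: "x \<in> B \<Longrightarrow> dist_to_set X x A \<le> hausdorff_dist X A B"
  using hausdorff_dist_le_iff[of X A B "hausdorff_dist X A B"] by simp

lemma dist_to_set_bounded:
  assumes "A \<in> bounded_hyperspace X" "B \<in> bounded_hyperspace X"
  shows "\<exists>K::real. \<forall>x\<in>B. dist_to_set X x A \<le> ennreal K"
proof -
  interpret Metric_space "mspace X" "mdist X" by simp
  obtain a where a: "a \<in> A" "a \<in> mspace X" using bounded_hyperspaceD[OF assms(1)] by auto
  obtain c r where c: "B \<subseteq> mcball c r"
    using bounded_hyperspaceD(4)[OF assms(2)] by (auto simp: bounded_in_def mbounded_def)
  have "dist_to_set X x A \<le> ennreal (r + mdist X c a)" if x: "x \<in> B" for x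
  proof -
    have "x \<in> mspace X" "c \<in> mspace X" "mdist X c x \<le> r" using c x by auto
    then have "mdist X x a \<le> r + mdist X c a"
      using triangle[of x c a] a commute[of x c] by simp
    then show ?thesis
      using dist_to_set_le[OF a(1), of X x] by (meson ennreal_leI order_trans)
  qed
  then show ?thesis by blast
qed

lemma hausdorff_dist_finite:
  assumes "A \<in> bounded_hyperspace X" "B \<in> bounded_hyperspace X"
  shows "hausdorff_dist X A B < \<infinity>"
proof -
  obtain K L :: real where "\<forall>x\<in>B. dist_to_set X x A \<le> ennreal K" "\<forall>x\<in>A. dist_to_set X x B \<le> ennreal L"
    using dist_to_set_bounded[OF assms] dist_to_set_bounded[OF assms(2,1)] by blast
  moreover have "ennreal K \<le> ennreal (max K L)" "ennreal L \<le> ennreal (max K L)"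
    by (auto intro: ennreal_leI)
  ultimately have "hausdorff_dist X A B \<le> ennreal (max K L)"
    unfolding hausdorff_dist_le_iff by (meson order_trans)
  then show ?thesis by (simp add: order_le_less_trans)
qed

lemma dist_to_set_triangle:
  assumes "A \<subseteq> mspace X" "B \<subseteq> mspace X" "C \<subseteq> mspace X" "x \<in> C"
  shows "dist_to_set X x A \<le> hausdorff_dist X A B + hausdorff_dist X B C"
proof (rule ennreal_le_epsilon)
  interpret Metric_space "mspace X" "mdist X" by simp
  fix e :: real
  assume fin: "hausdorff_dist X A B + hausdorff_dist X B C < top" and e: "0 < e"
  have fin1: "hausdorff_dist X A B < top" and fin2: "hausdorff_dist X B C < top"
    using fin by auto
  have e2: "ennreal (e / 2) > 0" "ennreal (e/2) + ennreal (e/2) = ennreal e"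
    using e by (auto simp flip: ennreal_plus)
  have less_add: "r < r + ennreal (e / 2)" if "r < top" for r
    using ennreal_add_left_cancel_less[of r 0 "ennreal (e / 2)"] that e2(1) by simp
  have "dist_to_set X x B < hausdorff_dist X B C + ennreal (e / 2)"
    using dist_to_set_le_hausdorff_dist[OF assms(4)] less_add[OF fin2] by (rule order_le_less_trans)
  then obtain b where b: "b \<in> B" "ennreal (mdist X x b) < hausdorff_dist X B C + ennreal (e / 2)"
    by (rule dist_to_set_lessE)
  have "dist_to_set X b A < hausdorff_dist X A B + ennreal (e / 2)"
    using dist_to_set_le_hausdorff_dist[OF b(1)] less_add[OF fin1] by (rule order_le_less_trans)
  then obtain a where a: "a \<in> A" "ennreal (mdist X b a) < hausdorff_dist X A B + ennreal (e / 2)"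
    by (rule dist_to_set_lessE)
  have "mdist X x a \<le> mdist X x b + mdist X b a"
    using triangle[of x b a] a b assms by auto
  then have "ennreal (mdist X x a) \<le> ennreal (mdist X x b) + ennreal (mdist X b a)"
    by (simp add: ennreal_leI flip: ennreal_plus)
  also have "\<dots> \<le> (hausdorff_dist X B C + ennreal (e / 2)) + (hausdorff_dist X A B + ennreal (e / 2))"
    using a b by (intro add_mono) auto
  also have "\<dots> = hausdorff_dist X A B + hausdorff_dist X B C + ennreal e"
    by (simp add: e2(2)[symmetric] ac_simps)
  finally show "dist_to_set X x A \<le> hausdorff_dist X A B + hausdorff_dist X B C + ennreal e"
    using dist_to_set_le[OF a(1), of X x] by (rule order_trans[rotated])
qed

lemma mem_of_dist_to_set_eq_0:
  assumes "closedin (mtopology_of X) A" "x \<in> mspace X" "dist_to_set X x A = 0"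
  shows "x \<in> A"
proof -
  interpret Metric_space "mspace X" "mdist X" by simp
  have sub: "A \<subseteq> mspace X" using closedin_subset[OF assms(1)] by simp
  have "\<exists>y\<in>A. y \<in> mball x r" if "r > 0" for r
  proof -
    have "dist_to_set X x A < ennreal r" using that assms(3) by simp
    then obtain a where "a \<in> A" "ennreal (mdist X x a) < ennreal r"
      by (rule dist_to_set_lessE)
    then show ?thesis using sub assms(2) that by (auto simp: ennreal_less_iff)
  qed
  then have "x \<in> mtopology closure_of A"
    using assms(2) by (simp add: metric_closure_of)
  then show ?thesis
    using assms(1) by (simp add: closure_of_closedin mtopology_of_def)
qed

lemma hausdorff_dist_eq_0_iff:
  assumes "closedin (mtopology_of X) A" "closedin (mtopology_of X) B"
  shows "hausdorff_dist X A B = 0 \<longleftrightarrow> A = B"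
proof
  have sub: "A \<subseteq> mspace X" "B \<subseteq> mspace X"
    using closedin_subset[OF assms(1)] closedin_subset[OF assms(2)] by auto
  assume "hausdorff_dist X A B = 0"
  then have "\<forall>x\<in>B. dist_to_set X x A = 0" "\<forall>x\<in>A. dist_to_set X x B = 0"
    using hausdorff_dist_le_iff[of X A B 0] by auto
  then have "x \<in> A \<longleftrightarrow> x \<in> B" for x
    using mem_of_dist_to_set_eq_0[OF assms(1), of x] mem_of_dist_to_set_eq_0[OF assms(2), of x] sub
    by auto
  then show "A = B" by blast
next
  assume AB: "A = B"
  have "dist_to_set X x A \<le> 0" if x: "x \<in> A" for x
  proof -
    interpret Metric_space "mspace X" "mdist X" by simp
    have "x \<in> mspace X" using x closedin_subset[OF assms(1)] by auto
    then show ?thesis using dist_to_set_le[OF x, of X x] by simp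
  qed
  then show "hausdorff_dist X A B = 0"
    using hausdorff_dist_le_iff[of X A A 0] AB by simp
qed

lemma Metric_space_bounded_hyperspace:
  "Metric_space (bounded_hyperspace X) (\<lambda>A B. enn2real (hausdorff_dist X A B))"
proof
  fix A B C
  show "0 \<le> enn2real (hausdorff_dist X A B)" by simp
  show "enn2real (hausdorff_dist X A B) = enn2real (hausdorff_dist X B A)"
    by (simp add: hausdorff_dist_commute)
  assume A: "A \<in> bounded_hyperspace X" and B: "B \<in> bounded_hyperspace X"
  have "enn2real (hausdorff_dist X A B) = 0 \<longleftrightarrow> hausdorff_dist X A B = 0"
    using hausdorff_dist_finite[OF A B] by (auto simp: enn2real_eq_0_iff)
  then show "enn2real (hausdorff_dist X A B) = 0 \<longleftrightarrow> A = B"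
    using hausdorff_dist_eq_0_iff[OF bounded_hyperspaceD(3)[OF A] bounded_hyperspaceD(3)[OF B]]
    by simp
  assume C: "C \<in> bounded_hyperspace X"
  have "hausdorff_dist X A C \<le> hausdorff_dist X A B + hausdorff_dist X B C"
    unfolding hausdorff_dist_le_iff
    using dist_to_set_triangle[of A X B C] dist_to_set_triangle[of C X B A]
      bounded_hyperspaceD(2)[OF A] bounded_hyperspaceD(2)[OF B] bounded_hyperspaceD(2)[OF C]
    by (simp add: hausdorff_dist_commute[of X C B] hausdorff_dist_commute[of X B A] add.commute)
  then show "enn2real (hausdorff_dist X A C) \<le>
      enn2real (hausdorff_dist X A B) + enn2real (hausdorff_dist X B C)"
    using enn2real_mono[of "hausdorff_dist X A C" "hausdorff_dist X A B + hausdorff_dist X B C"]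
      hausdorff_dist_finite[OF A B] hausdorff_dist_finite[OF B C]
    by (simp add: enn2real_plus)
qed

lemma mspace_Bd [simp]: "mspace (Bd X) = bounded_hyperspace X"
  unfolding Bd_def by (rule Metric_space.mspace_metric[OF Metric_space_bounded_hyperspace])

lemma mdist_Bd: "mdist (Bd X) A B = enn2real (hausdorff_dist X A B)"
  unfolding Bd_def by (simp add: Metric_space.mdist_metric[OF Metric_space_bounded_hyperspace])


section \<open>Absolute neighbourhood retracts\<close>

text \<open>A metric space \<open>M\<close> containing \<open>Y\<close> isometrically as a closed subset is rendered as a metric
  space \<open>M\<close> together with an isometric embedding \<open>e\<close> of \<open>Y\<close> onto a closed subset of \<open>M\<close>.
  A definition in HOL cannot quantify over all types, so the ambient spaces range over the metric
  spaces with points in a type \<open>'m\<close> passed as an argument; \<open>Y\<close> is an ANR iff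
  \<open>ANR_over TYPE('m) Y\<close> holds for every type \<open>'m\<close>. For \<open>Y :: 'a metric\<close> the single type
  \<open>'a \<Rightarrow> real\<close> is already large enough to be decisive: it accommodates the convex hull of the
  Kuratowski image of \<open>Y\<close> in the space of bounded functions, in which \<open>Y\<close> is closed.\<close>

definition isometric_embedding :: "'a metric \<Rightarrow> 'b metric \<Rightarrow> ('a \<Rightarrow> 'b) \<Rightarrow> bool" where
  "isometric_embedding Y M e \<longleftrightarrow>
     e \<in> mspace Y \<rightarrow> mspace M \<and> (\<forall>x\<in>mspace Y. \<forall>y\<in>mspace Y. mdist M (e x) (e y) = mdist Y x y)"

definition ANR_over :: "'m itself \<Rightarrow> 'a metric \<Rightarrow> bool" where
  "ANR_over T Y \<longleftrightarrow>
     (\<forall>(M :: 'm metric) e.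
        isometric_embedding Y M e \<and> closedin (mtopology_of M) (e ` mspace Y) \<longrightarrow>
        (\<exists>U. openin (mtopology_of M) U \<and> e ` mspace Y \<subseteq> U \<and>
             e ` mspace Y retract_of_space subtopology (mtopology_of M) U))"


section \<open>Local path connectedness\<close>

text \<open>The library's \<^const>\<open>locally_path_connected_space\<close> asks for a base of path connected
  neighbourhoods; this is the same as the pointwise condition with paths.\<close>

lemma locally_path_connected_space_iff_paths:
  "locally_path_connected_space T \<longleftrightarrow>
     (\<forall>x0\<in>topspace T. \<forall>U. openin T U \<and> x0 \<in> U \<longrightarrow>
        (\<exists>V. openin T V \<and> x0 \<in> V \<and>
           (\<forall>x\<in>V. \<exists>f. pathin T f \<and> f ` {0..1} \<subseteq> U \<and> f 0 = x0 \<and> f 1 = x)))"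
  (is "?L \<longleftrightarrow> ?R")
proof
  assume L: ?L
  show ?R
  proof (intro ballI allI impI)
    fix x0 U assume "x0 \<in> topspace T" and U: "openin T U \<and> x0 \<in> U"
    then obtain V where V: "openin T V" "x0 \<in> V"
        "\<forall>y\<in>V. \<exists>C. path_connectedin T C \<and> C \<subseteq> U \<and> x0 \<in> C \<and> y \<in> C"
      using L[unfolded locally_path_connected_space_im_kleinen, rule_format, OF U] by (elim exE conjE)
    have "\<exists>f. pathin T f \<and> f ` {0..1} \<subseteq> U \<and> f 0 = x0 \<and> f 1 = x" if x: "x \<in> V" for x
    proof -
      obtain C where C: "path_connectedin T C" "C \<subseteq> U" "x0 \<in> C" "x \<in> C"
        using bspec[OF V(3) x] by (elim exE conjE)
      have "\<forall>x\<in>C. \<forall>y\<in>C. \<exists>g. pathin T g \<and> g \<in> {0..1} \<rightarrow> C \<and> g 0 = x \<and> g 1 = y"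
        using C(1) unfolding path_connectedin by (rule conjunct2)
      from bspec[OF bspec[OF this C(3)] C(4)]
      obtain f where f: "pathin T f" "f \<in> {0..1} \<rightarrow> C" "f 0 = x0" "f 1 = x" by (elim exE conjE)
      have "f ` {0..1} \<subseteq> U" using f(2) C(2) by (auto simp: Pi_iff)
      then show ?thesis using f(1,3,4) by (intro exI[of _ f] conjI)
    qed
    then show "\<exists>V. openin T V \<and> x0 \<in> V \<and>
        (\<forall>x\<in>V. \<exists>f. pathin T f \<and> f ` {0..1} \<subseteq> U \<and> f 0 = x0 \<and> f 1 = x)"
      using V(1,2) by (intro exI[of _ V] conjI ballI)
  qed
next
  assume R: ?R
  show ?L
    unfolding locally_path_connected_space_im_kleinen
  proof (intro allI impI)
    fix U x0 assume U: "openin T U \<and> x0 \<in> U"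
    then have "x0 \<in> topspace T" using openin_subset by blast
    then obtain V where V: "openin T V" "x0 \<in> V"
      and p: "\<forall>x\<in>V. \<exists>f. pathin T f \<and> f ` {0..1} \<subseteq> U \<and> f 0 = x0 \<and> f 1 = x"
      using R[rule_format, OF _ U] by auto
    have "\<exists>C. path_connectedin T C \<and> C \<subseteq> U \<and> x0 \<in> C \<and> y \<in> C" if y: "y \<in> V" for y
    proof -
      obtain f where f: "pathin T f" "f ` {0..1} \<subseteq> U" "f 0 = x0" "f 1 = y"
        using p y by blast
      have "path_connectedin T (f ` {0..1})"
        by (rule path_connectedin_path_image[OF f(1)])
      moreover have "x0 \<in> f ` {0..1}" "y \<in> f ` {0..1}" using f(3,4) by force+
      ultimately show ?thesis using f(2) by blast
    qed
    then show "\<exists>V. openin T V \<and> x0 \<in> V \<and> V \<subseteq> U \<and>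
        (\<forall>y\<in>V. \<exists>C. path_connectedin T C \<and> C \<subseteq> U \<and> x0 \<in> C \<and> y \<in> C)"
      using V(1,2) by (intro exI[of _ V]) blast
  qed
qed


section \<open>Chains and traces\<close>

definition diameter_in :: "'a metric \<Rightarrow> 'a set \<Rightarrow> real" where
  "diameter_in Y S = (SUP (x, y)\<in>S \<times> S. mdist Y x y)"

definition chain_in :: "'a metric \<Rightarrow> real \<Rightarrow> nat \<Rightarrow> 'a \<Rightarrow> 'a \<Rightarrow> (nat \<Rightarrow> 'a) \<Rightarrow> bool" where
  "chain_in Y \<eta> l x y c \<longleftrightarrow>
     c ` {0..l} \<subseteq> mspace Y \<and> c 0 = x \<and> c l = y \<and> (\<forall>i\<in>{1..l}. mdist Y (c i) (c (i - 1)) < \<eta>)"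

definition locally_chain_connected_at :: "'a metric \<Rightarrow> 'a set \<Rightarrow> bool" where
  "locally_chain_connected_at Y Y0 \<longleftrightarrow>
     (\<forall>x0\<in>Y0. \<forall>\<epsilon>>0. \<exists>\<delta>>0. \<forall>\<eta>>0. \<forall>x\<in>Y0. mdist Y x x0 < \<delta> \<longrightarrow>
        (\<exists>l c. chain_in Y \<eta> l x0 x c \<and> diameter_in Y (c ` {0..l}) < \<epsilon>))"

definition locally_chain_connected :: "'a metric \<Rightarrow> bool" where
  "locally_chain_connected Y \<longleftrightarrow> locally_chain_connected_at Y (mspace Y)"

definition uniformly_locally_chain_equiconnected_at :: "'a metric \<Rightarrow> 'a set \<Rightarrow> bool" where
  "uniformly_locally_chain_equiconnected_at Y Y0 \<longleftrightarrow>
     (\<forall>\<epsilon>>0. \<exists>\<delta>>0. \<forall>\<eta>>0. \<exists>l::nat. \<forall>x\<in>Y0. \<forall>y\<in>Y0. mdist Y x y < \<delta> \<longrightarrow>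
        (\<exists>k\<le>l. \<exists>c. chain_in Y \<eta> k x y c \<and> diameter_in Y (c ` {0..k}) < \<epsilon>))"

text \<open>Only the values on the positive reals are constrained.\<close>

definition continuity_modulus :: "(real \<Rightarrow> real) \<Rightarrow> bool" where
  "continuity_modulus \<omega> \<longleftrightarrow>
     (\<forall>t>0. \<omega> t > 0) \<and> mono_on {0<..} \<omega> \<and> (\<omega> \<longlongrightarrow> 0) (at_right 0)"

definition modulus_of :: "'a metric \<Rightarrow> 'b metric \<Rightarrow> ('a \<Rightarrow> 'b) \<Rightarrow> real \<Rightarrow> ennreal" where
  "modulus_of P Y f t =
     (SUP (x, x') \<in> {(x, x'). x \<in> mspace P \<and> x' \<in> mspace P \<and> mdist P x x' \<le> t}.
        ennreal (mdist Y (f x) (f x')))"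

definition uniformly_locally_trace_equiconnected_at :: "'a metric \<Rightarrow> 'a set \<Rightarrow> bool" where
  "uniformly_locally_trace_equiconnected_at Y Y0 \<longleftrightarrow>
     (\<exists>\<epsilon>0>0. \<exists>\<omega>. continuity_modulus \<omega> \<and>
        (\<forall>x\<in>Y0. \<forall>y\<in>Y0. mdist Y x y < \<epsilon>0 \<longrightarrow>
           (\<forall>Q. countable Q \<and> Q \<subseteq> {0..mdist Y x y} \<and> {0..mdist Y x y} \<subseteq> closure Q \<and>
                {0, mdist Y x y} \<subseteq> Q \<longrightarrow>
              (\<exists>f. uniformly_continuous_map (submetric euclidean_metric Q) Y f \<and>
                   f 0 = x \<and> f (mdist Y x y) = y \<and>
                   (\<forall>t>0. modulus_of (submetric euclidean_metric Q) Y f t \<le> ennreal (\<omega> t))))))"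

end

theory Submission
  imports Defs
begin

text \<open>
  The six conditions are linked in a cycle. The last link, from traces back to the ANR property,
  constructs a retraction for ambient spaces with points in an arbitrary type; this also shows that
  the single type of ambient spaces in the first condition decides the matter for all types.

  An ANR is locally path connected because it is a retract of an open subset of a locally path
  connected space. A suitable ambient space is a half space of bounded functions: the functions
  that are positive at one extra coordinate, together with a Kuratowski copy of the given space on
  which this coordinate vanishes. So the copy is closed, and two nearby points are
  joined by a small path that bends into the positive part (\<open>locally_path_connected_of_ANR_over\<close>).
  For \<open>Bd X\<close> the empty set can label the extra coordinate. Local path connectedness yields
  chains, since a connected subset of an open set \<open>U\<close> lies in a single class of the relation ``linked
  by a chain of small steps in \<open>U\<close>'', all of whose classes are open.

  The passage from chains of sets to chains of points rests on the remark that one chain of sets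
  of length \<open>l\<close> from \<open>D\<close> to \<open>D'\<close> produces, for all points of \<open>D'\<close> at once, chains of points of
  length \<open>l\<close> that end in \<open>D\<close>. If the points of \<open>D\<close> are far apart then these chains cannot leave the
  neighbourhood of one point of \<open>D\<close>, and so chain lengths near \<open>D\<close> are uniformly bounded
  (\<open>uniform_links_near_separated_set\<close>). Terms of a Cauchy sequence are not far apart; here chains
  between the terms themselves have to be found first, by comparing the totally bounded range
  with finite sets (\<open>uniform_links_near_Cauchy\<close>). As every sequence has a Cauchy subsequence
  or a separated one, this covers a bounded set point by point, with a radius common to all points
  (\<open>pointwise_links_on_bounded_set\<close>). Finally a counterexample to
  uniformity is a double sequence of pairs of points; either it clusters, and the common radius
  gives short chains, or a diagonal selection from it is separated
  (\<open>chain_equiconnected_of_discretely_chain_connected\<close>).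

  Traces are obtained from chains by repeatedly inserting, between consecutive points, finer
  chains of controlled length. This defines a map on a countable grid with a modulus of continuity
  that depends on the bounded set only, and a countable dense set of parameters is carried into the
  grid by a Lipschitz map (\<open>Lipschitz_map_into_dense_set\<close>,
  \<open>trace_equiconnected_of_chain_equiconnected\<close>).

  For the retraction, traces between points of two nearby sets \<open>A\<close> and \<open>B\<close> combine to
  a continuous family of sets \<open>\<Gamma> A B s\<close> that starts at \<open>A\<close> and covers \<open>B\<close> at the end. A
  point \<open>m\<close> of the ambient space is sent to the closure of a union of such sets, where \<open>A\<close> and \<open>B\<close> run
  over the sets whose distance from \<open>m\<close> is comparable to the least possible one and the times \<open>s\<close>
  depend on the distances. A set enters or leaves the union at the moment when it is already covered by paths that
  start at still nearer sets. So the union varies continuously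
  (\<open>hyperspace_extension.P_near_P\<close>).
\<close>

section \<open>Metric preliminaries\<close>

lemma mdist_same [simp]: "x \<in> mspace X \<Longrightarrow> mdist X x x = 0"
  by simp

lemma bounded_inI:
  assumes "S \<subseteq> mspace X" "c \<in> mspace X" "\<And>x. x \<in> S \<Longrightarrow> mdist X c x \<le> r"
  shows "bounded_in X S"
proof -
  interpret Metric_space "mspace X" "mdist X" by simp
  show ?thesis using assms by (auto simp: bounded_in_def mbounded)
qed

lemma bounded_in_subset_mspace: "bounded_in X S \<Longrightarrow> S \<subseteq> mspace X"
  unfolding bounded_in_def by (rule Metric_space.mbounded_subset_mspace[OF Metric_space_mspace_mdist])

lemma bounded_in_mono: "bounded_in X T \<Longrightarrow> S \<subseteq> T \<Longrightarrow> bounded_in X S"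
  unfolding bounded_in_def by (rule Metric_space.mbounded_subset) auto

lemma bounded_inE:
  assumes "bounded_in X S" "c \<in> mspace X"
  obtains r where "0 < r" "\<And>x. x \<in> S \<Longrightarrow> mdist X c x \<le> r"
proof -
  interpret Metric_space "mspace X" "mdist X" by simp
  obtain r' where r': "\<forall>x\<in>insert c S. \<forall>y\<in>insert c S. mdist X x y \<le> r'"
    using assms mbounded_insert[of c S] mbounded_alt[of "insert c S"] by (auto simp: bounded_in_def)
  show thesis by (rule that[of "max r' 1"]) (use r' in auto)
qed

lemma bounded_in_neighbourhood:
  assumes "bounded_in X A" "S \<subseteq> mspace X" "\<And>x. x \<in> S \<Longrightarrow> \<exists>a\<in>A. mdist X x a \<le> r"
  shows "bounded_in X S"
proof (cases "mspace X = {}")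
  case True
  then have "S = {}" using assms(2) by simp
  then show ?thesis unfolding bounded_in_def
    using Metric_space.mbounded_empty[OF Metric_space_mspace_mdist[of X]] by simp
next
  case False
  then obtain c where c: "c \<in> mspace X" by auto
  obtain q where q: "\<And>a. a \<in> A \<Longrightarrow> mdist X c a \<le> q" using bounded_inE[OF assms(1) c] by blast
  show ?thesis
  proof (rule bounded_inI[OF assms(2) c])
    fix x assume "x \<in> S"
    then obtain a where a: "a \<in> A" "mdist X x a \<le> r" using assms(3) by blast
    have "a \<in> mspace X" using a(1) bounded_in_subset_mspace[OF assms(1)] by blast
    then show "mdist X c x \<le> q + r"
      using mdist_triangle[of c X a x] mdist_commute[of X x a] q[OF a(1)] a(2) c \<open>x \<in> S\<close> assms(2)
      by auto
  qed
qed

lemma closure_of_mtopology_of: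
  "mtopology_of X closure_of S = {x \<in> mspace X. \<forall>r>0. \<exists>y\<in>S. y \<in> mspace X \<and> mdist X x y < r}"
proof -
  interpret Metric_space "mspace X" "mdist X" by simp
  show ?thesis by (auto simp: mtopology_of_def metric_closure_of)
qed

lemma continuous_map_metric_iff:
  "continuous_map (mtopology_of M) (mtopology_of N) f \<longleftrightarrow>
     (\<forall>x\<in>mspace M. f x \<in> mspace N) \<and>
     (\<forall>x\<in>mspace M. \<forall>e>0. \<exists>d>0. \<forall>y. y \<in> mspace M \<and> mdist M x y < d \<longrightarrow> mdist N (f x) (f y) < e)"
  using Metric_space.metric_continuous_map[OF Metric_space_mspace_mdist Metric_space_mspace_mdist,
      of M N f]
  by (simp add: mtopology_of_def image_subset_iff)

lemma continuous_map_metricI: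
  assumes "\<And>x. x \<in> mspace M \<Longrightarrow> f x \<in> mspace N"
    and "\<And>x e. x \<in> mspace M \<Longrightarrow> 0 < e \<Longrightarrow>
        \<exists>d>0. \<forall>y\<in>mspace M. mdist M x y < d \<longrightarrow> mdist N (f x) (f y) < e"
  shows "continuous_map (mtopology_of M) (mtopology_of N) f"
  unfolding continuous_map_metric_iff
proof (intro conjI ballI allI impI)
  fix x and e :: real assume "x \<in> mspace M" "0 < e"
  from assms(2)[OF this]
  show "\<exists>d>0. \<forall>y. y \<in> mspace M \<and> mdist M x y < d \<longrightarrow> mdist N (f x) (f y) < e" by auto
qed (fact assms(1))

lemma openin_mtopology_of:
  "openin (mtopology_of X) U \<longleftrightarrow>
     U \<subseteq> mspace X \<and> (\<forall>x\<in>U. \<exists>r>0. \<forall>y\<in>mspace X. mdist X x y < r \<longrightarrow> y \<in> U)"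
proof -
  interpret Metric_space "mspace X" "mdist X" by simp
  have ball: "mball x r \<subseteq> U \<longleftrightarrow> (\<forall>y\<in>mspace X. mdist X x y < r \<longrightarrow> y \<in> U)"
    if "x \<in> mspace X" for x r
    using that by (auto simp: subset_iff)
  have "openin mtopology U \<longleftrightarrow> U \<subseteq> mspace X \<and> (\<forall>x\<in>U. \<exists>r>0. mball x r \<subseteq> U)"
    by (simp add: openin_mtopology Ball_def)
  also have "\<dots> \<longleftrightarrow> U \<subseteq> mspace X \<and>
      (\<forall>x\<in>U. \<exists>r>0. \<forall>y\<in>mspace X. mdist X x y < r \<longrightarrow> y \<in> U)"
    by (intro conj_cong refl ball_cong ex_cong1) (auto simp: ball subset_iff)
  finally show ?thesis by (simp add: mtopology_of_def)
qed

section \<open>Closeness in the Hausdorff metric\<close>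

text \<open>One half of the Hausdorff distance, as a relation between arbitrary sets: it avoids
  suprema and makes sense before closures are taken.\<close>

definition near_in :: "'a metric \<Rightarrow> real \<Rightarrow> 'a set \<Rightarrow> 'a set \<Rightarrow> bool" where
  "near_in X e A B \<longleftrightarrow> (\<forall>a\<in>A. \<exists>b\<in>B. mdist X a b < e)"

lemma near_in_mono: "near_in X e A B \<Longrightarrow> e \<le> e' \<Longrightarrow> A' \<subseteq> A \<Longrightarrow> B \<subseteq> B' \<Longrightarrow> near_in X e' A' B'"
  unfolding near_in_def by (meson order_less_le_trans subsetD)

lemma near_in_trans:
  assumes "near_in X e A B" "near_in X f B C" "A \<subseteq> mspace X" "B \<subseteq> mspace X" "C \<subseteq> mspace X"
  shows "near_in X (e + f) A C"
  unfolding near_in_def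
proof
  fix a assume a: "a \<in> A"
  then obtain b where b: "b \<in> B" "mdist X a b < e" using assms(1) unfolding near_in_def by blast
  then obtain c where c: "c \<in> C" "mdist X b c < f" using assms(2) unfolding near_in_def by blast
  have "mdist X a c < e + f"
    using mdist_triangle[of a X b c] a b c assms(3-5) by force
  then show "\<exists>c\<in>C. mdist X a c < e + f" using c(1) by blast
qed

lemma near_in_refl: "A \<subseteq> mspace X \<Longrightarrow> 0 < e \<Longrightarrow> near_in X e A A"
  unfolding near_in_def by (metis mdist_same subsetD)

lemma near_in_closure_of:
  "0 < e \<Longrightarrow> near_in X e (mtopology_of X closure_of S) S"
  unfolding near_in_def closure_of_mtopology_of by blast

lemma near_in_of_mdist_Bd:
  assumes "A \<in> bounded_hyperspace X" "B \<in> bounded_hyperspace X" "mdist (Bd X) A B < e"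
  shows "near_in X e A B" "near_in X e B A"
proof -
  have *: "near_in X e A B" if "A \<in> bounded_hyperspace X" "B \<in> bounded_hyperspace X"
    "mdist (Bd X) A B < e" for A B
    unfolding near_in_def
  proof
    fix a assume a: "a \<in> A"
    have e: "0 < e" using that(3) mdist_nonneg[of "Bd X" A B] by linarith
    have "hausdorff_dist X A B < top" using hausdorff_dist_finite[OF that(1,2)] by simp
    then have "hausdorff_dist X A B < ennreal e"
      using that(3) e unfolding mdist_Bd
      by (metis enn2real_nonneg ennreal_enn2real ennreal_less_iff)
    moreover have "dist_to_set X a B \<le> hausdorff_dist X A B"
      using dist_to_set_le_hausdorff_dist[OF a, of X B] by (simp add: hausdorff_dist_commute)
    ultimately have "dist_to_set X a B < ennreal e" by (rule order_le_less_trans[rotated])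
    then obtain b where "b \<in> B" "ennreal (mdist X a b) < ennreal e" by (rule dist_to_set_lessE)
    then show "\<exists>b\<in>B. mdist X a b < e" using e by (auto simp: ennreal_less_iff)
  qed
  show "near_in X e A B" by (rule *[OF assms])
  show "near_in X e B A" by (rule *[OF assms(2,1)]) (use assms(3) in \<open>simp add: mdist_commute\<close>)
qed

lemma mdist_Bd_le_of_near_in:
  assumes "near_in X e A B" "near_in X e B A" "0 \<le> e"
  shows "mdist (Bd X) A B \<le> e"
proof -
  have *: "dist_to_set X a B \<le> ennreal e" if h: "near_in X e A B" "a \<in> A" for A B a
  proof -
    obtain b where "b \<in> B" "mdist X a b < e" using h unfolding near_in_def by blast
    then show ?thesis using dist_to_set_le[of b B X a] by (meson ennreal_leI less_imp_le order_trans)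
  qed
  have "hausdorff_dist X A B \<le> ennreal e"
    unfolding hausdorff_dist_le_iff using * assms by blast
  then show ?thesis unfolding mdist_Bd using assms(3) by (rule enn2real_leI[rotated])
qed

lemma closure_of_in_bounded_hyperspace:
  assumes "bounded_in X S" "S \<noteq> {}"
  shows "mtopology_of X closure_of S \<in> bounded_hyperspace X"
proof -
  interpret Metric_space "mspace X" "mdist X" by simp
  have "S \<subseteq> mspace X" using bounded_in_subset_mspace[OF assms(1)] .
  then have "mtopology_of X closure_of S \<noteq> {}"
    using assms(2) closure_of_subset[of S "mtopology_of X"] by auto
  moreover have "bounded_in X (mtopology_of X closure_of S)"
    using assms(1) mbounded_closure_of unfolding bounded_in_def mtopology_of_def by blast
  ultimately show ?thesis by (simp add: bounded_hyperspace_def closed_hyperspace_def)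
qed

section \<open>Chains inside a set\<close>

text \<open>Chains are confined to a set instead of having small diameter. In this form they can be
  concatenated and reversed without any loss, and powers of a relation do the bookkeeping.\<close>

definition step_rel :: "'a metric \<Rightarrow> real \<Rightarrow> 'a set \<Rightarrow> ('a \<times> 'a) set" where
  "step_rel X \<eta> S = {(u, v). u \<in> S \<inter> mspace X \<and> v \<in> S \<inter> mspace X \<and> mdist X u v < \<eta>}"

definition linked :: "'a metric \<Rightarrow> real \<Rightarrow> nat \<Rightarrow> 'a set \<Rightarrow> 'a \<Rightarrow> 'a \<Rightarrow> bool" where
  "linked X \<eta> l S x y \<longleftrightarrow> x \<in> S \<inter> mspace X \<and> (\<exists>k\<le>l. (x, y) \<in> step_rel X \<eta> S ^^ k)"

lemma linked_refl: "x \<in> S \<Longrightarrow> x \<in> mspace X \<Longrightarrow> linked X \<eta> l S x x"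
  unfolding linked_def by (auto intro!: exI[of _ 0])

lemma linked_step:
  assumes "x \<in> S" "y \<in> S" "x \<in> mspace X" "y \<in> mspace X" "mdist X x y < \<eta>"
  shows "linked X \<eta> 1 S x y"
  using assms unfolding linked_def by (auto intro!: exI[of _ 1] simp: step_rel_def)

lemma linked_mono:
  assumes "linked X \<eta> l S x y" "\<eta> \<le> \<eta>'" "l \<le> l'" "S \<subseteq> S'"
  shows "linked X \<eta>' l' S' x y"
proof -
  obtain k where k: "x \<in> S \<inter> mspace X" "k \<le> l" "(x, y) \<in> step_rel X \<eta> S ^^ k"
    using assms(1) unfolding linked_def by blast
  have "step_rel X \<eta> S \<subseteq> step_rel X \<eta>' S'" using assms unfolding step_rel_def by auto
  then have "(x, y) \<in> step_rel X \<eta>' S' ^^ k" using k(3)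
    by (auto simp: relpow_fun_conv)
  then show ?thesis using k assms unfolding linked_def by (meson IntD1 IntD2 IntI le_trans subsetD)
qed

lemma linked_trans:
  assumes "linked X \<eta> k S x y" "linked X \<eta> l S y z"
  shows "linked X \<eta> (k + l) S x z"
proof -
  obtain i where i: "x \<in> S \<inter> mspace X" "i \<le> k" "(x, y) \<in> step_rel X \<eta> S ^^ i"
    using assms(1) unfolding linked_def by blast
  obtain j where j: "j \<le> l" "(y, z) \<in> step_rel X \<eta> S ^^ j"
    using assms(2) unfolding linked_def by blast
  have "(x, z) \<in> step_rel X \<eta> S ^^ (i + j)" using i j by (auto simp: relpow_add)
  then show ?thesis using i j unfolding linked_def by (meson add_mono)
qed

lemma linked_in: 
  assumes "linked X \<eta> l S x y"
  shows "x \<in> S" "x \<in> mspace X" "y \<in> S" "y \<in> mspace X"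
proof -
  show "x \<in> S" "x \<in> mspace X" using assms unfolding linked_def by auto
  obtain k where k: "x \<in> S \<inter> mspace X" "(x, y) \<in> step_rel X \<eta> S ^^ k"
    using assms(1) unfolding linked_def by blast
  have "y \<in> S \<inter> mspace X"
    using k by (cases k) (auto simp: step_rel_def)
  then show "y \<in> S" "y \<in> mspace X" by auto
qed

lemma linked_sym:
  assumes "linked X \<eta> l S x y"
  shows "linked X \<eta> l S y x"
proof -
  obtain k where k: "k \<le> l" "(x, y) \<in> step_rel X \<eta> S ^^ k"
    using assms unfolding linked_def by blast
  have "sym (step_rel X \<eta> S)" unfolding sym_def step_rel_def by (auto simp: mdist_commute)
  then have "sym (step_rel X \<eta> S ^^ k)" 
  proof (induction k)
    case 0 then show ?case by (simp add: sym_Id)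
  next
    case (Suc k)
    then have "(step_rel X \<eta> S ^^ k)\<inverse> = step_rel X \<eta> S ^^ k" "(step_rel X \<eta> S)\<inverse> = step_rel X \<eta> S"
      by (simp_all add: sym_conv_converse_eq)
    then show ?case
      unfolding sym_conv_converse_eq by (simp add: converse_relcomp relpow_commute)
  qed
  then have "(y, x) \<in> step_rel X \<eta> S ^^ k" using k(2) by (auto dest: symD)
  then show ?thesis using linked_in[OF assms] k(1) unfolding linked_def by blast
qed

lemma linked_imp_chain_in:
  assumes "linked X \<eta> l S x y"
  obtains k c where "k \<le> l" "chain_in X \<eta> k x y c" "c ` {0..k} \<subseteq> S"
proof -
  obtain k where k: "x \<in> S \<inter> mspace X" "k \<le> l" "(x, y) \<in> step_rel X \<eta> S ^^ k"
    using assms unfolding linked_def by blast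
  obtain c where c: "c 0 = x" "c k = y" "\<And>i. i < k \<Longrightarrow> (c i, c (Suc i)) \<in> step_rel X \<eta> S"
    using k(3) unfolding relpow_fun_conv by blast
  have in_S: "c i \<in> S \<inter> mspace X" if "i \<le> k" for i
    using that c(1,3) k(1) by (cases i) (fastforce simp: step_rel_def)+
  have "mdist X (c i) (c (i - 1)) < \<eta>" if "i \<in> {1..k}" for i
    using that c(3)[of "i - 1"] by (auto simp: step_rel_def mdist_commute)
  then have "chain_in X \<eta> k x y c" using c(1,2) in_S unfolding chain_in_def by auto
  then show thesis using that k(2) in_S by (meson IntD1 atLeastAtMost_iff image_subsetI)
qed

lemma chain_in_imp_linked:
  assumes "chain_in X \<eta> k x y c" "c ` {0..k} \<subseteq> S"
  shows "linked X \<eta> k S x y"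
proof -
  have "(c i, c (Suc i)) \<in> step_rel X \<eta> S" if "i < k" for i
  proof -
    have "mdist X (c (Suc i)) (c (Suc i - 1)) < \<eta>"
      using assms(1) that unfolding chain_in_def by (metis Suc_leI atLeastAtMost_iff le_add1 plus_1_eq_Suc)
    then show ?thesis using that assms unfolding chain_in_def step_rel_def
      by (auto simp: mdist_commute image_subset_iff)
  qed
  then have "(x, y) \<in> step_rel X \<eta> S ^^ k"
    using assms(1) unfolding relpow_fun_conv chain_in_def by blast
  then show ?thesis using assms unfolding linked_def chain_in_def by (auto simp: image_subset_iff)
qed

lemma diameter_in_le:
  assumes "S \<noteq> {}" "\<And>x y. x \<in> S \<Longrightarrow> y \<in> S \<Longrightarrow> mdist X x y \<le> r"
  shows "diameter_in X S \<le> r"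
  unfolding diameter_in_def using assms by (intro cSUP_least) auto

lemma mdist_le_diameter_in:
  assumes "finite S" "x \<in> S" "y \<in> S"
  shows "mdist X x y \<le> diameter_in X S"
  unfolding diameter_in_def
  using cSUP_upper[of "(x, y)" "S \<times> S" "\<lambda>(x, y). mdist X x y"] assms by auto

lemma chain_of_small_diameter_imp_linked:
  assumes "chain_in X \<eta> k x y c" "diameter_in X (c ` {0..k}) < \<epsilon>"
  shows "linked X \<eta> k (mball_of X x \<epsilon>) x y"
proof (rule chain_in_imp_linked[OF assms(1)])
  show "c ` {0..k} \<subseteq> mball_of X x \<epsilon>"
  proof
    fix z assume z: "z \<in> c ` {0..k}"
    have "x \<in> c ` {0..k}" using assms(1) unfolding chain_in_def by force
    then have "mdist X x z \<le> diameter_in X (c ` {0..k})" using z by (intro mdist_le_diameter_in) auto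
    moreover have "x \<in> mspace X" "z \<in> mspace X"
      using assms(1) z \<open>x \<in> c ` {0..k}\<close> unfolding chain_in_def by auto
    ultimately show "z \<in> mball_of X x \<epsilon>" using assms(2) by simp
  qed
qed

lemma linked_imp_chain_of_small_diameter:
  assumes "linked X \<eta> l (mball_of X z \<epsilon>) x y" "0 < \<epsilon>"
  obtains k c where "k \<le> l" "chain_in X \<eta> k x y c" "diameter_in X (c ` {0..k}) < 3 * \<epsilon>"
proof -
  obtain k c where kc: "k \<le> l" "chain_in X \<eta> k x y c" "c ` {0..k} \<subseteq> mball_of X z \<epsilon>"
    using linked_imp_chain_in[OF assms(1)] .
  have "mdist X u v \<le> 2 * \<epsilon>" if "u \<in> c ` {0..k}" "v \<in> c ` {0..k}" for u v
  proof -
    have "u \<in> mball_of X z \<epsilon>" "v \<in> mball_of X z \<epsilon>" using that kc(3) by blast+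
    then show ?thesis using mdist_triangle[of u X z v] by (auto simp: mdist_commute)
  qed
  then have "diameter_in X (c ` {0..k}) \<le> 2 * \<epsilon>" by (intro diameter_in_le) auto
  then show thesis using that kc assms(2) by fastforce
qed

text \<open>A chain of small diameter stays in a ball round its starting point; conversely a chain
  in a ball has at most twice the radius as diameter.\<close>

lemma locally_chain_connected_at_iff:
  "locally_chain_connected_at Y Y0 \<longleftrightarrow>
    (\<forall>x0\<in>Y0. \<forall>\<epsilon>>0. \<exists>\<delta>>0. \<forall>\<eta>>0. \<forall>x\<in>Y0. mdist Y x x0 < \<delta> \<longrightarrow>
       (\<exists>l. linked Y \<eta> l (mball_of Y x0 \<epsilon>) x0 x))" (is "?L \<longleftrightarrow> ?R")
proof
  assume L: ?L
  show ?R
  proof (intro ballI allI impI)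
    fix x0 and \<epsilon> :: real assume *: "x0 \<in> Y0" "0 < \<epsilon>"
    obtain \<delta> where d: "0 < \<delta>" "\<forall>\<eta>>0. \<forall>x\<in>Y0. mdist Y x x0 < \<delta> \<longrightarrow>
        (\<exists>l c. chain_in Y \<eta> l x0 x c \<and> diameter_in Y (c ` {0..l}) < \<epsilon>)"
      using L[unfolded locally_chain_connected_at_def, THEN bspec, OF *(1), THEN spec, THEN mp,
          OF *(2)] by (elim exE conjE)
    show "\<exists>\<delta>>0. \<forall>\<eta>>0. \<forall>x\<in>Y0. mdist Y x x0 < \<delta> \<longrightarrow>
        (\<exists>l. linked Y \<eta> l (mball_of Y x0 \<epsilon>) x0 x)"
    proof (intro exI[of _ \<delta>] conjI allI ballI impI d(1))
      fix \<eta> :: real and x assume "0 < \<eta>" "x \<in> Y0" "mdist Y x x0 < \<delta>"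
      from d(2)[rule_format, OF this]
      obtain l c where "chain_in Y \<eta> l x0 x c" "diameter_in Y (c ` {0..l}) < \<epsilon>"
        by (elim exE conjE)
      from chain_of_small_diameter_imp_linked[OF this]
      show "\<exists>l. linked Y \<eta> l (mball_of Y x0 \<epsilon>) x0 x" ..
    qed
  qed
next
  assume R: ?R
  show ?L unfolding locally_chain_connected_at_def
  proof (intro ballI allI impI)
    fix x0 and \<epsilon> :: real assume x0: "x0 \<in> Y0" and e: "0 < \<epsilon>"
    then have e3: "0 < \<epsilon> / 3" by simp
    obtain \<delta> where d: "0 < \<delta>" "\<forall>\<eta>>0. \<forall>x\<in>Y0. mdist Y x x0 < \<delta> \<longrightarrow>
       (\<exists>l. linked Y \<eta> l (mball_of Y x0 (\<epsilon> / 3)) x0 x)"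
      using R[THEN bspec, OF x0, THEN spec, THEN mp, OF e3] by (elim exE conjE)
    have "\<exists>l c. chain_in Y \<eta> l x0 x c \<and> diameter_in Y (c ` {0..l}) < \<epsilon>"
      if h: "0 < \<eta>" "x \<in> Y0" "mdist Y x x0 < \<delta>" for \<eta> x
    proof -
      obtain l where "linked Y \<eta> l (mball_of Y x0 (\<epsilon> / 3)) x0 x" using d(2)[rule_format, OF h] ..
      then obtain k c where "chain_in Y \<eta> k x0 x c" "diameter_in Y (c ` {0..k}) < 3 * (\<epsilon> / 3)"
        using linked_imp_chain_of_small_diameter e3 by metis
      then show ?thesis by auto
    qed
    then show "\<exists>\<delta>>0. \<forall>\<eta>>0. \<forall>x\<in>Y0. mdist Y x x0 < \<delta> \<longrightarrow>
        (\<exists>l c. chain_in Y \<eta> l x0 x c \<and> diameter_in Y (c ` {0..l}) < \<epsilon>)"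
      by (intro exI[of _ \<delta>] conjI d(1) allI ballI impI)
  qed
qed

lemma uniformly_locally_chain_equiconnected_at_iff:
  "uniformly_locally_chain_equiconnected_at Y Y0 \<longleftrightarrow>
    (\<forall>\<epsilon>>0. \<exists>\<delta>>0. \<forall>\<eta>>0. \<exists>l. \<forall>x\<in>Y0. \<forall>y\<in>Y0. mdist Y x y < \<delta> \<longrightarrow>
       linked Y \<eta> l (mball_of Y x \<epsilon>) x y)" (is "?L \<longleftrightarrow> ?R")
proof
  assume L: ?L
  show ?R
  proof (intro allI impI)
    fix \<epsilon> :: real assume "0 < \<epsilon>"
    then obtain \<delta> where d: "0 < \<delta>" "\<And>\<eta>. 0 < \<eta> \<Longrightarrow> \<exists>l. \<forall>x\<in>Y0. \<forall>y\<in>Y0. mdist Y x y < \<delta> \<longrightarrow>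
        (\<exists>k\<le>l. \<exists>c. chain_in Y \<eta> k x y c \<and> diameter_in Y (c ` {0..k}) < \<epsilon>)"
      using L unfolding uniformly_locally_chain_equiconnected_at_def by blast
    have "\<exists>l. \<forall>x\<in>Y0. \<forall>y\<in>Y0. mdist Y x y < \<delta> \<longrightarrow> linked Y \<eta> l (mball_of Y x \<epsilon>) x y" if "0 < \<eta>" for \<eta>
    proof -
      obtain l where "\<forall>x\<in>Y0. \<forall>y\<in>Y0. mdist Y x y < \<delta> \<longrightarrow>
        (\<exists>k\<le>l. \<exists>c. chain_in Y \<eta> k x y c \<and> diameter_in Y (c ` {0..k}) < \<epsilon>)" using d(2)[OF \<open>0 < \<eta>\<close>] ..
      then show ?thesis
        using chain_of_small_diameter_imp_linked linked_mono[OF _ order_refl _ subset_refl] by metis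
    qed
    then show "\<exists>\<delta>>0. \<forall>\<eta>>0. \<exists>l. \<forall>x\<in>Y0. \<forall>y\<in>Y0. mdist Y x y < \<delta> \<longrightarrow>
       linked Y \<eta> l (mball_of Y x \<epsilon>) x y" using d(1) by blast
  qed
next
  assume R: ?R
  show ?L unfolding uniformly_locally_chain_equiconnected_at_def
  proof (intro allI impI)
    fix \<epsilon> :: real assume "0 < \<epsilon>"
    then have e3: "0 < \<epsilon> / 3" by simp
    obtain \<delta> where d: "0 < \<delta>" "\<And>\<eta>. 0 < \<eta> \<Longrightarrow> \<exists>l. \<forall>x\<in>Y0. \<forall>y\<in>Y0. mdist Y x y < \<delta> \<longrightarrow>
       linked Y \<eta> l (mball_of Y x (\<epsilon> / 3)) x y"
      using R[rule_format, OF e3] by blast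
    have "\<exists>l. \<forall>x\<in>Y0. \<forall>y\<in>Y0. mdist Y x y < \<delta> \<longrightarrow>
        (\<exists>k\<le>l. \<exists>c. chain_in Y \<eta> k x y c \<and> diameter_in Y (c ` {0..k}) < \<epsilon>)" if "0 < \<eta>" for \<eta>
    proof -
      obtain l where l: "\<forall>x\<in>Y0. \<forall>y\<in>Y0. mdist Y x y < \<delta> \<longrightarrow>
        linked Y \<eta> l (mball_of Y x (\<epsilon> / 3)) x y" using d(2)[OF \<open>0 < \<eta>\<close>] ..
      have "\<exists>k\<le>l. \<exists>c. chain_in Y \<eta> k x y c \<and> diameter_in Y (c ` {0..k}) < \<epsilon>"
        if xy: "x \<in> Y0" "y \<in> Y0" "mdist Y x y < \<delta>" for x y
      proof -
        have "linked Y \<eta> l (mball_of Y x (\<epsilon> / 3)) x y" using l xy by blast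
        then obtain k c where "k \<le> l" "chain_in Y \<eta> k x y c"
            "diameter_in Y (c ` {0..k}) < 3 * (\<epsilon> / 3)"
          using linked_imp_chain_of_small_diameter e3 by metis
        then show ?thesis by auto
      qed
      then show ?thesis by blast
    qed
    then show "\<exists>\<delta>>0. \<forall>\<eta>>0. \<exists>l. \<forall>x\<in>Y0. \<forall>y\<in>Y0. mdist Y x y < \<delta> \<longrightarrow>
        (\<exists>k\<le>l. \<exists>c. chain_in Y \<eta> k x y c \<and> diameter_in Y (c ` {0..k}) < \<epsilon>)" using d(1) by blast
  qed
qed

section \<open>Separated sets and Cauchy sequences in the discrete hyperspace\<close>

definition separated_in :: "'a metric \<Rightarrow> real \<Rightarrow> 'a set \<Rightarrow> bool" where
  "separated_in X r D \<longleftrightarrow> D \<subseteq> mspace X \<and> (\<forall>x\<in>D. \<forall>y\<in>D. x \<noteq> y \<longrightarrow> r \<le> mdist X x y)"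

lemma separated_in_eqI:
  "separated_in X r D \<Longrightarrow> x \<in> D \<Longrightarrow> y \<in> D \<Longrightarrow> mdist X x y < r \<Longrightarrow> x = y"
  unfolding separated_in_def by fastforce

lemma in_Bd_D0I:
  assumes "D \<subseteq> mspace X" "D \<noteq> {}" "mtopology_of X derived_set_of D = {}" "countable D"
    and "bounded_in X D" "totally_bounded_in X D \<or> uniformly_discrete_in X D"
  shows "D \<in> bounded_hyperspace X \<inter> D0 X"
proof -
  have "closedin (mtopology_of X) D"
    using assms(1,3) by (auto simp: closedin_contains_derived_set)
  moreover have "subtopology (mtopology_of X) D = discrete_topology D"
    using assms(1,3) by (simp add: subtopology_eq_discrete_topology_eq)
  ultimately show ?thesis
    using assms by (auto simp: bounded_hyperspace_def closed_hyperspace_def D0_def)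
qed

lemma separated_in_Bd_D0:
  assumes sep: "separated_in X r D" and r: "0 < r" and "D \<noteq> {}" "countable D" "bounded_in X D"
  shows "D \<in> bounded_hyperspace X \<inter> D0 X"
proof -
  interpret Metric_space "mspace X" "mdist X" by simp
  have sub: "D \<subseteq> mspace X" using sep unfolding separated_in_def by simp
  have small: "u = v" if "x \<in> mspace X" "u \<in> D \<inter> mball x (r/2)" "v \<in> D \<inter> mball x (r/2)" for x u v
    using that triangle[of u x v] commute[of u x]
    by (intro separated_in_eqI[OF sep]) auto
  have "mtopology derived_set_of D = {}"
  proof (rule ccontr)
    assume "mtopology derived_set_of D \<noteq> {}"
    then obtain x where x: "x \<in> mspace X" and inf: "\<And>e. 0 < e \<Longrightarrow> infinite (D \<inter> mball x e)"
      unfolding derived_set_of_infinite_mball by blast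
    have "infinite (D \<inter> mball x (r/2))" using inf r by simp
    then obtain u where "u \<in> D \<inter> mball x (r/2)" by (metis finite.emptyI equals0I)
    then have "D \<inter> mball x (r/2) \<subseteq> {u}" using small[OF x] by blast
    then show False using \<open>infinite (D \<inter> mball x (r/2))\<close> finite_subset by blast
  qed
  moreover have "uniformly_discrete_in X D"
    unfolding uniformly_discrete_in_def
  proof (intro conjI exI[of _ "r/2"] ballI sub)
    fix x assume x: "x \<in> mspace X"
    have "\<exists>u. D \<inter> mball x (r/2) \<subseteq> {u}" using small[OF x] by blast
    then obtain u where u: "D \<inter> mball_of X x (r/2) \<subseteq> {u}" by (auto simp: mball_of_def)
    then show "finite (D \<inter> mball_of X x (r/2))" using finite_subset by blast
    show "card (D \<inter> mball_of X x (r/2)) \<le> 1" using card_mono[OF _ u] by simp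
  qed (use r in simp)
  ultimately show ?thesis using assms sub by (intro in_Bd_D0I) (auto simp: mtopology_of_def)
qed

text \<open>A Cauchy sequence either converges to a cluster point of its range, or its range is closed
  and discrete. This lemma and the next one treat the two cases.\<close>

lemma Cauchy_range_Bd_D0:
  assumes "Metric_space.MCauchy (mspace X) (mdist X) p"
    and "mtopology_of X derived_set_of (range p) = {}"
  shows "range p \<in> bounded_hyperspace X \<inter> D0 X"
proof -
  interpret Metric_space "mspace X" "mdist X" by simp
  have "mtotally_bounded (range p)" by (rule mtotally_bounded_cauchy_sequence[OF assms(1)])
  then show ?thesis
    using assms mtotally_bounded_imp_mbounded[of "range p"] mtotally_bounded_imp_subset[of "range p"]
    by (intro in_Bd_D0I) (auto simp: totally_bounded_in_def bounded_in_def)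
qed

lemma Cauchy_cluster_point_limit:
  assumes "Metric_space.MCauchy (mspace X) (mdist X) p"
    and "mtopology_of X derived_set_of (range p) \<noteq> {}"
  obtains c where "c \<in> mspace X" "\<And>e. 0 < e \<Longrightarrow> \<exists>N. \<forall>n\<ge>N. mdist X c (p n) < e"
proof -
  interpret Metric_space "mspace X" "mdist X" by simp
  obtain c where c: "c \<in> mspace X" and inf: "\<And>e. 0 < e \<Longrightarrow> infinite (range p \<inter> mball c e)"
    using assms(2) unfolding mtopology_of_def derived_set_of_infinite_mball by blast
  have p: "p n \<in> mspace X" for n using assms(1) unfolding MCauchy_def by blast
  have "\<exists>N. \<forall>n\<ge>N. mdist X c (p n) < e" if e: "0 < e" for e
  proof -
    obtain N where N: "\<And>n n'. N \<le> n \<Longrightarrow> N \<le> n' \<Longrightarrow> mdist X (p n) (p n') < e / 2"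
      using assms(1) e unfolding MCauchy_def by (meson half_gt_zero)
    have "\<not> range p \<inter> mball c (e/2) \<subseteq> p ` {..N}"
      using inf[of "e/2"] e finite_subset[of _ "p ` {..N}"] by auto
    then obtain j where "p j \<in> mball c (e/2)" "p j \<notin> p ` {..N}" by blast
    then have j: "mdist X c (p j) < e / 2" "\<not> j \<le> N" by auto
    have "mdist X c (p n) < e" if "n \<ge> N" for n
      using triangle[OF c p[of j] p[of n]] j N[of j n] that by linarith
    then show ?thesis by blast
  qed
  then show thesis using c that by blast
qed

text \<open>A maximal \<open>t\<close>-separated subset is a \<open>t\<close>-net. Replacing a set by such a net is what brings
  arbitrary countable perturbations back into the family of discrete sets.\<close>

lemma separated_net:
  assumes "S \<subseteq> mspace X" "0 < t"
  obtains E where "E \<subseteq> S" "separated_in X t E" "\<And>s. s \<in> S \<Longrightarrow> \<exists>e\<in>E. mdist X s e < t"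
proof -
  let ?A = "{E. E \<subseteq> S \<and> separated_in X t E}"
  have "\<exists>M\<in>?A. \<forall>E\<in>?A. M \<subseteq> E \<longrightarrow> E = M"
  proof (rule subset_Zorn')
    fix C assume C: "subset.chain ?A C"
    then have sub: "C \<subseteq> ?A" and total: "\<And>E F. E \<in> C \<Longrightarrow> F \<in> C \<Longrightarrow> E \<subseteq> F \<or> F \<subseteq> E"
      unfolding subset_chain_def by blast+
    have "t \<le> mdist X x y" if xy: "x \<in> \<Union>C" "y \<in> \<Union>C" "x \<noteq> y" for x y
    proof -
      obtain E F where "E \<in> C" "x \<in> E" "F \<in> C" "y \<in> F" using xy by blast
      then obtain G where "G \<in> C" "x \<in> G" "y \<in> G" using total by blast
      then show ?thesis using sub xy(3) unfolding separated_in_def by blast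
    qed
    moreover have "\<Union>C \<subseteq> S" using sub by blast
    ultimately show "\<Union>C \<in> ?A" using assms(1) unfolding separated_in_def by blast
  qed
  then obtain E where "E \<in> ?A" and max: "\<forall>F\<in>?A. E \<subseteq> F \<longrightarrow> F = E" by (rule bexE)
  then have E: "E \<subseteq> S" "separated_in X t E" by simp_all
  have "\<exists>e\<in>E. mdist X s e < t" if s: "s \<in> S" for s
  proof (rule ccontr)
    assume "\<not> ?thesis"
    then have far: "\<And>e. e \<in> E \<Longrightarrow> t \<le> mdist X s e" by force
    then have "\<And>e. e \<in> E \<Longrightarrow> t \<le> mdist X e s" by (subst mdist_commute)
    with far have "separated_in X t (insert s E)"
      using E(2) s assms(1) unfolding separated_in_def by (auto dest: subsetD)
    then have "insert s E = E" using max[THEN bspec, of "insert s E"] E(1) s by blast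
    then have "s \<in> E" by blast
    moreover have "mdist X s s = 0" using s assms(1) by auto
    ultimately show False using far[of s] assms(2) by simp
  qed
  then show thesis using E that by blast
qed

section \<open>From chains of sets to chains of points\<close>

text \<open>Starting from a point of the last set, a near point of each preceding set is chosen in turn.
  The length of the resulting chain does not depend on the point.\<close>

lemma linked_Bd_imp_linked:
  assumes "linked (Bd X) \<eta> l (mball_of (Bd X) D \<epsilon>) A A'" "a' \<in> A'"
  shows "\<exists>a\<in>A. linked X \<eta> l {z. \<exists>u\<in>D. mdist X u z < \<epsilon>} a a'"
proof -
  let ?R = "step_rel (Bd X) \<eta> (mball_of (Bd X) D \<epsilon>)"
  let ?S = "{z. \<exists>u\<in>D. mdist X u z < \<epsilon>}"
  have in_S: "z \<in> ?S \<inter> mspace X" if "C \<in> mball_of (Bd X) D \<epsilon>" "z \<in> C" for C z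
  proof -
    have "near_in X \<epsilon> C D" "C \<subseteq> mspace X"
      using that near_in_of_mdist_Bd[of D X C \<epsilon>] bounded_hyperspaceD(2)[of C X] by auto
    then obtain u where "u \<in> D" "mdist X z u < \<epsilon>"
      using \<open>z \<in> C\<close> unfolding near_in_def by blast
    then show ?thesis using \<open>z \<in> C\<close> \<open>C \<subseteq> mspace X\<close> mdist_commute[of X z u] by auto
  qed
  obtain k where k: "k \<le> l" "(A, A') \<in> ?R ^^ k" and A: "A \<in> mball_of (Bd X) D \<epsilon>"
    using assms(1) unfolding linked_def by blast
  have "\<forall>a'\<in>A'. \<exists>a\<in>A. (a, a') \<in> step_rel X \<eta> ?S ^^ k" using k(2)
  proof (induction k arbitrary: A')
    case 0 then show ?case by auto
  next
    case (Suc k)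
    then obtain C where C: "(A, C) \<in> ?R ^^ k" "(C, A') \<in> ?R" by auto
    have CA': "C \<in> mball_of (Bd X) D \<epsilon>" "A' \<in> mball_of (Bd X) D \<epsilon>" "mdist (Bd X) C A' < \<eta>"
      using C(2) unfolding step_rel_def by auto
    show ?case
    proof
      fix a' assume a': "a' \<in> A'"
      obtain c where c: "c \<in> C" "mdist X a' c < \<eta>"
        using near_in_of_mdist_Bd(2)[of C X A' \<eta>] CA' a' unfolding near_in_def by auto
      obtain a where "a \<in> A" "(a, c) \<in> step_rel X \<eta> ?S ^^ k" using Suc.IH[OF C(1)] c(1) by blast
      moreover have "(c, a') \<in> step_rel X \<eta> ?S"
        using in_S[OF CA'(1) c(1)] in_S[OF CA'(2) a'] c(2)
        unfolding step_rel_def by (simp add: mdist_commute)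
      ultimately show "\<exists>a\<in>A. (a, a') \<in> step_rel X \<eta> ?S ^^ Suc k" by auto
    qed
  qed
  then show ?thesis using in_S[OF A] k(1) assms(2) unfolding linked_def by blast
qed

text \<open>Around a set whose points are far apart, a chain of small steps cannot jump from the
  neighbourhood of one point to that of another.\<close>

lemma linked_confined:
  assumes sep: "separated_in X r D" and r: "2 * \<rho> + \<eta> \<le> r" and u: "u \<in> D" "mdist X u x < \<rho>"
    and link: "linked X \<eta> l {z. \<exists>v\<in>D. mdist X v z < \<rho>} x y"
  shows "linked X \<eta> l (mball_of X u \<rho>) x y"
proof -
  let ?S = "{z. \<exists>v\<in>D. mdist X v z < \<rho>}"
  have sub: "D \<subseteq> mspace X" using sep unfolding separated_in_def by simp
  obtain k where k: "k \<le> l" "(x, y) \<in> step_rel X \<eta> ?S ^^ k" and x: "x \<in> mspace X"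
    using link unfolding linked_def by blast
  have "(x, y) \<in> step_rel X \<eta> (mball_of X u \<rho>) ^^ k \<and> y \<in> mball_of X u \<rho>" using k(2)
  proof (induction k arbitrary: y)
    case 0 then show ?case using u x sub by auto
  next
    case (Suc k)
    then obtain z where z: "(x, z) \<in> step_rel X \<eta> ?S ^^ k" "(z, y) \<in> step_rel X \<eta> ?S" by auto
    have zu: "(x, z) \<in> step_rel X \<eta> (mball_of X u \<rho>) ^^ k" "z \<in> mball_of X u \<rho>"
      using Suc.IH[OF z(1)] by auto
    obtain v where v: "v \<in> D" "mdist X v y < \<rho>" and zy: "z \<in> mspace X" "y \<in> mspace X" "mdist X z y < \<eta>"
      using z(2) unfolding step_rel_def by auto
    have uv: "u \<in> mspace X" "v \<in> mspace X" using u v sub by auto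
    have "mdist X u v < r"
      using mdist_triangle[of u X z v] mdist_triangle[of z X y v] mdist_commute[of X v y] zu(2) zy uv v(2) r
      by auto
    then have "u = v" using separated_in_eqI[OF sep u(1) v(1)] by simp
    then have y: "y \<in> mball_of X u \<rho>" using v zy uv by simp
    then have "(z, y) \<in> step_rel X \<eta> (mball_of X u \<rho>)" using zu zy unfolding step_rel_def by auto
    then show ?case using zu y by auto
  qed
  then show ?thesis using k(1) x u sub unfolding linked_def by auto
qed

lemma not_linked_witnesses:
  assumes "\<nexists>l. \<forall>p\<in>P. \<forall>y\<in>Q. R p y \<longrightarrow> linked X \<eta> l (S p) p y"
  obtains p y where "\<And>l::nat. p l \<in> P \<and> y l \<in> Q \<and> R (p l) (y l) \<and> \<not> linked X \<eta> l (S (p l)) (p l) (y l)"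
proof -
  have "\<forall>l. \<exists>q. fst q \<in> P \<and> snd q \<in> Q \<and> R (fst q) (snd q) \<and> \<not> linked X \<eta> l (S (fst q)) (fst q) (snd q)"
    using assms by fastforce
  from choice[OF this] obtain f where "\<And>l::nat. fst (f l) \<in> P \<and> snd (f l) \<in> Q \<and>
      R (fst (f l)) (snd (f l)) \<and> \<not> linked X \<eta> l (S (fst (f l))) (fst (f l)) (snd (f l))" by blast
  then show thesis using that[of "\<lambda>l. fst (f l)" "\<lambda>l. snd (f l)"] by blast
qed

text \<open>Adding a sequence of points near \<open>D\<close> to \<open>D\<close> and passing to a separated net produces a
  discrete set that is Hausdorff close to \<open>D\<close> and comes within \<open>t\<close> of every added point.
  Chains of sets from \<open>D\<close> to it therefore reach all points of the sequence, up to one step.\<close>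

lemma net_perturbation:
  assumes D: "D \<in> bounded_hyperspace X" "countable D"
    and y: "\<And>l::nat. y l \<in> mspace X" "\<And>l. \<exists>p\<in>D. mdist X p (y l) < \<delta>"
    and t: "0 < t" "t \<le> \<delta>"
  obtains D' where "D' \<in> bounded_hyperspace X \<inter> D0 X" "mdist (Bd X) D' D \<le> \<delta>"
    "\<And>l. \<exists>e\<in>D'. mdist X (y l) e < t"
proof -
  have sub: "D \<union> range y \<subseteq> mspace X" using bounded_hyperspaceD(2)[OF D(1)] y(1) by auto
  obtain E where E: "E \<subseteq> D \<union> range y" "separated_in X t E"
      "\<And>s. s \<in> D \<union> range y \<Longrightarrow> \<exists>e\<in>E. mdist X s e < t"
    using separated_net[OF sub t(1)] by blast
  have near: "near_in X \<delta> D E"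
    unfolding near_in_def using E(3) t(2) by (meson UnI1 order_less_le_trans)
  have near': "near_in X \<delta> E D"
    unfolding near_in_def
  proof
    fix e assume "e \<in> E"
    then consider "e \<in> D" | l where "e = y l" using E(1) by blast
    then show "\<exists>p\<in>D. mdist X e p < \<delta>"
    proof cases
      case 1
      then show ?thesis using sub t by (intro bexI[of _ e]) auto
    next
      case 2
      then show ?thesis using y(2)[of l] by (metis mdist_commute)
    qed
  qed
  have "bounded_in X E"
  proof (rule bounded_in_neighbourhood[OF bounded_hyperspaceD(4)[OF D(1)]])
    show "\<exists>p\<in>D. mdist X e p \<le> \<delta>" if "e \<in> E" for e
      using near' that unfolding near_in_def by (meson less_imp_le)
  qed (use E(1) sub in blast)
  moreover have "countable E" by (rule countable_subset[OF E(1)]) (simp add: D(2))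
  moreover have "E \<noteq> {}" using near bounded_hyperspaceD(1)[OF D(1)] unfolding near_in_def by blast
  ultimately have "E \<in> bounded_hyperspace X \<inter> D0 X" by (intro separated_in_Bd_D0[OF E(2) t(1)])
  moreover have "mdist (Bd X) E D \<le> \<delta>" using mdist_Bd_le_of_near_in[OF near' near] t by simp
  ultimately show thesis using that[of E] E(3) by blast
qed

abbreviation discretely_chain_connected_Bd :: "'a metric \<Rightarrow> bool" where
  "discretely_chain_connected_Bd X \<equiv>
     locally_chain_connected_at (Bd X) (bounded_hyperspace X \<inter> D0 X)"

lemma discretely_chain_connected_BdE:
  assumes "discretely_chain_connected_Bd X" "D \<in> bounded_hyperspace X \<inter> D0 X" "0 < \<epsilon>"
  obtains \<delta> where "0 < \<delta>"
    "\<And>\<eta> D'. 0 < \<eta> \<Longrightarrow> D' \<in> bounded_hyperspace X \<inter> D0 X \<Longrightarrow> mdist (Bd X) D' D < \<delta> \<Longrightarrow>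
       \<exists>l. linked (Bd X) \<eta> l (mball_of (Bd X) D \<epsilon>) D D'"
proof -
  have "\<exists>\<delta>>0. \<forall>\<eta>>0. \<forall>x\<in>bounded_hyperspace X \<inter> D0 X. mdist (Bd X) x D < \<delta> \<longrightarrow>
      (\<exists>l. linked (Bd X) \<eta> l (mball_of (Bd X) D \<epsilon>) D x)"
    using assms(1)[unfolded locally_chain_connected_at_iff, THEN bspec, OF assms(2), THEN spec,
        THEN mp, OF assms(3)] .
  then obtain \<delta> where d: "0 < \<delta>" "\<forall>\<eta>>0. \<forall>x\<in>bounded_hyperspace X \<inter> D0 X. mdist (Bd X) x D < \<delta> \<longrightarrow>
      (\<exists>l. linked (Bd X) \<eta> l (mball_of (Bd X) D \<epsilon>) D x)" by (elim exE conjE)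
  show thesis by (rule that[OF d(1) d(2)[rule_format]])
qed

section \<open>Uniform chain lengths near discrete sets\<close>

text \<open>If for some step size the chain lengths were unbounded, then points \<open>y l\<close> close to points
  \<open>p l\<close> of \<open>D\<close> would need chains longer than \<open>l\<close>. But a single chain of sets, of length \<open>K\<close>,
  connects \<open>D\<close> to its perturbation by all the \<open>y l\<close>, and by confinement it induces chains of length
  \<open>K + 1\<close> from \<open>y l\<close> to \<open>p l\<close>.\<close>

lemma uniform_links_near_separated_set:
  assumes lcc: "discretely_chain_connected_Bd X"
    and sep: "separated_in X r D" and r: "0 < r" and D: "D \<noteq> {}" "countable D" "bounded_in X D"
    and eps: "0 < \<epsilon>"
  shows "\<exists>\<delta>>0. \<forall>\<eta>>0. \<exists>l. \<forall>p\<in>D. \<forall>y\<in>mspace X. mdist X p y < \<delta> \<longrightarrow>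
           linked X \<eta> l (mball_of X p \<epsilon>) p y"
proof -
  (* Confinement to balls of radius 2 * \<epsilon>' with steps of at most \<epsilon>' needs 5 * \<epsilon>' \<le> r. *)
  define \<epsilon>' where "\<epsilon>' = min \<epsilon> r / 10"
  have e': "0 < \<epsilon>'" "10 * \<epsilon>' \<le> \<epsilon>" "10 * \<epsilon>' \<le> r" using eps r unfolding \<epsilon>'_def by auto
  have DD: "D \<in> bounded_hyperspace X \<inter> D0 X" by (rule separated_in_Bd_D0[OF sep r D])
  have sub: "D \<subseteq> mspace X" using sep unfolding separated_in_def by simp
  obtain \<delta>0 where d0: "0 < \<delta>0" and lk:
    "\<And>\<eta> D'. 0 < \<eta> \<Longrightarrow> D' \<in> bounded_hyperspace X \<inter> D0 X \<Longrightarrow> mdist (Bd X) D' D < \<delta>0 \<Longrightarrow>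
       \<exists>l. linked (Bd X) \<eta> l (mball_of (Bd X) D \<epsilon>') D D'"
    using discretely_chain_connected_BdE[OF lcc DD e'(1)] by blast
  define \<delta> where "\<delta> = min \<delta>0 \<epsilon>' / 2"
  have d: "0 < \<delta>" "\<delta> < \<delta>0" "\<delta> < \<epsilon>'" using d0 e' unfolding \<delta>_def by (auto simp: min_def)
  have "\<exists>l. \<forall>p\<in>D. \<forall>y\<in>mspace X. mdist X p y < \<delta> \<longrightarrow> linked X \<eta> l (mball_of X p \<epsilon>) p y"
    if eta: "0 < \<eta>" for \<eta>
  proof (rule ccontr)
    assume "\<not> ?thesis"
    then obtain p y where py: "\<And>l::nat. p l \<in> D \<and> y l \<in> mspace X \<and> mdist X (p l) (y l) < \<delta> \<and>
        \<not> linked X \<eta> l (mball_of X (p l) \<epsilon>) (p l) (y l)"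
      by (rule not_linked_witnesses) (rule that, blast)
    define \<eta>' where "\<eta>' = min \<eta> \<epsilon>'"
    have eta': "0 < \<eta>'" "\<eta>' \<le> \<eta>" "\<eta>' \<le> \<epsilon>'" using eta e' unfolding \<eta>'_def by auto
    obtain D' where D': "D' \<in> bounded_hyperspace X \<inter> D0 X" "mdist (Bd X) D' D \<le> \<delta>"
      and net: "\<And>l. \<exists>e\<in>D'. mdist X (y l) e < min \<eta>' \<delta>"
    proof (rule net_perturbation[of D X y \<delta> "min \<eta>' \<delta>"])
      show "\<exists>p\<in>D. mdist X p (y l) < \<delta>" for l using py[of l] by blast
    qed (use DD D(2) py eta' d in auto)
    obtain K where K: "linked (Bd X) \<eta>' K (mball_of (Bd X) D \<epsilon>') D D'"
      using lk[OF eta'(1) D'(1)] D'(2) d by auto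
    define l where "l = K + 1"
    obtain e where e: "e \<in> D'" "mdist X (y l) e < \<eta>'" using net[of l] by auto
    obtain a where a: "a \<in> D" "linked X \<eta>' K {z. \<exists>u\<in>D. mdist X u z < \<epsilon>'} a e"
      using linked_Bd_imp_linked[OF K e(1)] by blast
    have pl: "p l \<in> D" "p l \<in> mspace X" "y l \<in> mspace X" "mdist X (p l) (y l) < \<delta>"
      using py[of l] sub by auto
    have em: "e \<in> mspace X" using linked_in[OF a(2)] by simp
    have "mdist X (p l) e < 2 * \<epsilon>'"
      using mdist_triangle[of "p l" X "y l" e] pl em e(2) eta'(3) d by auto
    moreover have "linked X \<eta>' K {z. \<exists>u\<in>D. mdist X u z < 2 * \<epsilon>'} e a"
    proof (rule linked_sym, rule linked_mono[OF a(2) order_refl order_refl])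
      have "mdist X u z < 2 * \<epsilon>'" if "mdist X u z < \<epsilon>'" for u z using that e'(1) by linarith
      then show "{z. \<exists>u\<in>D. mdist X u z < \<epsilon>'} \<subseteq> {z. \<exists>u\<in>D. mdist X u z < 2 * \<epsilon>'}" by blast
    qed
    ultimately have ea: "linked X \<eta>' K (mball_of X (p l) (2 * \<epsilon>')) e a"
      using e' eta' by (intro linked_confined[OF sep _ pl(1)]) auto
    have "a = p l"
      using linked_in(3)[OF ea] e' by (intro separated_in_eqI[OF sep a(1) pl(1)]) (auto simp: mdist_commute)
    moreover have "linked X \<eta>' 1 (mball_of X (p l) (2 * \<epsilon>')) e (y l)"
      using linked_in(1)[OF ea] pl em e(2) d by (intro linked_step) (auto simp: mdist_commute)
    ultimately have "linked X \<eta>' l (mball_of X (p l) (2 * \<epsilon>')) (p l) (y l)"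
      using linked_trans[OF linked_sym[OF ea]] unfolding l_def by blast
    then have "linked X \<eta> l (mball_of X (p l) \<epsilon>) (p l) (y l)"
      by (rule linked_mono) (use eta' e' in auto)
    then show False using py[of l] by blast
  qed
  then show ?thesis using d(1) by blast
qed

section \<open>Uniform chain lengths near Cauchy sequences\<close>

lemma separated_in_range:
  fixes w :: "nat \<Rightarrow> 'a"
  assumes "\<And>i. w i \<in> mspace X" "\<And>i j. i < j \<Longrightarrow> r \<le> mdist X (w i) (w j)"
  shows "separated_in X r (range w)"
  unfolding separated_in_def
proof (intro conjI ballI impI)
  show "range w \<subseteq> mspace X" using assms(1) by blast
  fix u v assume "u \<in> range w" "v \<in> range w" "u \<noteq> v"
  then obtain i j where ij: "u = w i" "v = w j" "i \<noteq> j" by blast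
  from ij(3) show "r \<le> mdist X u v"
  proof (rule linorder_neqE_nat)
    assume "j < i"
    then have "r \<le> mdist X (w j) (w i)" by (rule assms(2))
    then show ?thesis unfolding ij by (simp add: mdist_commute)
  qed (unfold ij, rule assms(2))
qed

lemma MCauchyE:
  assumes "Metric_space.MCauchy (mspace X) (mdist X) p"
  shows "p n \<in> mspace X"
    and "0 < e \<Longrightarrow> \<exists>N. \<forall>n\<ge>N. \<forall>m\<ge>N. mdist X (p n) (p m) < e"
proof -
  interpret Metric_space "mspace X" "mdist X" by simp
  show "p n \<in> mspace X" using assms unfolding MCauchy_def by blast
  show "\<exists>N. \<forall>n\<ge>N. \<forall>m\<ge>N. mdist X (p n) (p m) < e" if "0 < e"
    using conjunct2[OF assms[unfolded MCauchy_def], THEN spec, THEN mp, OF that] by auto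
qed

text \<open>The range of the sequence is Hausdorff close to a finite initial part. Chains of sets
  between them link each term, for every step size, to one of finitely many terms. The pigeonhole
  principle, applied first to the step sizes and then to the terms, selects one term that is linked
  to infinitely many others.\<close>

lemma Cauchy_subsequence_linked:
  assumes lcc: "discretely_chain_connected_Bd X"
    and cau: "Metric_space.MCauchy (mspace X) (mdist X) p"
    and der: "mtopology_of X derived_set_of (range p) = {}" and eps: "0 < \<epsilon>"
  shows "\<exists>b r. strict_mono (r :: nat \<Rightarrow> nat) \<and>
    (\<forall>j. \<forall>\<eta>>0. \<exists>l. linked X \<eta> l (mball_of X b \<epsilon>) b (p (r j)))"
proof -
  interpret Metric_space "mspace X" "mdist X" by simp
  obtain N where N: "\<And>n m. N \<le> n \<Longrightarrow> N \<le> m \<Longrightarrow> mdist X (p n) (p m) < \<epsilon> / 4"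
    using MCauchyE(2)[OF cau, of "\<epsilon> / 4"] eps by auto
  define q where "q = p \<circ> (+) N"
  have cq: "MCauchy q" unfolding q_def by (rule MCauchy_subsequence[OF _ cau]) (simp add: strict_mono_def)
  have qm: "q j \<in> mspace X" for j using MCauchyE(1)[OF cq] .
  have qq: "mdist X (q i) (q j) < \<epsilon> / 4" for i j unfolding q_def using N[of "N + i" "N + j"] by simp
  have "range q \<subseteq> range p" unfolding q_def by auto
  then have "mtopology_of X derived_set_of (range q) = {}"
    using der derived_set_of_mono[of "range q" "range p" "mtopology_of X"] by simp
  then have D: "range q \<in> bounded_hyperspace X \<inter> D0 X" by (rule Cauchy_range_Bd_D0[OF cq])
  have "0 < \<epsilon> / 4" using eps by simp
  then obtain \<delta> where d: "0 < \<delta>" and lk: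
    "\<And>\<eta> D'. 0 < \<eta> \<Longrightarrow> D' \<in> bounded_hyperspace X \<inter> D0 X \<Longrightarrow> mdist (Bd X) D' (range q) < \<delta> \<Longrightarrow>
       \<exists>l. linked (Bd X) \<eta> l (mball_of (Bd X) (range q) (\<epsilon> / 4)) (range q) D'"
    using discretely_chain_connected_BdE[OF lcc D] by blast
  obtain n where n: "\<And>j m. n \<le> j \<Longrightarrow> n \<le> m \<Longrightarrow> mdist X (q j) (q m) < \<delta> / 2"
    using MCauchyE(2)[OF cq, of "\<delta> / 2"] d by auto
  define F where "F = q ` {..n}"
  have Fsub: "F \<subseteq> range q" "finite F" unfolding F_def by auto
  have "mtopology_of X derived_set_of F = {}"
    using \<open>mtopology_of X derived_set_of (range q) = {}\<close> derived_set_of_mono[OF Fsub(1), of "mtopology_of X"]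
    by simp
  moreover have "mtotally_bounded F" using Fsub qm by (intro finite_imp_mtotally_bounded) auto
  ultimately have FD: "F \<in> bounded_hyperspace X \<inter> D0 X"
    using Fsub qm mtotally_bounded_imp_mbounded[of F]
    by (intro in_Bd_D0I) (auto simp: totally_bounded_in_def bounded_in_def F_def intro: countable_finite)
  have "near_in X (\<delta> / 2) F (range q)"
    by (rule near_in_mono[OF near_in_refl order_refl subset_refl Fsub(1)]) (use Fsub qm d in auto)
  moreover have "near_in X (\<delta> / 2) (range q) F"
    unfolding near_in_def
  proof
    fix a assume "a \<in> range q"
    then obtain j where j: "a = q j" by blast
    show "\<exists>b\<in>F. mdist X a b < \<delta> / 2"
    proof (cases "j \<le> n")
      case True then show ?thesis using j d qm unfolding F_def by (intro bexI[of _ "q j"]) auto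
    next
      case False then show ?thesis using j n[of j n] unfolding F_def by (intro bexI[of _ "q n"]) auto
    qed
  qed
  ultimately have dF: "mdist (Bd X) F (range q) < \<delta>"
    using mdist_Bd_le_of_near_in[of X "\<delta>/2" F "range q"] d by simp
  have link: "\<exists>i\<in>{..n}. \<exists>l. linked X \<eta> l (mball_of X (q i) \<epsilon>) (q i) (q j)" if eta: "0 < \<eta>" for \<eta> j
  proof -
    obtain l where l: "linked (Bd X) \<eta> l (mball_of (Bd X) (range q) (\<epsilon> / 4)) (range q) F"
      using lk[OF eta FD dF] by blast
    obtain a where a: "a \<in> F" "linked X \<eta> l {z. \<exists>u\<in>range q. mdist X u z < \<epsilon> / 4} a (q j)"
      using linked_Bd_imp_linked[OF linked_sym[OF l], of "q j"] by blast
    obtain i where i: "i \<le> n" "a = q i" using a(1) unfolding F_def by blast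
    have "linked X \<eta> l ({z. \<exists>u\<in>range q. mdist X u z < \<epsilon> / 4} \<inter> mspace X) a (q j)"
      using a(2) unfolding linked_def step_rel_def by auto
    then have "linked X \<eta> l (mball_of X (q i) \<epsilon>) a (q j)"
    proof (rule linked_mono[OF _ order_refl order_refl])
      show "{z. \<exists>u\<in>range q. mdist X u z < \<epsilon> / 4} \<inter> mspace X \<subseteq> mball_of X (q i) \<epsilon>"
      proof
        fix z assume "z \<in> {z. \<exists>u\<in>range q. mdist X u z < \<epsilon> / 4} \<inter> mspace X"
        then obtain k where "mdist X (q k) z < \<epsilon> / 4" "z \<in> mspace X" by blast
        then show "z \<in> mball_of X (q i) \<epsilon>"
          using mdist_triangle[OF qm qm, of z i k] qq[of i k] eps qm by auto
      qed
    qed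
    then show ?thesis using i by blast
  qed
  have "\<exists>i\<in>{..n}. \<forall>\<eta>>0. \<exists>l. linked X \<eta> l (mball_of X (q i) \<epsilon>) (q i) (q j)" for j
  proof (rule ccontr)
    assume "\<not> ?thesis"
    then have "\<forall>i\<in>{..n}. \<exists>\<eta>>0. \<forall>l. \<not> linked X \<eta> l (mball_of X (q i) \<epsilon>) (q i) (q j)" by blast
    from bchoice[OF this] obtain h where h: "\<And>i. i \<le> n \<Longrightarrow> 0 < h i"
        "\<And>i l. i \<le> n \<Longrightarrow> \<not> linked X (h i) l (mball_of X (q i) \<epsilon>) (q i) (q j)" by auto
    define \<eta> where "\<eta> = Min (h ` {..n})"
    have "0 < \<eta>" "\<And>i. i \<le> n \<Longrightarrow> \<eta> \<le> h i" unfolding \<eta>_def using h(1) by (auto simp: Min_gr_iff)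
    then obtain i l where i: "i \<le> n" "linked X \<eta> l (mball_of X (q i) \<epsilon>) (q i) (q j)"
      using link[of \<eta> j] by auto
    have "linked X (h i) l (mball_of X (q i) \<epsilon>) (q i) (q j)"
      by (rule linked_mono[OF i(2) _ order_refl subset_refl]) (rule \<open>\<And>i. i \<le> n \<Longrightarrow> \<eta> \<le> h i\<close>[OF i(1)])
    then show False using h(2)[OF i(1)] by blast
  qed
  then have "\<forall>j\<in>UNIV. \<exists>i\<in>{..n}. \<forall>\<eta>>0. \<exists>l. linked X \<eta> l (mball_of X (q i) \<epsilon>) (q i) (q j)" by blast
  from pigeonhole_infinite_rel[OF _ _ this]
  obtain i where i: "infinite {j. \<forall>\<eta>>0. \<exists>l. linked X \<eta> l (mball_of X (q i) \<epsilon>) (q i) (q j)}"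
    by auto
  obtain r :: "nat \<Rightarrow> nat" where r: "strict_mono r"
      "\<And>m. r m \<in> {j. \<forall>\<eta>>0. \<exists>l. linked X \<eta> l (mball_of X (q i) \<epsilon>) (q i) (q j)}"
    using infinite_enumerate[OF i] by blast
  show ?thesis
  proof (rule exI[of _ "q i"], rule exI[of _ "\<lambda>m. N + r m"], intro conjI allI impI)
    show "strict_mono (\<lambda>m. N + r m)" using r(1) by (simp add: strict_mono_def)
    show "\<exists>l. linked X \<eta> l (mball_of X (q i) \<epsilon>) (q i) (p (N + r j))" if "0 < \<eta>" for j and \<eta> :: real
      using r(2)[of j] that unfolding q_def by simp
  qed
qed

text \<open>Here the points of the discrete set are not far apart, and a chain of sets may lead from
  a perturbed point to an unexpected term of the sequence. All terms are linked to \<open>b\<close>,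
  however, and for a given step size with a common bound on the length: up to one
  step there are only finitely many terms. So every detour through \<open>b\<close> has bounded length.\<close>

lemma uniform_links_near_linked_Cauchy:
  assumes lcc: "discretely_chain_connected_Bd X"
    and cau: "Metric_space.MCauchy (mspace X) (mdist X) q"
    and der: "mtopology_of X derived_set_of (range q) = {}" and eps: "0 < \<epsilon>"
    and b: "\<And>j \<eta>. 0 < \<eta> \<Longrightarrow> \<exists>l. linked X \<eta> l (mball_of X b \<epsilon>) b (q j)"
    and s: "s \<longlonglongrightarrow> (0::real)"
  shows "\<exists>n. \<forall>\<eta>>0. \<exists>l. \<forall>y\<in>mspace X. mdist X (q n) y < s n \<longrightarrow>
    linked X \<eta> l (mball_of X (q n) (5 * \<epsilon>)) (q n) y"
proof -
  interpret Metric_space "mspace X" "mdist X" by simp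
  have D: "range q \<in> bounded_hyperspace X \<inter> D0 X" by (rule Cauchy_range_Bd_D0[OF cau der])
  have qm: "q j \<in> mspace X" for j using MCauchyE(1)[OF cau] .
  have bm: "b \<in> mspace X" and bq: "mdist X b (q j) < \<epsilon>" for j
    using b[of 1 j] linked_in[of X 1 _ "mball_of X b \<epsilon>" b "q j"] by auto
  obtain \<delta> where d: "0 < \<delta>" and lk:
    "\<And>\<eta> D'. 0 < \<eta> \<Longrightarrow> D' \<in> bounded_hyperspace X \<inter> D0 X \<Longrightarrow> mdist (Bd X) D' (range q) < \<delta> \<Longrightarrow>
       \<exists>l. linked (Bd X) \<eta> l (mball_of (Bd X) (range q) \<epsilon>) (range q) D'"
    using discretely_chain_connected_BdE[OF lcc D eps] by blast
  have "\<forall>\<^sub>F n in sequentially. s n < min (\<delta> / 2) \<epsilon>"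
    using order_tendstoD(2)[OF s, of "min (\<delta> / 2) \<epsilon>"] d eps by simp
  then obtain n where n: "s n < \<delta> / 2" "s n < \<epsilon>" by (auto simp: eventually_sequentially)
  have "\<exists>l. \<forall>y\<in>mspace X. mdist X (q n) y < s n \<longrightarrow> linked X \<eta> l (mball_of X (q n) (5 * \<epsilon>)) (q n) y"
    if eta: "0 < \<eta>" for \<eta>
  proof (rule ccontr)
    assume "\<not> ?thesis"
    then have "\<forall>l. \<exists>y. y \<in> mspace X \<and> mdist X (q n) y < s n \<and>
        \<not> linked X \<eta> l (mball_of X (q n) (5 * \<epsilon>)) (q n) y" by blast
    from choice[OF this] obtain y where y: "\<And>l. y l \<in> mspace X" "\<And>l. mdist X (q n) (y l) < s n"
        "\<And>l. \<not> linked X \<eta> l (mball_of X (q n) (5 * \<epsilon>)) (q n) (y l)" by blast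
    have t: "0 < min \<eta> (\<delta>/2)" using eta d by simp
    obtain D' where D': "D' \<in> bounded_hyperspace X \<inter> D0 X" "mdist (Bd X) D' (range q) \<le> \<delta> / 2"
      and net: "\<And>l. \<exists>e\<in>D'. mdist X (y l) e < min \<eta> (\<delta>/2)"
    proof (rule net_perturbation[of "range q" X y "\<delta>/2" "min \<eta> (\<delta>/2)"])
      show "\<exists>p\<in>range q. mdist X p (y l) < \<delta> / 2" for l
        using y(2)[of l] n by (intro bexI[of _ "q n"]) auto
    qed (use D y t in auto)
    obtain K where K: "linked (Bd X) \<eta> K (mball_of (Bd X) (range q) \<epsilon>) (range q) D'"
      using lk[OF eta D'(1)] D'(2) d by auto
    obtain M where M: "\<And>j m. M \<le> j \<Longrightarrow> M \<le> m \<Longrightarrow> mdist X (q j) (q m) < \<eta>"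
      using MCauchyE(2)[OF cau eta] by auto
    have "\<forall>j\<in>{..M}. \<exists>l. linked X \<eta> l (mball_of X b \<epsilon>) b (q j)" using b[OF eta] by blast
    from bchoice[OF this] obtain L where L: "\<And>j. j \<le> M \<Longrightarrow> linked X \<eta> (L j) (mball_of X b \<epsilon>) b (q j)"
      by auto
    define L' where "L' = Max (L ` {..M}) + 1"
    have bl: "linked X \<eta> L' (mball_of X b \<epsilon>) b (q j)" for j
    proof (cases "j \<le> M")
      case True
      then have "L j \<le> L'" unfolding L'_def by (meson Max_ge atMost_iff finite_atMost finite_imageI imageI trans_le_add1)
      then show ?thesis by (rule linked_mono[OF L[OF True] order_refl _ subset_refl])
    next
      case False
      have "linked X \<eta> (Max (L ` {..M})) (mball_of X b \<epsilon>) b (q M)"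
        by (rule linked_mono[OF L[of M] order_refl _ subset_refl]) auto
      moreover have "linked X \<eta> 1 (mball_of X b \<epsilon>) (q M) (q j)"
        using M[of M j] False bq bm qm by (intro linked_step) auto
      ultimately show ?thesis unfolding L'_def by (rule linked_trans)
    qed
    define l where "l = L' + L' + K + 1"
    obtain e where e: "e \<in> D'" "mdist X (y l) e < \<eta>" using net[of l] by auto
    obtain a where a: "a \<in> range q" "linked X \<eta> K {z. \<exists>u\<in>range q. mdist X u z < \<epsilon>} a e"
      using linked_Bd_imp_linked[OF K e(1)] by blast
    obtain j where j: "a = q j" using a(1) by blast
    have ball: "z \<in> mball_of X (q n) (5 * \<epsilon>)" if "mdist X (q k) z < 2 * \<epsilon>" "z \<in> mspace X" for k z
    proof -
      have "mdist X (q n) z < 5 * \<epsilon>"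
        using that(1) mdist_triangle[OF qm qm that(2), of n k] mdist_triangle[OF qm bm qm, of n k]
          bq[of n] bq[of k] mdist_commute[of X "q n" b] eps by linarith
      then show ?thesis using qm that(2) by simp
    qed
    have b1: "mball_of X b \<epsilon> \<subseteq> mball_of X (q n) (5 * \<epsilon>)"
    proof
      fix z assume "z \<in> mball_of X b \<epsilon>"
      then have z: "z \<in> mspace X" "mdist X b z < \<epsilon>" by auto
      have "mdist X (q n) z < 2 * \<epsilon>"
        using z(2) mdist_triangle[OF qm bm z(1), of n] bq[of n] mdist_commute[of X "q n" b] by linarith
      then show "z \<in> mball_of X (q n) (5 * \<epsilon>)" using ball z(1) by blast
    qed
    have "linked X \<eta> K ({z. \<exists>u\<in>range q. mdist X u z < \<epsilon>} \<inter> mspace X) a e"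
      using a(2) unfolding linked_def step_rel_def by auto
    then have "linked X \<eta> K (mball_of X (q n) (5 * \<epsilon>)) a e"
    proof (rule linked_mono[OF _ order_refl order_refl])
      show "{z. \<exists>u\<in>range q. mdist X u z < \<epsilon>} \<inter> mspace X \<subseteq> mball_of X (q n) (5 * \<epsilon>)"
      proof
        fix z assume "z \<in> {z. \<exists>u\<in>range q. mdist X u z < \<epsilon>} \<inter> mspace X"
        then obtain k where k: "mdist X (q k) z < \<epsilon>" "z \<in> mspace X" by blast
        show "z \<in> mball_of X (q n) (5 * \<epsilon>)" by (rule ball[OF _ k(2), of k]) (use k(1) eps in linarith)
      qed
    qed
    then have ae: "linked X \<eta> K (mball_of X (q n) (5 * \<epsilon>)) (q j) e" unfolding j .
    have bl': "linked X \<eta> L' (mball_of X (q n) (5 * \<epsilon>)) b (q i)" for i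
      by (rule linked_mono[OF bl order_refl order_refl b1])
    have ey: "linked X \<eta> 1 (mball_of X (q n) (5 * \<epsilon>)) e (y l)"
    proof (rule linked_step)
      show "e \<in> mball_of X (q n) (5 * \<epsilon>)" "e \<in> mspace X" using linked_in[OF ae] by auto
      show "y l \<in> mball_of X (q n) (5 * \<epsilon>)" "y l \<in> mspace X" using ball[of n "y l"] y(1)[of l] y(2)[of l] n eps by linarith+
      show "mdist X e (y l) < \<eta>" using e(2) by (simp add: mdist_commute)
    qed
    have "linked X \<eta> (L' + L' + K + 1) (mball_of X (q n) (5 * \<epsilon>)) (q n) (y l)"
      by (rule linked_trans[OF linked_trans[OF linked_trans[OF linked_sym[OF bl'] bl'] ae] ey])
    then show False using y(3)[of l] unfolding l_def by blast
  qed
  then show ?thesis by blast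
qed

lemma uniform_links_near_Cauchy:
  assumes lcc: "discretely_chain_connected_Bd X"
    and cau: "Metric_space.MCauchy (mspace X) (mdist X) p" and eps: "0 < \<epsilon>"
    and s: "s \<longlonglongrightarrow> (0::real)"
  shows "\<exists>n. \<forall>\<eta>>0. \<exists>l. \<forall>y\<in>mspace X. mdist X (p n) y < s n \<longrightarrow>
    linked X \<eta> l (mball_of X (p n) \<epsilon>) (p n) y"
proof (cases "mtopology_of X derived_set_of (range p) = {}")
  case True
  interpret Metric_space "mspace X" "mdist X" by simp
  have e5: "0 < \<epsilon> / 5" using eps by simp
  obtain b and r :: "nat \<Rightarrow> nat" where r: "strict_mono r"
    and b: "\<forall>j. \<forall>\<eta>>0. \<exists>l. linked X \<eta> l (mball_of X b (\<epsilon>/5)) b (p (r j))"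
    using Cauchy_subsequence_linked[OF lcc cau True e5] by (elim exE conjE) simp
  have "range (p \<circ> r) \<subseteq> range p" by auto
  then have der: "mtopology_of X derived_set_of (range (p \<circ> r)) = {}"
    using True derived_set_of_mono[of "range (p \<circ> r)" "range p" "mtopology_of X"] by simp
  have lim: "(s \<circ> r) \<longlonglongrightarrow> 0" using LIMSEQ_subseq_LIMSEQ[OF s r] .
  have b': "\<exists>l. linked X \<eta> l (mball_of X b (\<epsilon>/5)) b ((p \<circ> r) j)" if "0 < \<eta>" for \<eta> j
    using b[rule_format, OF that, of j] by simp
  have "\<exists>n. \<forall>\<eta>>0. \<exists>l. \<forall>y\<in>mspace X. mdist X ((p \<circ> r) n) y < (s \<circ> r) n \<longrightarrow>
    linked X \<eta> l (mball_of X ((p \<circ> r) n) (5 * (\<epsilon>/5))) ((p \<circ> r) n) y"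
    by (rule uniform_links_near_linked_Cauchy[OF lcc MCauchy_subsequence[OF r cau] der e5 b' lim])
  then obtain n where "\<forall>\<eta>>0. \<exists>l. \<forall>y\<in>mspace X. mdist X ((p \<circ> r) n) y < (s \<circ> r) n \<longrightarrow>
    linked X \<eta> l (mball_of X ((p \<circ> r) n) (5 * (\<epsilon>/5))) ((p \<circ> r) n) y" ..
  then have "\<forall>\<eta>>0. \<exists>l. \<forall>y\<in>mspace X. mdist X (p (r n)) y < s (r n) \<longrightarrow>
    linked X \<eta> l (mball_of X (p (r n)) \<epsilon>) (p (r n)) y" by simp
  then show ?thesis by (rule exI)
next
  case False
  obtain c where c: "c \<in> mspace X" and lim: "\<And>e. 0 < e \<Longrightarrow> \<exists>N. \<forall>n\<ge>N. mdist X c (p n) < e"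
    using Cauchy_cluster_point_limit[OF cau False] by blast
  have pm: "p n \<in> mspace X" for n by (rule MCauchyE(1)[OF cau])
  have e2: "0 < \<epsilon> / 2" using eps by simp
  have "\<exists>\<delta>>0. \<forall>\<eta>>0. \<exists>l. \<forall>x\<in>{c}. \<forall>y\<in>mspace X. mdist X x y < \<delta> \<longrightarrow>
           linked X \<eta> l (mball_of X x (\<epsilon>/2)) x y"
    using c by (intro uniform_links_near_separated_set[OF lcc _ zero_less_one _ _ _ e2])
      (auto simp: separated_in_def intro: bounded_inI[of _ _ c 0])
  then obtain \<delta> where d: "0 < \<delta>" and lk: "\<forall>\<eta>>0. \<exists>l. \<forall>x\<in>{c}. \<forall>y\<in>mspace X. mdist X x y < \<delta> \<longrightarrow>
           linked X \<eta> l (mball_of X x (\<epsilon>/2)) x y" by (elim exE conjE)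
  have "\<forall>\<^sub>F n in sequentially. s n < \<delta> / 2" using order_tendstoD(2)[OF s, of "\<delta> / 2"] d by simp
  then obtain N where N: "\<And>n. N \<le> n \<Longrightarrow> s n < \<delta> / 2" unfolding eventually_sequentially by blast
  obtain N' where N': "\<And>n. N' \<le> n \<Longrightarrow> mdist X c (p n) < min (\<delta> / 2) (\<epsilon> / 2)"
    using lim[of "min (\<delta> / 2) (\<epsilon> / 2)"] d e2 by auto
  define n where "n = max N N'"
  have n: "s n < \<delta> / 2" "mdist X c (p n) < \<delta> / 2" "mdist X c (p n) < \<epsilon> / 2"
    using N[of n] N'[of n] unfolding n_def by auto
  have "\<exists>l. \<forall>y\<in>mspace X. mdist X (p n) y < s n \<longrightarrow> linked X \<eta> l (mball_of X (p n) \<epsilon>) (p n) y"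
    if eta: "0 < \<eta>" for \<eta>
  proof -
    obtain l where l: "\<And>y. y \<in> mspace X \<Longrightarrow> mdist X c y < \<delta> \<Longrightarrow> linked X \<eta> l (mball_of X c (\<epsilon>/2)) c y"
      using lk[rule_format, OF eta] by blast
    have sub: "mball_of X c (\<epsilon>/2) \<subseteq> mball_of X (p n) \<epsilon>"
    proof
      fix z assume "z \<in> mball_of X c (\<epsilon>/2)"
      then have z: "z \<in> mspace X" "mdist X c z < \<epsilon>/2" by auto
      have "mdist X (p n) z < \<epsilon>"
        using mdist_triangle[OF pm c z(1), of n] z(2) n(3) mdist_commute[of X c "p n"] by linarith
      then show "z \<in> mball_of X (p n) \<epsilon>" using pm z(1) by simp
    qed
    have "linked X \<eta> (l + l) (mball_of X (p n) \<epsilon>) (p n) y" if y: "y \<in> mspace X" "mdist X (p n) y < s n" for y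
    proof -
      have "mdist X c y < \<delta>" using mdist_triangle[OF c pm y(1), of n] y(2) n by simp
      moreover have "mdist X c (p n) < \<delta>" using n d by simp
      ultimately have "linked X \<eta> (l + l) (mball_of X c (\<epsilon>/2)) (p n) y"
        by (intro linked_trans[OF linked_sym[OF l[OF pm]] l[OF y(1)]])
      then show ?thesis by (rule linked_mono[OF _ order_refl order_refl sub])
    qed
    then show ?thesis by blast
  qed
  then show ?thesis by blast
qed

section \<open>Uniform chain lengths on bounded sets\<close>

text \<open>A sequence of points that violate the claim for radii tending to \<open>0\<close> has a Cauchy
  subsequence or, if its range is not totally bounded, a separated one. Either contradicts one of the
  preceding results on uniform chain lengths.\<close>

lemma pointwise_links_on_bounded_set:
  assumes lcc: "discretely_chain_connected_Bd X" and B: "bounded_in X B" and eps: "0 < \<epsilon>"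
  obtains \<delta> where "0 < \<delta>" "\<And>p \<eta>. p \<in> B \<Longrightarrow> 0 < \<eta> \<Longrightarrow> \<exists>l. \<forall>y\<in>mspace X. mdist X p y < \<delta> \<longrightarrow>
    linked X \<eta> l (mball_of X p \<epsilon>) p y"
proof -
  interpret Metric_space "mspace X" "mdist X" by simp
  let ?G = "\<lambda>\<delta> p. \<forall>\<eta>>0. \<exists>l. \<forall>y\<in>mspace X. mdist X p y < \<delta> \<longrightarrow> linked X \<eta> l (mball_of X p \<epsilon>) p y"
  have G_mono: "?G \<delta> p" if "?G \<delta>' p" "\<delta> \<le> \<delta>'" for \<delta> \<delta>' p
    using that by (meson order_less_le_trans)
  have "\<exists>\<delta>>0. \<forall>p\<in>B. ?G \<delta> p"
  proof (rule ccontr)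
    assume neg: "\<not> ?thesis"
    have "\<forall>n. \<exists>p. p \<in> B \<and> \<not> ?G (inverse (Suc n)) p"
    proof
      fix n :: nat
      have "0 < inverse (real (Suc n))" by simp
      then show "\<exists>p. p \<in> B \<and> \<not> ?G (inverse (Suc n)) p" using neg by blast
    qed
    from choice[OF this] obtain p where p: "\<And>n. p n \<in> B" and bad: "\<And>n. \<not> ?G (inverse (Suc n)) (p n)"
      by blast
    have pm: "range p \<subseteq> mspace X" using p bounded_in_subset_mspace[OF B] by blast
    show False
    proof (cases "mtotally_bounded (range p)")
      case True
      then obtain r where r: "strict_mono r" "MCauchy (p \<circ> r)"
        unfolding mtotally_bounded_sequentially by blast
      have "(\<lambda>n. inverse (real (Suc (r n)))) \<longlonglongrightarrow> 0"
        using LIMSEQ_subseq_LIMSEQ[OF LIMSEQ_inverse_real_of_nat r(1)] by (simp add: o_def)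
      from uniform_links_near_Cauchy[OF lcc r(2) eps this]
      obtain n where "?G (inverse (Suc (r n))) ((p \<circ> r) n)" by (rule exE)
      then show False using bad[of "r n"] unfolding o_def by (rule notE[rotated])
    next
      case False
      then obtain t where t: "0 < t"
        and nt': "\<not> (\<exists>K. finite K \<and> K \<subseteq> range p \<and> range p \<subseteq> (\<Union>x\<in>K. mball x t))"
        unfolding mtotally_bounded_def by (auto simp only: not_all not_imp)
      have nt: "\<not> range p \<subseteq> (\<Union>x\<in>K. mball x t)" if "finite K" "K \<subseteq> range p" for K
        using nt' that by blast
      have "\<exists>f. \<forall>j::nat. \<forall>i<j. t \<le> mdist X (p (f i)) (p (f j))"
      proof (rule dependent_wellorder_choice
          [where P = "\<lambda>f (j :: nat) m. \<forall>i<j. t \<le> mdist X (p (f i)) (p m)"])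
        fix j :: nat and f :: "nat \<Rightarrow> nat"
        have "\<not> range p \<subseteq> (\<Union>x\<in>p ` f ` {..<j}. mball x t)" by (rule nt) auto
        then obtain m where m: "p m \<notin> (\<Union>x\<in>p ` f ` {..<j}. mball x t)" by blast
        have "t \<le> mdist X (p (f i)) (p m)" if "i < j" for i
        proof -
          have "p m \<notin> mball (p (f i)) t" using m that by blast
          then show ?thesis using pm by (auto simp: not_less)
        qed
        then show "\<exists>m. \<forall>i<j. t \<le> mdist X (p (f i)) (p m)" by blast
      qed auto
      then obtain f :: "nat \<Rightarrow> nat" where f: "\<And>i j. i < j \<Longrightarrow> t \<le> mdist X (p (f i)) (p (f j))"
        by blast
      have pfm: "p (f i) \<in> mspace X" for i using pm by blast
      have "inj f"
      proof (rule linorder_injI)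
        fix i j :: nat assume "i < j"
        then have "t \<le> mdist X (p (f i)) (p (f j))" by (rule f)
        then show "f i \<noteq> f j" using pfm[of j] t by auto
      qed
      then have inf: "infinite (range f)" by (simp add: range_inj_infinite)
      let ?D = "range (p \<circ> f)"
      have "separated_in X t ?D" using separated_in_range[of "p \<circ> f" X t] pfm f by simp
      moreover have "bounded_in X ?D" by (rule bounded_in_mono[OF B]) (use p in auto)
      ultimately have "\<exists>\<delta>>0. \<forall>\<eta>>0. \<exists>l. \<forall>x\<in>?D. \<forall>y\<in>mspace X. mdist X x y < \<delta> \<longrightarrow>
           linked X \<eta> l (mball_of X x \<epsilon>) x y"
        by (intro uniform_links_near_separated_set[OF lcc _ t _ _ _ eps]) auto
      then obtain \<delta> where d: "0 < \<delta>" and lk: "\<forall>\<eta>>0. \<exists>l. \<forall>x\<in>?D. \<forall>y\<in>mspace X. mdist X x y < \<delta> \<longrightarrow>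
           linked X \<eta> l (mball_of X x \<epsilon>) x y" by (elim exE conjE)
      obtain N where N: "inverse (real (Suc N)) < \<delta>" using reals_Archimedean[OF d] by blast
      obtain m where m: "N \<le> m" "m \<in> range f"
        using inf unfolding infinite_nat_iff_unbounded_le by blast
      have "?G \<delta> (p m)"
      proof (intro allI impI)
        fix \<eta> :: real assume "0 < \<eta>"
        then obtain l where "\<forall>x\<in>?D. \<forall>y\<in>mspace X. mdist X x y < \<delta> \<longrightarrow>
           linked X \<eta> l (mball_of X x \<epsilon>) x y" using lk by blast
        then have "\<forall>y\<in>mspace X. mdist X (p m) y < \<delta> \<longrightarrow> linked X \<eta> l (mball_of X (p m) \<epsilon>) (p m) y"
          using m(2) by auto
        then show "\<exists>l. \<forall>y\<in>mspace X. mdist X (p m) y < \<delta> \<longrightarrow> linked X \<eta> l (mball_of X (p m) \<epsilon>) (p m) y" ..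
      qed
      moreover have "inverse (real (Suc m)) \<le> inverse (real (Suc N))"
        by (rule le_imp_inverse_le) (use m(1) in auto)
      then have "inverse (real (Suc m)) \<le> \<delta>" using N by linarith
      ultimately have "?G (inverse (real (Suc m))) (p m)" by (rule G_mono)
      then show False using bad[of m] by (rule notE[rotated])
    qed
  qed
  then obtain \<delta> where d: "0 < \<delta>" "\<forall>p\<in>B. ?G \<delta> p" by (elim exE conjE)
  show thesis by (rule that[OF d(1) d(2)[rule_format]])
qed

text \<open>If the claim fails, then for each \<open>n\<close> there is a step size \<open>h n\<close> for which the pairs
  \<open>x n l\<close>, \<open>y n l\<close>, at distance less than a multiple of \<open>1 / (n + 1)\<close>, admit no chains of length
  \<open>l\<close>. The points \<open>x n l\<close>, \<open>l \<ge> m\<close>, cannot all lie near finitely many points, as chains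
  through these points would have bounded length. So a greedy choice picks a separated sequence that contains
  points \<open>x n l\<close> with arbitrarily large \<open>l\<close> for every \<open>n\<close>; chain lengths near it are uniformly
  bounded, a contradiction for large \<open>n\<close>.\<close>

theorem chain_equiconnected_of_discretely_chain_connected:
  assumes lcc: "discretely_chain_connected_Bd X" and B: "bounded_in X B"
  shows "uniformly_locally_chain_equiconnected_at X B"
  unfolding uniformly_locally_chain_equiconnected_at_iff
proof (intro allI impI)
  fix \<epsilon> :: real assume eps: "0 < \<epsilon>"
  have Bm: "B \<subseteq> mspace X" by (rule bounded_in_subset_mspace[OF B])
  have e2: "0 < \<epsilon> / 2" using eps by simp
  obtain \<delta>0 where d00: "0 < \<delta>0" and pl0: "\<And>p \<eta>. p \<in> B \<Longrightarrow> 0 < \<eta> \<Longrightarrow> \<exists>l. \<forall>y\<in>mspace X. mdist X p y < \<delta>0 \<longrightarrow>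
    linked X \<eta> l (mball_of X p (\<epsilon>/2)) p y"
    using pointwise_links_on_bounded_set[OF lcc B e2] by blast
  define \<delta>1 where "\<delta>1 = min \<delta>0 (\<epsilon>/2)"
  have d1: "0 < \<delta>1" "\<delta>1 \<le> \<epsilon>/2" "\<delta>1 \<le> \<delta>0" using d00 e2 unfolding \<delta>1_def by auto
  show "\<exists>\<delta>>0. \<forall>\<eta>>0. \<exists>l. \<forall>x\<in>B. \<forall>y\<in>B. mdist X x y < \<delta> \<longrightarrow> linked X \<eta> l (mball_of X x \<epsilon>) x y"
  proof (rule ccontr)
    assume neg: "\<not> ?thesis"
    have "\<forall>n. \<exists>\<eta>. 0 < \<eta> \<and> (\<nexists>l. \<forall>x\<in>B. \<forall>y\<in>B. mdist X x y < \<delta>1 / 2 / real (Suc n) \<longrightarrow>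
        linked X \<eta> l (mball_of X x \<epsilon>) x y)"
    proof
      fix n :: nat
      have "0 < \<delta>1 / 2 / real (Suc n)" using d1 by simp
      then show "\<exists>\<eta>. 0 < \<eta> \<and> (\<nexists>l. \<forall>x\<in>B. \<forall>y\<in>B. mdist X x y < \<delta>1 / 2 / real (Suc n) \<longrightarrow>
        linked X \<eta> l (mball_of X x \<epsilon>) x y)" using neg by blast
    qed
    from choice[OF this] obtain h where h: "\<And>n. 0 < h n" "\<And>n. \<nexists>l. \<forall>x\<in>B. \<forall>y\<in>B.
        mdist X x y < \<delta>1 / 2 / real (Suc n) \<longrightarrow> linked X (h n) l (mball_of X x \<epsilon>) x y" by blast
    have "\<forall>n. \<exists>xy. \<forall>l. fst xy l \<in> B \<and> snd xy l \<in> B \<and> mdist X (fst xy l) (snd xy l) < \<delta>1 / 2 / real (Suc n) \<and>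
        \<not> linked X (h n) l (mball_of X (fst xy l) \<epsilon>) (fst xy l) (snd xy l)"
    proof
      fix n
      obtain x y where "\<And>l. x l \<in> B \<and> y l \<in> B \<and> mdist X (x l) (y l) < \<delta>1 / 2 / real (Suc n) \<and>
        \<not> linked X (h n) l (mball_of X (x l) \<epsilon>) (x l) (y l)"
        using h(2)[of n] by (rule not_linked_witnesses) (rule that, blast)
      then show "\<exists>xy. \<forall>l. fst xy l \<in> B \<and> snd xy l \<in> B \<and> mdist X (fst xy l) (snd xy l) < \<delta>1 / 2 / real (Suc n) \<and>
        \<not> linked X (h n) l (mball_of X (fst xy l) \<epsilon>) (fst xy l) (snd xy l)"
        by (intro exI[of _ "(x, y)"]) simp
    qed
    from choice[OF this] obtain xy where xy: "\<And>n l. fst (xy n) l \<in> B \<and> snd (xy n) l \<in> B \<and>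
        mdist X (fst (xy n) l) (snd (xy n) l) < \<delta>1 / 2 / real (Suc n) \<and>
        \<not> linked X (h n) l (mball_of X (fst (xy n) l) \<epsilon>) (fst (xy n) l) (snd (xy n) l)" by blast
    define x y where "x n = fst (xy n)" and "y n = snd (xy n)" for n
    have xB: "x n l \<in> B" "y n l \<in> B" and dxy: "mdist X (x n l) (y n l) < \<delta>1 / 2 / real (Suc n)"
      and bad: "\<not> linked X (h n) l (mball_of X (x n l) \<epsilon>) (x n l) (y n l)" for n l
      using xy[of n l] unfolding x_def y_def by auto
    have dxy1: "mdist X (x n l) (y n l) < \<delta>1 / 2" for n l
    proof -
      have "\<delta>1 / 2 / real (Suc n) \<le> \<delta>1 / 2" using d1 by (simp add: divide_le_eq)
      then show ?thesis using dxy[of n l] by linarith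
    qed
    have escape: "\<exists>l\<ge>m. \<forall>u\<in>F. \<delta>1 / 2 \<le> mdist X u (x n l)" if F: "finite F" "F \<subseteq> B" for n m F
    proof (rule ccontr)
      assume "\<not> ?thesis"
      then have close: "\<exists>u\<in>F. mdist X u (x n l) < \<delta>1 / 2" if "m \<le> l" for l
        using that by (meson not_le)
      have "\<forall>u\<in>F. \<exists>l. \<forall>z\<in>mspace X. mdist X u z < \<delta>0 \<longrightarrow> linked X (h n) l (mball_of X u (\<epsilon>/2)) u z"
        using pl0[OF _ h(1)] F(2) by blast
      from bchoice[OF this] obtain L where L: "\<And>u z. u \<in> F \<Longrightarrow> z \<in> mspace X \<Longrightarrow> mdist X u z < \<delta>0 \<Longrightarrow>
          linked X (h n) (L u) (mball_of X u (\<epsilon>/2)) u z" by blast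
      define l where "l = max m (2 * Max (L ` F))"
      obtain u where u: "u \<in> F" "mdist X u (x n l) < \<delta>1 / 2" using close[of l] unfolding l_def by auto
      have um: "u \<in> mspace X" "x n l \<in> mspace X" "y n l \<in> mspace X" using u F(2) Bm xB by blast+
      have "mdist X u (y n l) < \<delta>1" using mdist_triangle[OF um] u(2) dxy1[of n l] by linarith
      then have lk: "linked X (h n) (L u) (mball_of X u (\<epsilon>/2)) u (x n l)"
        "linked X (h n) (L u) (mball_of X u (\<epsilon>/2)) u (y n l)"
        using L[OF u(1)] um u(2) d1 by auto
      have "linked X (h n) (L u + L u) (mball_of X u (\<epsilon>/2)) (x n l) (y n l)"
        by (intro linked_trans[OF linked_sym[OF lk(1)] lk(2)])
      then have "linked X (h n) l (mball_of X (x n l) \<epsilon>) (x n l) (y n l)"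
      proof (rule linked_mono[OF _ order_refl])
        have "L u \<le> Max (L ` F)" using u(1) F(1) by simp
        then show "L u + L u \<le> l" unfolding l_def by simp
        show "mball_of X u (\<epsilon>/2) \<subseteq> mball_of X (x n l) \<epsilon>"
        proof
          fix z assume "z \<in> mball_of X u (\<epsilon>/2)"
          then show "z \<in> mball_of X (x n l) \<epsilon>"
            using mdist_triangle[OF um(2,1), of z] um(2) u(2) d1 mdist_commute[of X u "x n l"] by auto
        qed
      qed
      then show False using bad by blast
    qed
    (* The first component of prod_decode takes every value n at arbitrarily late places j, so that
       each n occurs together with arbitrarily large indices f j. *)
    have "\<exists>f. \<forall>j. j \<le> f j \<and>
        (\<forall>i<j. \<delta>1 / 2 \<le> mdist X (x (fst (prod_decode i)) (f i)) (x (fst (prod_decode j)) (f j)))"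
    proof (rule dependent_wellorder_choice[where P = "\<lambda>f (j :: nat) l. j \<le> l \<and> (\<forall>i<j.
          \<delta>1 / 2 \<le> mdist X (x (fst (prod_decode i)) (f i)) (x (fst (prod_decode j)) l))"])
      fix j :: nat and f :: "nat \<Rightarrow> nat"
      have "\<exists>l\<ge>j. \<forall>u\<in>(\<lambda>i. x (fst (prod_decode i)) (f i)) ` {..<j}.
          \<delta>1 / 2 \<le> mdist X u (x (fst (prod_decode j)) l)"
        by (rule escape) (use xB in auto)
      then show "\<exists>l. j \<le> l \<and>
        (\<forall>i<j. \<delta>1 / 2 \<le> mdist X (x (fst (prod_decode i)) (f i)) (x (fst (prod_decode j)) l))" by auto
    qed auto
    then obtain f where fj: "\<And>j. j \<le> f j" and
      fsep: "\<And>i j. i < j \<Longrightarrow> \<delta>1 / 2 \<le> mdist X (x (fst (prod_decode i)) (f i)) (x (fst (prod_decode j)) (f j))"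
      by blast
    define w where "w j = x (fst (prod_decode j)) (f j)" for j
    have "separated_in X (\<delta>1 / 2) (range w)"
    proof (rule separated_in_range)
      show "w i \<in> mspace X" for i using xB(1) Bm unfolding w_def by blast
    qed (unfold w_def, rule fsep)
    moreover have "0 < \<delta>1 / 2" using d1 by simp
    moreover have "bounded_in X (range w)"
      by (rule bounded_in_mono[OF B]) (use xB in \<open>auto simp: w_def\<close>)
    ultimately have "\<exists>\<delta>>0. \<forall>\<eta>>0. \<exists>l. \<forall>p\<in>range w. \<forall>y\<in>mspace X. mdist X p y < \<delta> \<longrightarrow>
           linked X \<eta> l (mball_of X p \<epsilon>) p y"
      by (intro uniform_links_near_separated_set[OF lcc _ _ _ _ _ eps, of "\<delta>1 / 2"]) auto
    then obtain \<delta> where d: "0 < \<delta>" and lk: "\<forall>\<eta>>0. \<exists>l. \<forall>p\<in>range w. \<forall>y\<in>mspace X. mdist X p y < \<delta> \<longrightarrow>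
           linked X \<eta> l (mball_of X p \<epsilon>) p y" by (elim exE conjE)
    obtain n where n: "\<delta>1 / 2 / \<delta> < real n" using reals_Archimedean2 by blast
    have n': "\<delta>1 / 2 / real (Suc n) < \<delta>" 
    proof -
      have "\<delta>1 / 2 < real n * \<delta>" using n d by (simp add: divide_less_eq)
      also have "\<dots> \<le> \<delta> * real (Suc n)" using d by simp
      finally show ?thesis by (rule pos_divide_less_eq[THEN iffD2, rotated]) simp
    qed
    obtain l where l: "\<forall>p\<in>range w. \<forall>y\<in>mspace X. mdist X p y < \<delta> \<longrightarrow>
           linked X (h n) l (mball_of X p \<epsilon>) p y" using lk[THEN spec, THEN mp, OF h(1)] ..
    define j where "j = prod_encode (n, l)"
    have j: "fst (prod_decode j) = n" "l \<le> j" unfolding j_def by (auto simp: le_prod_encode_2)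
    have wj: "w j = x n (f j)" unfolding w_def j ..
    have "linked X (h n) l (mball_of X (w j) \<epsilon>) (w j) (y n (f j))"
      using l dxy[of n "f j"] n' xB(2)[of n "f j"] Bm unfolding wj[symmetric] by auto
    then have "linked X (h n) (f j) (mball_of X (w j) \<epsilon>) (w j) (y n (f j))"
      by (rule linked_mono[OF _ order_refl le_trans[OF j(2) fj] subset_refl])
    then show False using bad unfolding wj by blast
  qed
qed

section \<open>Continuity moduli and Lipschitz selections\<close>

lemma modulus_ofD:
  assumes "modulus_of P Y f t \<le> ennreal w" "x \<in> mspace P" "x' \<in> mspace P" "mdist P x x' \<le> t" "0 \<le> w"
  shows "mdist Y (f x) (f x') \<le> w"
proof -
  have "ennreal (mdist Y (f x) (f x')) \<le> modulus_of P Y f t"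
    unfolding modulus_of_def by (rule SUP_upper2[of "(x, x')"]) (simp_all add: assms(2-4))
  then have "ennreal (mdist Y (f x) (f x')) \<le> ennreal w" using assms(1) by (rule order_trans)
  then show ?thesis using assms(5) by simp
qed

lemma modulus_of_leI:
  assumes "\<And>x x'. x \<in> mspace P \<Longrightarrow> x' \<in> mspace P \<Longrightarrow> mdist P x x' \<le> t \<Longrightarrow> mdist Y (f x) (f x') \<le> w"
  shows "modulus_of P Y f t \<le> ennreal w"
  unfolding modulus_of_def
proof (rule SUP_least)
  fix p assume "p \<in> {(x, x'). x \<in> mspace P \<and> x' \<in> mspace P \<and> mdist P x x' \<le> t}"
  then show "(case p of (x, x') \<Rightarrow> ennreal (mdist Y (f x) (f x'))) \<le> ennreal w"
    using assms[of "fst p" "snd p"] by (cases p) (simp add: ennreal_leI)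
qed

lemma continuity_modulus_small:
  assumes "continuity_modulus \<omega>" "0 < e"
  obtains t where "0 < t" "\<omega> t < e"
proof -
  have "\<forall>\<^sub>F t in at_right 0. \<omega> t < e"
    using assms order_tendstoD(2) unfolding continuity_modulus_def by blast
  then obtain b where "0 < b" "\<forall>t>0. t < b \<longrightarrow> \<omega> t < e"
    unfolding eventually_at_right_field by auto
  then show thesis using that[of "b / 2"] by simp
qed

lemma continuity_modulus_pos: "continuity_modulus \<omega> \<Longrightarrow> 0 < t \<Longrightarrow> 0 < \<omega> t"
  unfolding continuity_modulus_def by blast

text \<open>The least admissible modulus is the supremum of the observed distances; adding the identity
  makes it positive.\<close>

lemma continuity_modulus_exists:
  fixes P :: "(real \<times> real) set"
  assumes bound: "\<And>t r. (t, r) \<in> P \<Longrightarrow> r \<le> K"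
    and small: "\<And>e. 0 < e \<Longrightarrow> \<exists>s>0. \<forall>t r. (t, r) \<in> P \<and> t < s \<longrightarrow> r \<le> e"
  obtains \<omega> where "continuity_modulus \<omega>" "\<And>t r t'. (t, r) \<in> P \<Longrightarrow> t \<le> t' \<Longrightarrow> 0 < t' \<Longrightarrow> r \<le> \<omega> t'"
proof -
  define S where "S t = insert 0 {r. \<exists>u\<le>t. (u, r) \<in> P}" for t
  define \<omega> where "\<omega> t = t + Sup (S t)" for t
  have bdd: "bdd_above (S t)" for t
    unfolding S_def by (rule bdd_aboveI[of _ "max 0 K"]) (auto dest: bound)
  have nonneg: "0 \<le> Sup (S t)" for t
    by (rule cSup_upper[OF _ bdd]) (simp add: S_def)
  have mono: "Sup (S s) \<le> Sup (S t)" if "s \<le> t" for s t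
  proof (rule cSup_subset_mono[OF _ bdd])
    show "S s \<subseteq> S t"
      unfolding S_def by (intro insert_mono Collect_mono) (meson order_trans that)
  qed (simp add: S_def)
  have "(\<omega> \<longlongrightarrow> 0) (at_right 0)"
    unfolding tendsto_iff
  proof (intro allI impI)
    fix e :: real assume "0 < e"
    then obtain s where s: "0 < s" "\<forall>t r. (t, r) \<in> P \<and> t < s \<longrightarrow> r \<le> e / 2"
      using small[of "e / 2"] by auto
    have "dist (\<omega> t) 0 < e" if t: "0 < t" "t < min s (e / 2)" for t
    proof -
      have "Sup (S t) \<le> e / 2"
      proof (rule cSup_least)
        fix r assume "r \<in> S t"
        then consider "r = 0" | u where "u \<le> t" "(u, r) \<in> P" unfolding S_def by blast
        then show "r \<le> e / 2"
        proof cases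
          case 2
          then have "u < s" using t by linarith
          with 2 show ?thesis using s(2) by blast
        qed (use \<open>0 < e\<close> in simp)
      qed (simp add: S_def)
      then show ?thesis using nonneg[of t] t unfolding \<omega>_def by (simp add: dist_real_def)
    qed
    then show "\<forall>\<^sub>F t in at_right 0. dist (\<omega> t) 0 < e"
      unfolding eventually_at_right_field using s(1) \<open>0 < e\<close> by (intro exI[of _ "min s (e / 2)"]) auto
  qed
  moreover have "mono_on {0<..} \<omega>"
    unfolding \<omega>_def by (intro mono_onI add_mono mono) auto
  moreover have "0 < \<omega> t" if "0 < t" for t using nonneg[of t] that unfolding \<omega>_def by linarith
  ultimately have "continuity_modulus \<omega>" unfolding continuity_modulus_def by blast
  moreover have "r \<le> \<omega> t'" if "(t, r) \<in> P" "t \<le> t'" "0 < t'" for t r t'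
  proof -
    have "r \<le> Sup (S t')" by (rule cSup_upper[OF _ bdd]) (use that in \<open>auto simp: S_def\<close>)
    then show ?thesis using that(3) unfolding \<omega>_def by linarith
  qed
  ultimately show thesis using that by blast
qed

text \<open>The values are chosen one after another. Each earlier value restricts the next one
  to an interval; any two of these intervals overlap, hence finitely many of them have a common
  interval, which meets the dense set. Starting from slope \<open>1 / d\<close> with the Lipschitz constant \<open>2 / d\<close>
  keeps the inequalities between distinct points strict, so that the intervals are open.\<close>

lemma Lipschitz_map_into_dense_set:
  fixes Q G :: "real set" and d :: real
  assumes Q: "countable Q" "{0, d} \<subseteq> Q" and d: "0 < d"
    and G: "0 \<in> G" "1 \<in> G" and dense: "\<And>a b. a < b \<Longrightarrow> \<exists>g\<in>G. a < g \<and> g < b"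
  obtains h where "\<And>q. q \<in> Q \<Longrightarrow> h q \<in> G" "h 0 = 0" "h d = 1"
    "\<And>q q'. q \<in> Q \<Longrightarrow> q' \<in> Q \<Longrightarrow> \<bar>h q - h q'\<bar> \<le> 2 / d * \<bar>q - q'\<bar>"
proof -
  (* The end points come first, since their values are prescribed. *)
  define e :: "nat \<Rightarrow> real" where
    "e n = (if n = 0 then 0 else if n = 1 then d else from_nat_into Q (n - 2))" for n
  have e01: "e 0 = 0" "e 1 = d" unfolding e_def by auto
  have Qe: "\<exists>n. e n = q" if q: "q \<in> Q" for q
  proof -
    obtain n where "from_nat_into Q n = q" using from_nat_into_surj[OF Q(1) q] by blast
    then have "e (n + 2) = q" unfolding e_def by simp
    then show ?thesis by blast
  qed
  define L where "L = 2 / d"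
  have L: "0 < L" "L * d = 2" using d unfolding L_def by auto
  define P where "P F n r \<longleftrightarrow> r \<in> G \<and> (n = 0 \<longrightarrow> r = 0) \<and> (n = 1 \<longrightarrow> r = 1) \<and>
    (\<forall>i<n. if e i = e n then r = F i else \<bar>r - F i\<bar> < L * \<bar>e n - e i\<bar>)"
    for F :: "nat \<Rightarrow> real" and n r
  have compat: "(e i = e j \<longrightarrow> F i = F j) \<and> (e i \<noteq> e j \<longrightarrow> \<bar>F i - F j\<bar> < L * \<bar>e i - e j\<bar>)"
    if F: "\<And>m. m < n \<Longrightarrow> P F m (F m)" and ij: "i < n" "j < n" for F n i j
  proof -
    have *: "(e i = e j \<longrightarrow> F i = F j) \<and> (e i \<noteq> e j \<longrightarrow> \<bar>F i - F j\<bar> < L * \<bar>e i - e j\<bar>)"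
      if "i < j" "j < n" for i j
      using F[OF that(2)] that(1) unfolding P_def by (metis abs_minus_commute)
    show ?thesis
    proof (cases i j rule: linorder_cases)
      case greater
      then show ?thesis using *[of j i] ij by (simp add: abs_minus_commute eq_commute)
    qed (use * ij in auto)
  qed
  have "\<exists>F. \<forall>n. P F n (F n)"
  proof (rule dependent_wellorder_choice)
    show "P f n r = P g n r" if "\<And>m. m < n \<Longrightarrow> f m = g m" for r f g n
      unfolding P_def using that by auto
    fix n F assume F: "\<And>m. m < n \<Longrightarrow> P F m (F m)"
    have "n = 0 \<or> n = 1 \<or> 1 < n" by linarith
    then consider "n = 0" | "n = 1" | "1 < n" "\<exists>i<n. e i = e n" | "1 < n" "\<forall>i<n. e i \<noteq> e n"
      by blast
    then show "\<exists>r. P F n r"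
    proof cases
      case 1
      then show ?thesis using G(1) unfolding P_def by auto
    next
      case 2
      have "F 0 = 0" using F[of 0] 2 unfolding P_def by auto
      then show ?thesis using G(2) 2 d e01 L unfolding P_def by (intro exI[of _ 1]) auto
    next
      case 3
      then obtain i where i: "i < n" "e i = e n" by blast
      have "F i \<in> G" using F[OF i(1)] unfolding P_def by blast
      moreover have "if e j = e n then F i = F j else \<bar>F i - F j\<bar> < L * \<bar>e n - e j\<bar>" if "j < n" for j
        using compat[OF F i(1) that] unfolding i(2) by auto
      ultimately show ?thesis using 3(1) unfolding P_def by (intro exI[of _ "F i"]) auto
    next
      case 4
      let ?lo = "\<lambda>i. F i - L * \<bar>e n - e i\<bar>" and ?hi = "\<lambda>i. F i + L * \<bar>e n - e i\<bar>"
      have lohi: "?lo i < ?hi j" if ij: "i < n" "j < n" for i j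
      proof (cases "e i = e j")
        case True
        have "0 < L * \<bar>e n - e i\<bar>" using 4(2) ij L(1) by auto
        moreover have "0 \<le> L * \<bar>e n - e j\<bar>" using L(1) by auto
        ultimately show ?thesis using compat[OF F ij] True by linarith
      next
        case False
        have "\<bar>F i - F j\<bar> < L * \<bar>e i - e j\<bar>" using compat[OF F ij] False by blast
        also have "\<dots> \<le> L * (\<bar>e n - e i\<bar> + \<bar>e n - e j\<bar>)" using L(1) by (intro mult_left_mono) auto
        finally show ?thesis by (simp add: algebra_simps)
      qed
      have fin: "finite (?lo ` {..<n})" "?lo ` {..<n} \<noteq> {}" "finite (?hi ` {..<n})" "?hi ` {..<n} \<noteq> {}"
        using 4(1) by auto
      have "Max (?lo ` {..<n}) < Min (?hi ` {..<n})"
        using lohi by (simp only: Max_less_iff[OF fin(1,2)] Min_gr_iff[OF fin(3,4)]) auto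
      then obtain g where g: "g \<in> G" "Max (?lo ` {..<n}) < g" "g < Min (?hi ` {..<n})"
        using dense by blast
      have "?lo i < g" "g < ?hi i" if "i < n" for i
        using g(2,3) that by (auto simp only: Max_less_iff[OF fin(1,2)] Min_gr_iff[OF fin(3,4)])
      then have "\<bar>g - F i\<bar> < L * \<bar>e n - e i\<bar>" if "i < n" for i
        using that by (auto simp: abs_less_iff algebra_simps)
      then show ?thesis using 4 g(1) unfolding P_def by (intro exI[of _ g]) auto
    qed
  qed
  then obtain F where F: "\<And>n. P F n (F n)" by blast
  have cF: "(e i = e j \<longrightarrow> F i = F j) \<and> (e i \<noteq> e j \<longrightarrow> \<bar>F i - F j\<bar> < L * \<bar>e i - e j\<bar>)" for i j
    using compat[of "Suc (max i j)" F i j] F by simp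
  obtain idx where idx: "\<And>q. q \<in> Q \<Longrightarrow> e (idx q) = q" using Qe by metis
  show thesis
  proof (rule that[of "\<lambda>q. F (idx q)"])
    show "F (idx q) \<in> G" for q using F[of "idx q"] unfolding P_def by blast
    have "F 0 = 0" "F 1 = 1" using F[of 0] F[of 1] unfolding P_def by auto
    then show "F (idx 0) = 0" "F (idx d) = 1"
      using cF[of "idx 0" 0] cF[of "idx d" 1] idx[of 0] idx[of d] Q(2) e01 by auto
    show "\<bar>F (idx q) - F (idx q')\<bar> \<le> 2 / d * \<bar>q - q'\<bar>" if "q \<in> Q" "q' \<in> Q" for q q'
    proof (cases "q = q'")
      case False
      then show ?thesis using cF[of "idx q" "idx q'"] idx[OF that(1)] idx[OF that(2)]
        unfolding L_def by (simp add: less_imp_le)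
    qed simp
  qed
qed

section \<open>Traces from chains\<close>

lemma linked_imp_chain_function:
  assumes "linked X \<eta> l S x y" "l \<le> L" "0 < \<eta>"
  shows "\<exists>c. c 0 = x \<and> c L = y \<and> (\<forall>i::nat. c i \<in> S \<and> c i \<in> mspace X) \<and>
    (\<forall>i. mdist X (c i) (c (Suc i)) < \<eta>)"
proof -
  obtain k c where kc: "k \<le> l" "chain_in X \<eta> k x y c" "c ` {0..k} \<subseteq> S"
    using linked_imp_chain_in[OF assms(1)] .
  have step: "mdist X (c (min i k)) (c (min (Suc i) k)) < \<eta>" for i
  proof (cases "i < k")
    case True
    then have "mdist X (c (Suc i)) (c (Suc i - 1)) < \<eta>"
      using kc(2) unfolding chain_in_def by (metis Suc_leI atLeastAtMost_iff le_add1 plus_1_eq_Suc)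
    then show ?thesis using True by (simp add: min_def mdist_commute)
  next
    case False
    have "c k \<in> mspace X" using kc(2) unfolding chain_in_def by auto
    then show ?thesis using False assms(3) by (simp add: min_def)
  qed
  have mem: "c (min i k) \<in> S \<and> c (min i k) \<in> mspace X" for i
    using kc(2,3) unfolding chain_in_def by (auto simp: image_subset_iff)
  have "min L k = k" using kc(1) assms(2) by simp
  then have "c (min 0 k) = x" "c (min L k) = y" using kc(2) unfolding chain_in_def by auto
  then show ?thesis using step mem by (intro exI[of _ "\<lambda>i. c (min i k)"]) simp
qed

text \<open>\<open>refine C L x y m k i\<close> is the value at the grid point with index \<open>i\<close> on level \<open>k\<close>. Each cell
  of level \<open>k\<close> is divided into \<open>L (m + k)\<close> cells along the chain \<open>C (m + k)\<close> between the values at its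
  ends. Integer indices spare a separate treatment of the ends of the grid.\<close>

primrec refine :: "(nat \<Rightarrow> 'a \<Rightarrow> 'a \<Rightarrow> nat \<Rightarrow> 'a) \<Rightarrow> (nat \<Rightarrow> nat) \<Rightarrow> 'a \<Rightarrow> 'a \<Rightarrow> nat \<Rightarrow> nat \<Rightarrow> int \<Rightarrow> 'a"
  where
    "refine C L x y m 0 i = (if i \<le> 0 then x else y)"
  | "refine C L x y m (Suc k) i =
       C (m + k) (refine C L x y m k (i div int (L (m + k))))
         (refine C L x y m k (i div int (L (m + k)) + 1)) (nat (i mod int (L (m + k))))"

definition cells :: "(nat \<Rightarrow> nat) \<Rightarrow> nat \<Rightarrow> nat \<Rightarrow> nat" where
  "cells L m k = (\<Prod>j<k. L (m + j))"

lemma cells_0 [simp]: "cells L m 0 = 1"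
  and cells_Suc: "cells L m (Suc k) = cells L m k * L (m + k)"
  by (simp_all add: cells_def)

lemma cells_add: "cells L m (j + t) = cells L m j * cells L (m + j) t"
  by (induction t) (simp_all add: cells_Suc add.assoc)

lemma cells_ge: "(\<And>n. 2 \<le> L n) \<Longrightarrow> 2 ^ k \<le> cells L m k"
  by (induction k) (auto simp: cells_Suc mult.commute intro: mult_mono)

lemma geometric_bound_le_3: "(1/2) ^ m * (3 - 2 * (1/2) ^ k) \<le> (3::real)"
proof -
  have "(1/2) ^ k \<le> (1::real)" by (simp add: power_le_one)
  then have "(1/2) ^ m * (3 - 2 * (1/2) ^ k) \<le> (1::real) * 3"
    by (intro mult_mono power_le_one) auto
  then show ?thesis by simp
qed

lemma floor_diff_le_1:
  fixes a b :: real
  assumes "\<bar>a - b\<bar> < 1"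
  shows "\<lfloor>b\<rfloor> = \<lfloor>a\<rfloor> \<or> \<lfloor>b\<rfloor> = \<lfloor>a\<rfloor> + 1 \<or> \<lfloor>a\<rfloor> = \<lfloor>b\<rfloor> + 1"
  using assms by linarith

text \<open>\<open>C n u v\<close> is a chain of \<open>L n\<close> steps shorter than \<open>\<delta> (Suc n)\<close> in the ball of radius \<open>1 / 2 ^ n\<close>
  round \<open>u\<close>. As the radii are summable, all refinements of a pair stay at distance at most \<open>3\<close>, inside \<open>B\<close>.\<close>

locale refinement =
  fixes X :: "'a metric" and B :: "'a set" and \<delta> :: "nat \<Rightarrow> real"
    and C :: "nat \<Rightarrow> 'a \<Rightarrow> 'a \<Rightarrow> nat \<Rightarrow> 'a" and L :: "nat \<Rightarrow> nat" and x y :: 'a and m :: nat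
  assumes L: "\<And>n. 2 \<le> L n" and \<delta>: "\<And>n. 0 < \<delta> n" "\<And>n. \<delta> n \<le> (1/2) ^ n"
    and C: "\<And>n u v. \<lbrakk>u \<in> B; v \<in> B; mdist X u v < \<delta> n\<rbrakk> \<Longrightarrow>
        C n u v 0 = u \<and> C n u v (L n) = v \<and>
        (\<forall>i. C n u v i \<in> mspace X \<and> mdist X u (C n u v i) < (1/2) ^ n) \<and>
        (\<forall>i. mdist X (C n u v i) (C n u v (Suc i)) < \<delta> (Suc n))"
    and x: "x \<in> mspace X" and y: "y \<in> mspace X" and xy: "mdist X x y < \<delta> m"
    and B: "\<And>z. z \<in> mspace X \<Longrightarrow> mdist X x z \<le> 3 \<Longrightarrow> z \<in> B"
begin

abbreviation K where "K \<equiv> refine C L x y m"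
abbreviation N where "N \<equiv> cells L m"

lemma refine_basic:
  "K k i \<in> mspace X \<and> mdist X x (K k i) \<le> (1/2) ^ m * (3 - 2 * (1/2) ^ k) \<and>
   mdist X (K k i) (K k (i + 1)) < \<delta> (m + k)"
proof (induction k arbitrary: i)
  case 0
  have "mdist X x y \<le> (1/2) ^ m" using xy \<delta>(2)[of m] by linarith
  then show ?case using x y xy \<delta>(1)[of m] by (auto simp: mdist_commute)
next
  case (Suc k)
  define l where "l = int (L (m + k))"
  have l: "2 \<le> l" using L[of "m + k"] unfolding l_def by simp
  have inB: "K k j \<in> B" for j
    using Suc.IH[of j] geometric_bound_le_3[of m k] by (intro B) linarith+
  define q where "q = i div l"
  define s where "s = nat (i mod l)"
  note c = C[OF inB inB, of q "q + 1" "m + k"]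
  have close: "mdist X (K k q) (K k (q + 1)) < \<delta> (m + k)" using Suc.IH[of q] by blast
  have Ki: "K (Suc k) i = C (m + k) (K k q) (K k (q + 1)) s"
    unfolding q_def s_def l_def by simp
  have mem: "K (Suc k) i \<in> mspace X" "mdist X (K k q) (K (Suc k) i) < (1/2) ^ (m + k)"
    using c[OF close] unfolding Ki by auto
  have "mdist X x (K (Suc k) i) \<le> mdist X x (K k q) + mdist X (K k q) (K (Suc k) i)"
    using mdist_triangle[OF x _ mem(1)] Suc.IH[of q] by blast
  also have "\<dots> \<le> (1/2) ^ m * (3 - 2 * (1/2) ^ k) + (1/2) ^ (m + k)"
    using Suc.IH[of q] mem(2) by (intro add_mono) auto
  also have "\<dots> = (1/2) ^ m * (3 - 2 * (1/2) ^ Suc k)" by (simp add: power_add algebra_simps)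
  finally have bound: "mdist X x (K (Suc k) i) \<le> (1/2) ^ m * (3 - 2 * (1/2) ^ Suc k)" .
  have "K (Suc k) (i + 1) = C (m + k) (K k q) (K k (q + 1)) (Suc s)"
  proof (cases "i mod l + 1 = l")
    case True
    then have "i + 1 = q * l + l" unfolding q_def using div_mult_mod_eq[of i l] by linarith
    then have i1: "i + 1 = (q + 1) * l" by (simp add: distrib_right)
    have "(i + 1) div l = q + 1" "(i + 1) mod l = 0" unfolding i1 using l by auto
    then have "K (Suc k) (i + 1) = K k (q + 1)"
      using C[OF inB inB, of "q + 1" "q + 1 + 1" "m + k"] Suc.IH[of "q + 1"] unfolding l_def by simp
    moreover have "int s = i mod l" unfolding s_def using l by simp
    then have "int (Suc s) = int (L (m + k))" using True unfolding l_def by simp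
    then have "Suc s = L (m + k)" by (simp only: of_nat_eq_iff)
    ultimately show ?thesis using c[OF close] by simp
  next
    case False
    have "0 \<le> i mod l" "i mod l < l" using l by auto
    then have r: "0 \<le> i mod l + 1" "i mod l + 1 < l" using False by auto
    have i1: "i + 1 = q * l + (i mod l + 1)" unfolding q_def using div_mult_mod_eq[of i l] by simp
    have "(i + 1) div l = q" "(i + 1) mod l = i mod l + 1"
      unfolding i1 using r by auto
    then show ?thesis unfolding s_def q_def l_def using \<open>0 \<le> i mod l\<close>
      by (simp add: l_def nat_add_distrib)
  qed
  then have "mdist X (K (Suc k) i) (K (Suc k) (i + 1)) < \<delta> (m + Suc k)"
    unfolding Ki using c[OF close] by simp
  then show ?case using mem(1) bound by blast
qed

lemma refine_mem: "K k i \<in> mspace X" using refine_basic by blast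

lemma refine_in_B: "K k i \<in> B"
  using refine_basic[of k i] geometric_bound_le_3[of m k] by (intro B) linarith+

lemma refine_coarse:
  "mdist X (K k (i div int (L (m + k)))) (K (Suc k) i) < (1/2) ^ (m + k)"
proof -
  have "mdist X (K k (i div int (L (m + k)))) (K k (i div int (L (m + k)) + 1)) < \<delta> (m + k)"
    using refine_basic by blast
  from C[OF refine_in_B refine_in_B this] show ?thesis by simp
qed

lemma refine_exact: "K (Suc k) (i * int (L (m + k))) = K k i"
proof -
  have "mdist X (K k i) (K k (i + 1)) < \<delta> (m + k)" using refine_basic by blast
  from C[OF refine_in_B refine_in_B this] show ?thesis using L[of "m + k"] by simp
qed

lemma refine_coarse_iter:
  "mdist X (K j (i div int (cells L (m + j) t))) (K (j + t) i) \<le> 2 * (1/2) ^ (m + j) * (1 - (1/2) ^ t)"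
proof (induction t arbitrary: i)
  case 0 then show ?case using refine_mem by simp
next
  case (Suc t)
  define l where "l = int (L (m + (j + t)))"
  have eq: "i div int (cells L (m + j) (Suc t)) = i div l div int (cells L (m + j) t)"
    unfolding l_def by (simp add: cells_Suc add.assoc mult.commute[of _ "L _"] zdiv_zmult2_eq)
  have "mdist X (K j (i div int (cells L (m + j) (Suc t)))) (K (j + Suc t) i)
      \<le> mdist X (K j (i div l div int (cells L (m + j) t))) (K (j + t) (i div l))
        + mdist X (K (j + t) (i div l)) (K (Suc (j + t)) i)"
    unfolding eq add_Suc_right by (rule mdist_triangle) (rule refine_mem)+
  also have "\<dots> \<le> 2 * (1/2) ^ (m + j) * (1 - (1/2) ^ t) + (1/2) ^ (m + (j + t))"
    using Suc.IH[of "i div l"] refine_coarse[of "j + t" i] unfolding l_def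
    by (intro add_mono) (auto simp del: refine.simps)
  also have "\<dots> = 2 * (1/2) ^ (m + j) * (1 - (1/2) ^ Suc t)" by (simp add: power_add algebra_simps)
  finally show ?case .
qed

lemma refine_exact_iter: "K (k + t) (i * int (cells L (m + k) t)) = K k i"
proof (induction t)
  case (Suc t)
  have "K (k + Suc t) (i * int (cells L (m + k) (Suc t))) =
      K (Suc (k + t)) ((i * int (cells L (m + k) t)) * int (L (m + (k + t))))"
    by (simp add: cells_Suc add.assoc mult.assoc del: refine.simps)
  then show ?case using refine_exact[of "k + t" "i * int (cells L (m + k) t)"] Suc.IH
    by (simp del: refine.simps)
qed simp

lemma cells_pos: "0 < cells L n k"
proof -
  have "2 ^ k \<le> cells L n k" by (rule cells_ge[OF L])
  then show ?thesis by (rule less_le_trans[rotated]) simp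
qed

text \<open>Passing to a coarser level \<open>j\<close> costs the tail of a geometric series, while passing to a finer
  one is exact. The rounded grid position covers both cases.\<close>

lemma refine_near_cell:
  "mdist X (K j \<lfloor>real_of_int i / real (N k) * real (N j)\<rfloor>) (K k i) \<le> 2 * (1/2) ^ (m + j)"
proof (cases "j \<le> k")
  case True
  then obtain t where t: "k = j + t" using le_Suc_ex by blast
  let ?P = "cells L (m + j) t"
  have "real_of_int i / real (N k) * real (N j) = real_of_int i / real_of_int (int ?P)"
    using cells_pos[of m j] unfolding t cells_add by simp
  then have "\<lfloor>real_of_int i / real (N k) * real (N j)\<rfloor> = i div int ?P"
    by (simp only: floor_divide_of_int_eq)
  moreover have "2 * (1/2) ^ (m + j) * (1 - (1/2) ^ t) \<le> 2 * (1/2) ^ (m + j) * (1::real)"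
    by (intro mult_left_mono) auto
  with refine_coarse_iter[of j i t]
  have "mdist X (K j (i div int ?P)) (K k i) \<le> 2 * (1/2) ^ (m + j)" unfolding t by linarith
  ultimately show ?thesis by simp
next
  case False
  then obtain t where t: "j = k + t" by (metis le_Suc_ex nat_le_linear)
  let ?P = "cells L (m + k) t"
  have "real_of_int i / real (N k) * real (N j) = real_of_int (i * int ?P)"
    using cells_pos[of m k] unfolding t cells_add by simp
  then have "\<lfloor>real_of_int i / real (N k) * real (N j)\<rfloor> = i * int ?P" by (simp only: floor_of_int)
  then show ?thesis using refine_exact_iter[of k t i] refine_mem[of k i] unfolding t by simp
qed

lemma refine_near:
  assumes "\<bar>real_of_int i / real (N k) - real_of_int i' / real (N k')\<bar> < 1 / real (N j)"
  shows "mdist X (K k i) (K k' i') \<le> 5 * (1/2) ^ (m + j)"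
proof -
  let ?a = "real_of_int i / real (N k) * real (N j)" and ?b = "real_of_int i' / real (N k') * real (N j)"
  have Nj: "0 < real (N j)" using cells_pos by simp
  have "?a - ?b = (real_of_int i / real (N k) - real_of_int i' / real (N k')) * real (N j)"
    by (simp add: left_diff_distrib)
  then have "\<bar>?a - ?b\<bar> < 1" using assms Nj by (simp add: abs_mult pos_less_divide_eq)
  then have "\<lfloor>?b\<rfloor> = \<lfloor>?a\<rfloor> \<or> \<lfloor>?b\<rfloor> = \<lfloor>?a\<rfloor> + 1 \<or> \<lfloor>?a\<rfloor> = \<lfloor>?b\<rfloor> + 1" by (rule floor_diff_le_1)
  then have "mdist X (K j \<lfloor>?a\<rfloor>) (K j \<lfloor>?b\<rfloor>) \<le> \<delta> (m + j)"
  proof (elim disjE)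
    assume "\<lfloor>?b\<rfloor> = \<lfloor>?a\<rfloor>" then show ?thesis using refine_mem \<delta>(1)[of "m + j"] by simp
  next
    assume "\<lfloor>?b\<rfloor> = \<lfloor>?a\<rfloor> + 1" then show ?thesis using refine_basic[of j "\<lfloor>?a\<rfloor>"] by simp
  next
    assume "\<lfloor>?a\<rfloor> = \<lfloor>?b\<rfloor> + 1" then show ?thesis
      using refine_basic[of j "\<lfloor>?b\<rfloor>"] by (simp add: mdist_commute)
  qed
  then have 2: "mdist X (K j \<lfloor>?a\<rfloor>) (K j \<lfloor>?b\<rfloor>) \<le> (1/2) ^ (m + j)" using \<delta>(2)[of "m + j"] by linarith
  have 1: "mdist X (K k i) (K j \<lfloor>?a\<rfloor>) \<le> 2 * (1/2) ^ (m + j)"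
    using refine_near_cell[of j i k] by (simp add: mdist_commute)
  have 3: "mdist X (K j \<lfloor>?b\<rfloor>) (K k' i') \<le> 2 * (1/2) ^ (m + j)" by (rule refine_near_cell)
  show ?thesis
    using mdist_triangle[OF refine_mem[of k i] refine_mem[of j "\<lfloor>?a\<rfloor>"] refine_mem[of k' i']]
      mdist_triangle[OF refine_mem[of j "\<lfloor>?a\<rfloor>"] refine_mem[of j "\<lfloor>?b\<rfloor>"] refine_mem[of k' i']] 1 2 3
    by linarith
qed

text \<open>The value depends on the position of the grid point only, and not on its level.\<close>

lemma refine_same:
  assumes "real_of_int i / real (N k) = real_of_int i' / real (N k')"
  shows "K k i = K k' i'"
proof -
  have "mdist X (K k i) (K k' i') \<le> 5 * (1/2) ^ j" for j
  proof -
    have "mdist X (K k i) (K k' i') \<le> 5 * (1/2) ^ (m + j)"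
      by (rule refine_near) (use assms cells_pos in simp)
    also have "\<dots> \<le> 5 * (1/2) ^ j" by (simp add: power_add mult_left_le_one_le power_le_one)
    finally show ?thesis .
  qed
  then have "\<exists>J. \<forall>j\<ge>J. mdist X (K k i) (K k' i') \<le> 5 * (1/2) ^ j" by blast
  moreover have "(\<lambda>j. 5 * (1/2) ^ j) \<longlonglongrightarrow> (5 * 0 :: real)"
    by (intro tendsto_mult tendsto_const LIMSEQ_power_zero) simp
  ultimately have "mdist X (K k i) (K k' i') \<le> 5 * 0" by (intro LIMSEQ_le_const)
  then have "mdist X (K k i) (K k' i') \<le> 0" by simp
  then show ?thesis using refine_mem mdist_nonneg[of X "K k i" "K k' i'"]
    by (metis mdist_zero order_antisym)
qed

text \<open>This bound takes the place of the estimate by cells when the whole pair is already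
  closer than the scale under consideration.\<close>

lemma refine_diameter: "mdist X (K k i) (K k' i') \<le> 6 * (1/2) ^ m"
proof -
  have "(1/2) ^ m * (3 - 2 * (1/2) ^ k) \<le> (1/2::real) ^ m * 3" for k
    by (intro mult_left_mono) auto
  then have "mdist X x (K k i) \<le> 3 * (1/2) ^ m" for k i
    using refine_basic[of k i] by (smt (verit) mult.commute)
  then show ?thesis
    using mdist_triangle[OF refine_mem x refine_mem, of k i k' i'] mdist_commute[of X x "K k i"]
    by (smt (verit))
qed

end

lemma cells_grid_dense:
  assumes "\<And>n. 2 \<le> L n" "a < b"
  shows "\<exists>g\<in>{real_of_int i / real (cells L m k) | i k. True}. a < g \<and> g < b"
proof -
  obtain k :: nat where k: "1 / (b - a) < 2 ^ k" using real_arch_pow[of 2 "1 / (b - a)"] by auto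
  define R where "R = real (cells L m k)"
  have "2 ^ k \<le> cells L m k" by (rule cells_ge[OF assms(1)])
  then have "real (2 ^ k) \<le> R" unfolding R_def by (rule of_nat_mono)
  then have R: "1 / (b - a) < R" using k by simp
  moreover have "0 < 1 / (b - a)" using assms(2) by simp
  ultimately have R0: "0 < R" by linarith
  have "1 < R * (b - a)" using R assms(2) by (simp add: pos_divide_less_eq)
  then have gap: "a * R + 1 < b * R" by (simp add: algebra_simps)
  define i where "i = \<lfloor>a * R\<rfloor> + 1"
  have "a * R < real_of_int i" "real_of_int i < b * R" using gap unfolding i_def by linarith+
  then have "a < real_of_int i / R" "real_of_int i / R < b"
    using R0 by (simp_all add: pos_less_divide_eq pos_divide_less_eq)
  then show ?thesis unfolding R_def by blast
qed

text \<open>A pair at distance \<open>d\<close> is refined from the level \<open>m\<close> with \<open>\<delta> (m + 1) \<le> d < \<delta> m\<close> on.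
  The lower bound on \<open>d\<close> makes the modulus uniform: a cell that is \<open>k\<close> levels further down has length
  at least \<open>\<delta> (m + 1)\<close> divided by the number of cells, and for a given precision
  \<open>1 / 2 ^ j\<close> only the finitely many levels \<open>m < j\<close> matter, because pairs that start on a later
  level are refined within a set of small diameter.\<close>

theorem trace_equiconnected_of_chain_equiconnected:
  assumes ch: "\<And>B. bounded_in X B \<Longrightarrow> uniformly_locally_chain_equiconnected_at X B"
    and B: "bounded_in X B"
  shows "uniformly_locally_trace_equiconnected_at X B"
proof -
  have Bm: "B \<subseteq> mspace X" by (rule bounded_in_subset_mspace[OF B])
  define B' where "B' = {z \<in> mspace X. \<exists>b\<in>B. mdist X b z \<le> 3}"
  have "bounded_in X B'"
    by (rule bounded_in_neighbourhood[OF B, of _ 3]) (auto simp: B'_def mdist_commute)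
  note chB = ch[OF this, unfolded uniformly_locally_chain_equiconnected_at_iff]
  have "\<forall>n. \<exists>\<delta>>0. \<forall>\<eta>>0. \<exists>l. \<forall>x\<in>B'. \<forall>y\<in>B'. mdist X x y < \<delta> \<longrightarrow>
      linked X \<eta> l (mball_of X x ((1/2) ^ n)) x y"
    by (intro allI chB[THEN spec, THEN mp]) simp
  from choice[OF this] obtain \<delta>' :: "nat \<Rightarrow> real" where
    "\<forall>n. 0 < \<delta>' n \<and> (\<forall>\<eta>>0. \<exists>l. \<forall>x\<in>B'. \<forall>y\<in>B'. mdist X x y < \<delta>' n \<longrightarrow>
      linked X \<eta> l (mball_of X x ((1/2) ^ n)) x y)" ..
  then have d': "0 < \<delta>' n"
    "\<forall>\<eta>>0. \<exists>l. \<forall>x\<in>B'. \<forall>y\<in>B'. mdist X x y < \<delta>' n \<longrightarrow>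
      linked X \<eta> l (mball_of X x ((1/2) ^ n)) x y" for n by simp_all
  define \<delta> where "\<delta> n = min (\<delta>' n) ((1/2) ^ n)" for n
  have d: "0 < \<delta> n" "\<delta> n \<le> (1/2) ^ n" "\<delta> n \<le> \<delta>' n" for n using d'(1)[of n] unfolding \<delta>_def by auto
  have "\<forall>n. \<exists>l. \<forall>x\<in>B'. \<forall>y\<in>B'. mdist X x y < \<delta>' n \<longrightarrow>
      linked X (\<delta> (Suc n)) l (mball_of X x ((1/2) ^ n)) x y"
    by (intro allI d'(2)[THEN spec, THEN mp] d(1))
  from choice[OF this] obtain l :: "nat \<Rightarrow> nat" where l: "\<forall>n. \<forall>x\<in>B'. \<forall>y\<in>B'. mdist X x y < \<delta>' n \<longrightarrow>
      linked X (\<delta> (Suc n)) (l n) (mball_of X x ((1/2) ^ n)) x y" ..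
  (* At least two parts for each cell make the grid dense. *)
  define L where "L n = l n + 2" for n
  have L: "2 \<le> L n" for n unfolding L_def by simp
  define good where "good n u v c \<longleftrightarrow> c 0 = u \<and> c (L n) = v \<and>
        (\<forall>i::nat. c i \<in> mball_of X u ((1/2) ^ n) \<and> c i \<in> mspace X) \<and>
        (\<forall>i. mdist X (c i) (c (Suc i)) < \<delta> (Suc n))" for n u v c
  define C where "C n u v = (SOME c. good n u v c)" for n u v
  have C: "good n u v (C n u v)" if uv: "u \<in> B'" "v \<in> B'" "mdist X u v < \<delta> n" for n u v
  proof -
    have "mdist X u v < \<delta>' n" using uv(3) d(3)[of n] by linarith
    then have "linked X (\<delta> (Suc n)) (l n) (mball_of X u ((1/2) ^ n)) u v"
      using l[THEN spec, THEN bspec, OF uv(1), THEN bspec, OF uv(2)] by blast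
    then have "\<exists>c. good n u v c"
      unfolding good_def by (rule linked_imp_chain_function) (simp_all add: L_def d(1))
    then show ?thesis unfolding C_def by (rule someI_ex)
  qed
  have refinement: "refinement X B' \<delta> C L x y m" if xy: "x \<in> B" "y \<in> B" "mdist X x y < \<delta> m" for x y m
  proof
    show "2 \<le> L n" "0 < \<delta> n" "\<delta> n \<le> (1/2) ^ n" for n using L d by auto
    show "x \<in> mspace X" "y \<in> mspace X" using xy Bm by blast+
    show "mdist X x y < \<delta> m" by (rule xy(3))
    show "z \<in> B'" if "z \<in> mspace X" "mdist X x z \<le> 3" for z using that xy(1) unfolding B'_def by blast
    show "C n u v 0 = u \<and> C n u v (L n) = v \<and>
        (\<forall>i. C n u v i \<in> mspace X \<and> mdist X u (C n u v i) < (1/2) ^ n) \<and>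
        (\<forall>i. mdist X (C n u v i) (C n u v (Suc i)) < \<delta> (Suc n))"
      if "u \<in> B'" "v \<in> B'" "mdist X u v < \<delta> n" for n u v
      using C[OF that] unfolding good_def by simp
  qed
  define P where "P = {(t, r). \<exists>x\<in>B. \<exists>y\<in>B. \<exists>m k i k' i'. mdist X x y < \<delta> m \<and> \<delta> (Suc m) \<le> mdist X x y \<and>
      t = mdist X x y * \<bar>real_of_int i / real (cells L m k) - real_of_int i' / real (cells L m k')\<bar> / 2 \<and>
      r = mdist X (refine C L x y m k i) (refine C L x y m k' i')}"
  have bound: "r \<le> 6" if tr: "(t, r) \<in> P" for t r
  proof -
    obtain x y m k i k' i' where *: "x \<in> B" "y \<in> B" "mdist X x y < \<delta> m"
        "r = mdist X (refine C L x y m k i) (refine C L x y m k' i')"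
      using tr unfolding P_def by blast
    interpret refinement X B' \<delta> C L x y m by (rule refinement[OF *(1-3)])
    have "6 * (1/2) ^ m \<le> (6::real)" by (simp add: power_le_one)
    then show ?thesis using refine_diameter[of k i k' i'] unfolding *(4) by linarith
  qed
  have small: "\<exists>s>0. \<forall>t r. (t, r) \<in> P \<and> t < s \<longrightarrow> r \<le> e" if e: "0 < e" for e
  proof -
    obtain j :: nat where "(1/2) ^ j < e / 6" using real_arch_pow_inv[of "e / 6" "1/2"] e by auto
    then have j: "6 * (1/2) ^ j \<le> e" by simp
    define h where "h m = \<delta> (Suc m) / (2 * real (cells L m (j - m)))" for m
    have cpos: "0 < real (cells L m k)" for m k
    proof -
      have "2 ^ k \<le> cells L m k" by (rule cells_ge[OF L])
      then show ?thesis by (metis of_nat_0_less_iff less_le_trans zero_less_numeral zero_less_power)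
    qed
    have h: "0 < h m" for m unfolding h_def using d(1) cpos by simp
    define s where "s = Min (insert 1 (h ` {..<j}))"
    have s: "0 < s" "m < j \<Longrightarrow> s \<le> h m" for m
      unfolding s_def using h by (auto simp: Min_gr_iff)
    have "r \<le> e" if tr: "(t, r) \<in> P" "t < s" for t r
    proof -
      obtain x y m k i k' i' where *: "x \<in> B" "y \<in> B" "mdist X x y < \<delta> m"
          "r = mdist X (refine C L x y m k i) (refine C L x y m k' i')" and D: "\<delta> (Suc m) \<le> mdist X x y"
        and t: "t = mdist X x y * \<bar>real_of_int i / real (cells L m k) - real_of_int i' / real (cells L m k')\<bar> / 2"
        using tr(1) unfolding P_def by blast
      interpret refinement X B' \<delta> C L x y m by (rule refinement[OF *(1-3)])
      show ?thesis
      proof (cases "j \<le> m")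
        case True
        then have "6 * (1/2) ^ m \<le> 6 * (1/2::real) ^ j" by (intro mult_left_mono power_decreasing) auto
        then show ?thesis using refine_diameter[of k i k' i'] j unfolding *(4) by linarith
      next
        case False
        define w where "w = \<bar>real_of_int i / real (N k) - real_of_int i' / real (N k')\<bar>"
        have tw: "t = mdist X x y * w / 2" using t unfolding w_def .
        have "s \<le> h m" using s(2)[of m] False by simp
        then have "mdist X x y * w < 2 * h m" using tr(2) tw by linarith
        moreover have "\<delta> (Suc m) * w \<le> mdist X x y * w"
          using D by (rule mult_right_mono) (simp add: w_def)
        moreover have "2 * h m = \<delta> (Suc m) * (1 / real (N (j - m)))" unfolding h_def by simp
        ultimately have "\<delta> (Suc m) * w < \<delta> (Suc m) * (1 / real (N (j - m)))" by linarith
        then have "w < 1 / real (N (j - m))" by (rule mult_left_less_imp_less) (simp add: d(1) less_imp_le)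
        then have "mdist X (K k i) (K k' i') \<le> 5 * (1/2) ^ (m + (j - m))"
          unfolding w_def by (rule refine_near)
        also have "m + (j - m) = j" using False by simp
        finally have "mdist X (K k i) (K k' i') \<le> 5 * (1/2) ^ j" .
        moreover have "0 \<le> (1/2::real) ^ j" by simp
        ultimately show ?thesis using j unfolding *(4) by linarith
      qed
    qed
    then show ?thesis using s(1) by blast
  qed
  obtain \<omega> where om: "continuity_modulus \<omega>" and omP: "\<And>t r t'. (t, r) \<in> P \<Longrightarrow> t \<le> t' \<Longrightarrow> 0 < t' \<Longrightarrow> r \<le> \<omega> t'"
  proof (rule continuity_modulus_exists[of P 6])
    show "\<And>t r. (t, r) \<in> P \<Longrightarrow> r \<le> 6" by (rule bound)
    show "\<And>e. 0 < e \<Longrightarrow> \<exists>s>0. \<forall>t r. (t, r) \<in> P \<and> t < s \<longrightarrow> r \<le> e" by (rule small)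
    fix \<omega> assume "continuity_modulus \<omega>" "\<And>t r t'. (t, r) \<in> P \<Longrightarrow> t \<le> t' \<Longrightarrow> 0 < t' \<Longrightarrow> r \<le> \<omega> t'"
    then show thesis by (rule that)
  qed
  have trace: "\<exists>f. uniformly_continuous_map (submetric euclidean_metric Q) X f \<and>
        f 0 = x \<and> f (mdist X x y) = y \<and>
        (\<forall>t>0. modulus_of (submetric euclidean_metric Q) X f t \<le> ennreal (\<omega> t))"
    if pt: "x \<in> B" "y \<in> B" "mdist X x y < \<delta> 0" and Q: "countable Q" "Q \<subseteq> {0..mdist X x y}"
      "{0, mdist X x y} \<subseteq> Q" for x y Q
  proof -
    have xm: "x \<in> mspace X" "y \<in> mspace X" using pt Bm by blast+
    have suff: ?thesis
      if f: "f 0 = x" "f (mdist X x y) = y" "\<And>q. q \<in> Q \<Longrightarrow> f q \<in> mspace X"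
        "\<And>q q' t. q \<in> Q \<Longrightarrow> q' \<in> Q \<Longrightarrow> \<bar>q - q'\<bar> \<le> t \<Longrightarrow> 0 < t \<Longrightarrow> mdist X (f q) (f q') \<le> \<omega> t" for f
    proof (intro exI[of _ f] conjI f(1,2) allI impI)
      show "modulus_of (submetric euclidean_metric Q) X f t \<le> ennreal (\<omega> t)" if "0 < t" for t
        using f(4) that by (intro modulus_of_leI) (auto simp: dist_real_def)
      show "uniformly_continuous_map (submetric euclidean_metric Q) X f"
        unfolding uniformly_continuous_map_def
      proof (intro conjI allI impI)
        show "f \<in> mspace (submetric euclidean_metric Q) \<rightarrow> mspace X" using f(3) by auto
        fix e :: real assume "0 < e"
        then obtain t where t: "0 < t" "\<omega> t < e" using continuity_modulus_small[OF om] by blast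
        have "mdist X (f q') (f q) < e" if "q \<in> Q" "q' \<in> Q" "dist q' q < t" for q q'
          using f(4)[OF that(2,1) _ t(1)] that(3) t(2) by (simp add: dist_real_def)
        then show "\<exists>t>0. \<forall>q\<in>mspace (submetric euclidean_metric Q). \<forall>q'\<in>mspace (submetric euclidean_metric Q).
            mdist (submetric euclidean_metric Q) q' q < t \<longrightarrow> mdist X (f q') (f q) < e"
          using t(1) by (intro exI[of _ t]) auto
      qed
    qed
    show ?thesis
    proof (cases "mdist X x y = 0")
      case True
      then have "x = y" using xm by simp
      show ?thesis
      proof (rule suff[of "\<lambda>_. x"])
        show "mdist X x x \<le> \<omega> t" if "0 < t" for t
          using continuity_modulus_pos[OF om that] xm by simp
      qed (use xm \<open>x = y\<close> in auto)
    next
      case False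
      define D where "D = mdist X x y"
      have D: "0 < D" "D < \<delta> 0" using False pt(3) mdist_nonneg[of X x y] unfolding D_def by linarith+
      have lim: "\<exists>n. \<delta> n \<le> D"
      proof -
        obtain n :: nat where "(1/2) ^ n < D" using real_arch_pow_inv[of D "1/2"] D(1) by auto
        then show ?thesis using d(2)[of n] by (intro exI[of _ n]) linarith
      qed
      define n where "n = (LEAST n. \<delta> n \<le> D)"
      have n: "\<delta> n \<le> D" unfolding n_def using lim by (rule LeastI_ex)
      then have "n \<noteq> 0" using D(2) by (intro notI) simp
      then obtain m where nm: "n = Suc m" using not0_implies_Suc by blast
      have Dm: "D < \<delta> m" using not_less_Least[of m "\<lambda>n. \<delta> n \<le> D"] nm unfolding n_def by simp
      interpret refinement X B' \<delta> C L x y m by (rule refinement) (use pt Dm in \<open>simp_all add: D_def\<close>)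
      define G where "G = {real_of_int i / real (N k) | i k. True}"
      have G01: "0 \<in> G" "1 \<in> G" unfolding G_def by (force intro: exI[of _ 0] exI[of _ "0::nat"] exI[of _ 1])+
      have dense: "\<exists>g\<in>G. a < g \<and> g < b" if "a < b" for a b
        unfolding G_def by (rule cells_grid_dense[OF L that])
      obtain h where hG: "\<And>q. q \<in> Q \<Longrightarrow> h q \<in> G" and h01: "h 0 = 0" "h D = 1" and
          hL: "\<And>q q'. q \<in> Q \<Longrightarrow> q' \<in> Q \<Longrightarrow> \<bar>h q - h q'\<bar> \<le> 2 / D * \<bar>q - q'\<bar>"
        using Lipschitz_map_into_dense_set[OF Q(1) _ D(1) G01 dense] Q(3) unfolding D_def by metis
      have "\<forall>q\<in>Q. \<exists>ik. h q = real_of_int (fst ik) / real (N (snd ik))"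
        using hG unfolding G_def by fastforce
      from bchoice[OF this] obtain ik where ik: "\<And>q. q \<in> Q \<Longrightarrow> h q = real_of_int (fst (ik q)) / real (N (snd (ik q)))"
        by blast
      define f where "f q = K (snd (ik q)) (fst (ik q))" for q
      have Q0D: "0 \<in> Q" "D \<in> Q" using Q(3) unfolding D_def by auto
      show ?thesis
      proof (rule suff[of f])
        have "f 0 = K 0 0" unfolding f_def by (rule refine_same) (use ik[OF Q0D(1)] h01 in simp)
        then show "f 0 = x" by simp
        have "f D = K 0 1" unfolding f_def by (rule refine_same) (use ik[OF Q0D(2)] h01 in simp)
        then show "f (mdist X x y) = y" unfolding D_def by simp
        show "f q \<in> mspace X" for q unfolding f_def by (rule refine_mem)
        show "mdist X (f q) (f q') \<le> \<omega> t" if q: "q \<in> Q" "q' \<in> Q" "\<bar>q - q'\<bar> \<le> t" "0 < t" for q q' t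
        proof (rule omP[OF _ _ q(4)])
          show "(D * \<bar>h q - h q'\<bar> / 2, mdist X (f q) (f q')) \<in> P"
            unfolding P_def mem_Collect_eq case_prod_conv
            by (rule bexI[OF _ pt(1)], rule bexI[OF _ pt(2)], rule exI[of _ m],
                rule exI[of _ "snd (ik q)"], rule exI[of _ "fst (ik q)"],
                rule exI[of _ "snd (ik q')"], rule exI[of _ "fst (ik q')"])
              (use Dm n nm in \<open>simp add: D_def f_def ik[OF q(1)] ik[OF q(2)]\<close>)
          have "D * \<bar>h q - h q'\<bar> / 2 \<le> D * (2 / D * \<bar>q - q'\<bar>) / 2"
            using hL[OF q(1,2)] D(1) by (intro divide_right_mono mult_left_mono) auto
          also have "\<dots> = \<bar>q - q'\<bar>" using D(1) by simp
          finally show "D * \<bar>h q - h q'\<bar> / 2 \<le> t" using q(3) by linarith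
        qed
      qed
    qed
  qed
  show ?thesis
    unfolding uniformly_locally_trace_equiconnected_at_def
  proof (rule exI[of _ "\<delta> 0"], intro conjI d(1), rule exI[of _ \<omega>], intro conjI om ballI impI allI)
    fix x y and Q :: "real set"
    assume "x \<in> B" "y \<in> B" "mdist X x y < \<delta> 0" and
      "countable Q \<and> Q \<subseteq> {0..mdist X x y} \<and> {0..mdist X x y} \<subseteq> closure Q \<and> {0, mdist X x y} \<subseteq> Q"
    then show "\<exists>f. uniformly_continuous_map (submetric euclidean_metric Q) X f \<and>
        f 0 = x \<and> f (mdist X x y) = y \<and>
        (\<forall>t>0. modulus_of (submetric euclidean_metric Q) X f t \<le> ennreal (\<omega> t))"
      by (elim conjE) (rule trace)
  qed
qed

section \<open>Retractions onto a hyperspace with controlled paths\<close>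

text \<open>The two cut-off functions of the relative distance of a set \<open>A\<close> from a point \<open>m\<close>, that is, of the
  distance divided by the distance of \<open>m\<close> from the hyperspace. A set is a starting point of paths
  up to relative distance \<open>2\<close>, and it is reached by paths from the nearest sets
  fully up to relative distance \<open>2\<close> and not at all beyond \<open>3\<close>. That the first range ends where
  full coverage ends is what makes the retraction continuous.\<close>

definition rise :: "real \<Rightarrow> real" where "rise t = max 0 (min 1 (4 - 2 * t))"
definition reach :: "real \<Rightarrow> real" where "reach t = max 0 (min 1 (3 - t))"

lemma rise_bounds: "0 \<le> rise t" "rise t \<le> 1" "\<bar>rise s - rise t\<bar> \<le> 2 * \<bar>s - t\<bar>"
  unfolding rise_def by (auto simp: max_def min_def abs_if)

lemma reach_bounds: "0 \<le> reach t" "reach t \<le> 1" "\<bar>reach s - reach t\<bar> \<le> \<bar>s - t\<bar>"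
  unfolding reach_def by (auto simp: max_def min_def abs_if)

lemma min_close:
  fixes a b a' b' :: real
  assumes "\<bar>a - a'\<bar> < r" "\<bar>b - b'\<bar> < r"
  shows "\<bar>min a b - min a' b'\<bar> < r"
  using assms by (auto simp: min_def abs_if split: if_splits)

text \<open>Relative distances are Lipschitz in the point, with a constant that is uniform over all sets,
  once they are truncated at \<open>4\<close>.\<close>

lemma ratio_close:
  fixes u u' D D' r :: real
  assumes D: "0 < D" "D / 2 \<le> D'" and u: "0 \<le> u" "0 \<le> u'" and r: "\<bar>u - u'\<bar> \<le> r" "\<bar>D - D'\<bar> \<le> r"
  shows "\<bar>min (u / D) 4 - min (u' / D') 4\<bar> \<le> 10 * r / D"
proof -
  have D': "0 < D'" using D by linarith
  have r0: "0 \<le> r" using r by linarith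
  have *: "\<bar>v / E - v' / E'\<bar> \<le> 5 * r / E'"
    if "0 < E" "0 < E'" "0 \<le> v" "v / E \<le> 4" "\<bar>v - v'\<bar> \<le> r" "\<bar>E - E'\<bar> \<le> r" for v v' E E' :: real
  proof -
    define w where "w = (v / E) * (E - E')"
    have "v / E - v' / E' = (v - v' - w) / E'"
      using that(1,2) unfolding w_def by (simp add: field_simps)
    moreover have "\<bar>v - v' - w\<bar> \<le> 5 * r"
    proof -
      have "\<bar>w\<bar> \<le> 4 * r"
        unfolding w_def abs_mult using that by (intro mult_mono) auto
      then show ?thesis using that(5) by linarith
    qed
    ultimately show ?thesis using that(2) by (simp add: abs_divide divide_right_mono)
  qed
  have half: "5 * r / D' \<le> 10 * r / D"
  proof -
    have "5 * r * D \<le> 5 * r * (2 * D')" using D r0 by (intro mult_left_mono) auto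
    then show ?thesis using D(1) D' by (simp add: field_simps)
  qed
  have half': "5 * r / D \<le> 10 * r / D" using D(1) r0 by (simp add: divide_right_mono)
  consider "u / D \<le> 4" | "u' / D' \<le> 4" | "4 < u / D" "4 < u' / D'" by linarith
  then show ?thesis
  proof cases
    case 1
    have "\<bar>u / D - u' / D'\<bar> \<le> 5 * r / D'" by (rule *[OF D(1) D' u(1) 1 r])
    then show ?thesis using half by linarith
  next
    case 2
    have "\<bar>u' / D' - u / D\<bar> \<le> 5 * r / D" 
      by (rule *[OF D' D(1) u(2) 2]) (use r in \<open>simp_all add: abs_minus_commute\<close>)
    then show ?thesis using half' by linarith
  next
    case 3
    then show ?thesis using D(1) r0 by simp
  qed
qed

text \<open>Only unions of these families of sets will be formed. Therefore the condition at the end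
  is that the second set is covered, and continuity is one-sided closeness for all pairs of times.\<close>

definition controlled_paths :: "'a metric \<Rightarrow> ('a set \<Rightarrow> 'a set \<Rightarrow> real \<Rightarrow> 'a set) \<Rightarrow> 'a set set \<Rightarrow> bool" where
  "controlled_paths X \<Gamma> \<N> \<longleftrightarrow>
     (\<forall>A\<in>\<N>. \<forall>B\<in>\<N>. B \<subseteq> \<Gamma> A B 1 \<and> (\<forall>s\<in>{0..1}. near_in X 1 (\<Gamma> A B s) A)) \<and>
     (\<forall>e>0. \<exists>s0>0. \<forall>A\<in>\<N>. \<forall>B\<in>\<N>. \<forall>s\<in>{0..1}. \<forall>t\<in>{0..1}.
        \<bar>s - t\<bar> < s0 \<longrightarrow> near_in X e (\<Gamma> A B s) (\<Gamma> A B t)) \<and>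
     (\<forall>e>0. \<exists>\<delta>>0. \<forall>A\<in>\<N>. \<forall>B\<in>\<N>. \<forall>s\<in>{0..1}.
        mdist (Bd X) A B < \<delta> \<longrightarrow> near_in X e (\<Gamma> A B s) A)"

locale hyperspace_paths =
  fixes X :: "'a metric" and \<Gamma> :: "'a set \<Rightarrow> 'a set \<Rightarrow> real \<Rightarrow> 'a set" and \<kappa> :: "'a set \<Rightarrow> real"
  assumes \<Gamma>_sub: "\<And>A B s. A \<in> bounded_hyperspace X \<Longrightarrow> B \<in> bounded_hyperspace X \<Longrightarrow> \<Gamma> A B s \<subseteq> mspace X"
    and \<Gamma>_start: "\<And>A B. A \<in> bounded_hyperspace X \<Longrightarrow> B \<in> bounded_hyperspace X \<Longrightarrow> \<Gamma> A B 0 = A"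
    and \<Gamma>_contains: "\<And>A B s. A \<subseteq> \<Gamma> A B s"
    and \<kappa>: "\<And>A0. A0 \<in> bounded_hyperspace X \<Longrightarrow> 0 < \<kappa> A0"
    and controlled: "\<And>A0. A0 \<in> bounded_hyperspace X \<Longrightarrow>
        controlled_paths X \<Gamma> (mball_of (Bd X) A0 (\<kappa> A0))"
begin

lemma
  assumes "A0 \<in> bounded_hyperspace X"
    and "A \<in> mball_of (Bd X) A0 (\<kappa> A0)" "B \<in> mball_of (Bd X) A0 (\<kappa> A0)"
  shows \<Gamma>_end: "B \<subseteq> \<Gamma> A B 1"
    and \<Gamma>_bounded: "s \<in> {0..1} \<Longrightarrow> near_in X 1 (\<Gamma> A B s) A"
  using controlled[OF assms(1), unfolded controlled_paths_def, THEN conjunct1,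
      THEN bspec, OF assms(2), THEN bspec, OF assms(3)] by simp_all

lemma
  assumes "A0 \<in> bounded_hyperspace X" "0 < e"
  shows \<Gamma>_continuous: "\<exists>s0>0. \<forall>A\<in>mball_of (Bd X) A0 (\<kappa> A0). \<forall>B\<in>mball_of (Bd X) A0 (\<kappa> A0).
      \<forall>s\<in>{0..1}. \<forall>t\<in>{0..1}. \<bar>s - t\<bar> < s0 \<longrightarrow> near_in X e (\<Gamma> A B s) (\<Gamma> A B t)"
    and \<Gamma>_small: "\<exists>\<delta>>0. \<forall>A\<in>mball_of (Bd X) A0 (\<kappa> A0). \<forall>B\<in>mball_of (Bd X) A0 (\<kappa> A0).
      \<forall>s\<in>{0..1}. mdist (Bd X) A B < \<delta> \<longrightarrow> near_in X e (\<Gamma> A B s) A"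
  using controlled[OF assms(1), unfolded controlled_paths_def, THEN conjunct2, THEN conjunct1,
      THEN spec, THEN mp, OF assms(2)]
    controlled[OF assms(1), unfolded controlled_paths_def, THEN conjunct2, THEN conjunct2,
      THEN spec, THEN mp, OF assms(2)] by (elim exE conjE; blast)+

end

locale hyperspace_extension = hyperspace_paths X \<Gamma> \<kappa>
  for X :: "'a metric" and \<Gamma> \<kappa> +
  fixes M :: "'m metric" and e :: "'a set \<Rightarrow> 'm"
  assumes e_in: "\<And>A. A \<in> bounded_hyperspace X \<Longrightarrow> e A \<in> mspace M"
    and e_iso: "\<And>A B. A \<in> bounded_hyperspace X \<Longrightarrow> B \<in> bounded_hyperspace X \<Longrightarrow>
        mdist M (e A) (e B) = mdist (Bd X) A B"
    and e_closed: "closedin (mtopology_of M) (e ` bounded_hyperspace X)"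
    and nonempty: "bounded_hyperspace X \<noteq> {}"
begin

abbreviation H where "H \<equiv> bounded_hyperspace X"

text \<open>\<open>D m\<close> is the distance of \<open>m\<close> from the copy of the hyperspace, \<open>\<sigma> A m\<close> the truncated relative
  distance of \<open>A\<close> from \<open>m\<close>, and the closure of \<open>P m\<close> will be the image of \<open>m\<close>.\<close>

definition D :: "'m \<Rightarrow> real" where "D m = (INF A\<in>H. mdist M m (e A))"

definition \<sigma> :: "'a set \<Rightarrow> 'm \<Rightarrow> real" where "\<sigma> A m = min (mdist M m (e A) / D m) 4"

definition P :: "'m \<Rightarrow> 'a set" where
  "P m = \<Union>{\<Gamma> A B (min (rise (\<sigma> A m)) (reach (\<sigma> B m))) | A B. A \<in> H \<and> B \<in> H \<and> \<sigma> A m \<le> 2}"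

lemma D_le: "A \<in> H \<Longrightarrow> D m \<le> mdist M m (e A)"
  unfolding D_def by (intro cINF_lower bdd_belowI[of _ 0]) auto

lemma D_lt_ex: "D m < c \<Longrightarrow> \<exists>A\<in>H. mdist M m (e A) < c"
  unfolding D_def using cInf_lessD[of "(\<lambda>A. mdist M m (e A)) ` H" c] nonempty by auto

lemma D_close:
  assumes "m \<in> mspace M" "m' \<in> mspace M"
  shows "\<bar>D m - D m'\<bar> \<le> mdist M m m'"
proof -
  have *: "D m \<le> mdist M m m' + D m'" if "m \<in> mspace M" "m' \<in> mspace M" for m m'
  proof (rule field_le_epsilon)
    fix c :: real assume "0 < c"
    then obtain A where A: "A \<in> H" "mdist M m' (e A) < D m' + c" using D_lt_ex[of m' "D m' + c"] by auto
    have "D m \<le> mdist M m m' + mdist M m' (e A)"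
      using D_le[OF A(1), of m] mdist_triangle[OF that e_in[OF A(1)]] by linarith
    then show "D m \<le> mdist M m m' + D m' + c" using A(2) by linarith
  qed
  show ?thesis using *[OF assms] *[OF assms(2,1)] mdist_commute[of M m m'] by linarith
qed

lemma D_pos:
  assumes "m \<in> mspace M - e ` H"
  shows "0 < D m"
proof -
  have "openin (mtopology_of M) (mspace M - e ` H)"
    using e_closed unfolding closedin_def by simp
  then obtain r where r: "0 < r" "\<forall>y\<in>mspace M. mdist M m y < r \<longrightarrow> y \<in> mspace M - e ` H"
    using assms unfolding openin_mtopology_of by blast
  have "r \<le> D m"
  proof (rule ccontr)
    assume "\<not> r \<le> D m"
    then obtain A where "A \<in> H" "mdist M m (e A) < r" using D_lt_ex[of m r] by auto
    then show False using r(2) e_in by blast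
  qed
  then show ?thesis using r(1) by linarith
qed

lemma \<sigma>_lt_4:
  assumes "m \<in> mspace M - e ` H" "\<sigma> A m < 4"
  shows "mdist M m (e A) < 4 * D m"
  using assms D_pos[OF assms(1)] unfolding \<sigma>_def by (simp add: min_less_iff_disj pos_divide_less_eq)

lemma \<sigma>_near:
  assumes m: "m \<in> mspace M - e ` H" and A: "A \<in> H" "\<sigma> A m < 4" and A0: "A0 \<in> H"
  shows "mdist (Bd X) A0 A < 5 * mdist M m (e A0)"
proof -
  have "mdist (Bd X) A0 A = mdist M (e A0) (e A)" using e_iso A0 A(1) by simp
  also have "\<dots> \<le> mdist M (e A0) m + mdist M m (e A)"
    using m e_in A0 A(1) by (intro mdist_triangle) auto
  also have "\<dots> < mdist M (e A0) m + 4 * D m" using \<sigma>_lt_4[OF m A(2)] by simp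
  also have "\<dots> \<le> 5 * mdist M m (e A0)" using D_le[OF A0, of m] mdist_commute[of M "e A0" m] by linarith
  finally show ?thesis .
qed

lemma \<sigma>_near_ball:
  assumes m: "m \<in> mspace M - e ` H" and A: "A \<in> H" "\<sigma> A m < 4" and A0: "A0 \<in> H"
    and close: "mdist M m (e A0) < \<kappa> A0 / 5"
  shows "A \<in> mball_of (Bd X) A0 (\<kappa> A0)"
  using \<sigma>_near[OF m A A0] close A(1) A0 by simp

lemma ex_close_member:
  assumes m: "m \<in> mspace M - e ` H"
  obtains C where "C \<in> H" "\<sigma> C m < 3/2"
proof -
  have "D m < 3/2 * D m" using D_pos[OF m] by simp
  then obtain C where C: "C \<in> H" "mdist M m (e C) < 3/2 * D m" using D_lt_ex by blast
  then have "mdist M m (e C) / D m < 3/2" using D_pos[OF m] by (simp add: pos_divide_less_eq)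
  then have "\<sigma> C m < 3/2" unfolding \<sigma>_def by linarith
  then show thesis using C(1) that by blast
qed

lemma \<sigma>_equicontinuous:
  assumes m: "m \<in> mspace M - e ` H" and \<tau>: "0 < \<tau>"
  obtains \<rho> where "0 < \<rho>" "\<rho> \<le> D m" "\<And>m' A. m' \<in> mspace M \<Longrightarrow> mdist M m m' < \<rho> \<Longrightarrow> A \<in> H \<Longrightarrow>
    \<bar>\<sigma> A m - \<sigma> A m'\<bar> < \<tau>"
proof
  let ?\<rho> = "min (D m / 2) (\<tau> * D m / 20)"
  show "0 < ?\<rho>" "?\<rho> \<le> D m" using D_pos[OF m] \<tau> by auto
  fix m' A assume m': "m' \<in> mspace M" and close: "mdist M m m' < ?\<rho>" and A: "A \<in> H"
  have mM: "m \<in> mspace M" using m by blast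
  have DD: "\<bar>D m - D m'\<bar> \<le> mdist M m m'" by (rule D_close[OF mM m'])
  have dd: "\<bar>mdist M m (e A) - mdist M m' (e A)\<bar> \<le> mdist M m m'"
    using mdist_triangle[OF mM m' e_in[OF A]] mdist_triangle[OF m' mM e_in[OF A]] mdist_commute[of M m m']
    by linarith
  have "D m / 2 \<le> D m'" using DD close by linarith
  then have "\<bar>\<sigma> A m - \<sigma> A m'\<bar> \<le> 10 * mdist M m m' / D m"
    unfolding \<sigma>_def by (intro ratio_close D_pos[OF m] mdist_nonneg dd DD)
  also have "\<dots> < \<tau>"
  proof -
    have "10 * mdist M m m' < \<tau> * D m" using close mdist_nonneg[of M m m'] D_pos[OF m] \<tau> by linarith
    then show ?thesis using D_pos[OF m] by (simp add: pos_divide_less_eq)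
  qed
  finally show "\<bar>\<sigma> A m - \<sigma> A m'\<bar> < \<tau>" .
qed

lemma P_I: "A \<in> H \<Longrightarrow> B \<in> H \<Longrightarrow> \<sigma> A m \<le> 2 \<Longrightarrow> \<Gamma> A B (min (rise (\<sigma> A m)) (reach (\<sigma> B m))) \<subseteq> P m"
  unfolding P_def by blast

lemma P_E:
  assumes "z \<in> P m"
  obtains A B where "A \<in> H" "B \<in> H" "\<sigma> A m \<le> 2" "z \<in> \<Gamma> A B (min (rise (\<sigma> A m)) (reach (\<sigma> B m)))"
  using assms unfolding P_def by blast

lemma P_sub: "P m \<subseteq> mspace X"
  unfolding P_def using \<Gamma>_sub by blast

text \<open>Paths towards sets outside the region of control are frozen at their starting point.\<close>

lemma far_partner:
  assumes "m \<in> mspace M - e ` H" "B \<in> H" "A0 \<in> H" "mdist M m (e A0) < \<kappa> A0 / 5"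
    and "B \<notin> mball_of (Bd X) A0 (\<kappa> A0)"
  shows "min (rise t) (reach (\<sigma> B m)) = 0"
proof -
  have "\<not> \<sigma> B m < 4" using \<sigma>_near_ball[OF assms(1,2) _ assms(3,4)] assms(5) by blast
  then have "reach (\<sigma> B m) = 0" unfolding reach_def by simp
  then show ?thesis using rise_bounds(1)[of t] by simp
qed

lemma time_in: "min (rise t) (reach u) \<in> {0..1}"
  using rise_bounds[of t] reach_bounds[of u] by auto

text \<open>When \<open>m\<close> is replaced by a near point \<open>m'\<close>, the time along a path that is kept changes little.
  A path from \<open>A\<close> can disappear only if the relative distance of \<open>A\<close> crosses \<open>2\<close>; then its time
  is almost \<open>0\<close>, so its set is close to \<open>A\<close>, and \<open>A\<close> is almost covered by the path
  from a nearest set \<open>C\<close> to \<open>A\<close>, which belongs to \<open>P m'\<close> and is almost completed.\<close>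

lemma P_near_P:
  assumes m: "m \<in> mspace M - e ` H" "m' \<in> mspace M - e ` H" and A0: "A0 \<in> H"
    and close: "mdist M m (e A0) < \<kappa> A0 / 5" "mdist M m' (e A0) < \<kappa> A0 / 5"
    and s0: "0 < s0" "\<And>A B s t. A \<in> mball_of (Bd X) A0 (\<kappa> A0) \<Longrightarrow> B \<in> mball_of (Bd X) A0 (\<kappa> A0) \<Longrightarrow>
        s \<in> {0..1} \<Longrightarrow> t \<in> {0..1} \<Longrightarrow> \<bar>s - t\<bar> < s0 \<Longrightarrow> near_in X c (\<Gamma> A B s) (\<Gamma> A B t)"
    and \<tau>: "2 * \<tau> \<le> s0" "\<tau> \<le> 1" and \<sigma>\<sigma>: "\<And>A. A \<in> H \<Longrightarrow> \<bar>\<sigma> A m - \<sigma> A m'\<bar> < \<tau>" and c: "0 < c"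
  shows "near_in X (2 * c) (P m) (P m')"
  unfolding near_in_def
proof
  fix z assume z: "z \<in> P m"
  obtain A B where AB: "A \<in> H" "B \<in> H" "\<sigma> A m \<le> 2"
    and zin: "z \<in> \<Gamma> A B (min (rise (\<sigma> A m)) (reach (\<sigma> B m)))" using z by (rule P_E)
  define s where "s = min (rise (\<sigma> A m)) (reach (\<sigma> B m))"
  define s' where "s' = min (rise (\<sigma> A m')) (reach (\<sigma> B m'))"
  have zs: "z \<in> \<Gamma> A B s" using zin unfolding s_def .
  have zX: "z \<in> mspace X" using z P_sub by blast
  have ss: "s \<in> {0..1}" "s' \<in> {0..1}" unfolding s_def s'_def by (rule time_in)+
  have "\<bar>s - s'\<bar> < 2 * \<tau>"
    unfolding s_def s'_def
  proof (rule min_close)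
    show "\<bar>rise (\<sigma> A m) - rise (\<sigma> A m')\<bar> < 2 * \<tau>"
      by (rule order_le_less_trans[OF rise_bounds(3)]) (use \<sigma>\<sigma>[OF AB(1)] in simp)
    show "\<bar>reach (\<sigma> B m) - reach (\<sigma> B m')\<bar> < 2 * \<tau>"
      by (rule order_le_less_trans[OF reach_bounds(3)])
        (use \<sigma>\<sigma>[OF AB(2)] abs_ge_zero[of "\<sigma> B m - \<sigma> B m'"] in linarith)
  qed
  then have ss': "\<bar>s - s'\<bar> < s0" using \<tau> by linarith
  have Ab: "A \<in> mball_of (Bd X) A0 (\<kappa> A0)" using \<sigma>_near_ball[OF m(1) AB(1) _ A0 close(1)] AB(3) by simp
  show "\<exists>b\<in>P m'. mdist X z b < 2 * c"
  proof (cases "\<sigma> A m' \<le> 2")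
    case True
    have "\<exists>b\<in>\<Gamma> A B s'. mdist X z b < c"
    proof (cases "B \<in> mball_of (Bd X) A0 (\<kappa> A0)")
      case True
      then show ?thesis using s0(2)[OF Ab True ss ss'] zs unfolding near_in_def by blast
    next
      case False
      have "s = 0" "s' = 0"
        unfolding s_def s'_def using far_partner[OF _ AB(2) A0 _ False] m close by blast+
      then show ?thesis using zs zX c by (intro bexI[of _ z]) auto
    qed
    moreover have "\<Gamma> A B s' \<subseteq> P m'" unfolding s'_def by (rule P_I[OF AB(1,2) True])
    ultimately obtain b where "b \<in> P m'" "mdist X z b < c" by blast
    then show ?thesis using c by (intro bexI[of _ b]) auto
  next
    case False
    have "rise (\<sigma> A m) < 2 * \<tau>" using False \<sigma>\<sigma>[OF AB(1)] unfolding rise_def by linarith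
    then have s_small: "\<bar>s - 0\<bar> < s0" using \<tau> ss unfolding s_def by auto
    have "\<exists>a\<in>\<Gamma> A B 0. mdist X z a < c"
    proof (cases "B \<in> mball_of (Bd X) A0 (\<kappa> A0)")
      case True
      have "near_in X c (\<Gamma> A B s) (\<Gamma> A B 0)" by (rule s0(2)[OF Ab True ss(1) _ s_small]) simp
      then show ?thesis using zs unfolding near_in_def by blast
    next
      case False
      have "s = 0" unfolding s_def using far_partner[OF _ AB(2) A0 _ False] m close by blast
      then show ?thesis using zs zX c by (intro bexI[of _ z]) auto
    qed
    then obtain a where a: "a \<in> A" "mdist X z a < c" unfolding \<Gamma>_start[OF AB(1,2)] by blast
    obtain C where C: "C \<in> H" "\<sigma> C m' < 3/2" using ex_close_member[OF m(2)] .
    define u where "u = min (rise (\<sigma> C m')) (reach (\<sigma> A m'))"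
    have "rise (\<sigma> C m') = 1" using C(2) unfolding rise_def by simp
    moreover have "1 - \<tau> \<le> reach (\<sigma> A m')" using \<sigma>\<sigma>[OF AB(1)] AB(3) \<tau> unfolding reach_def by linarith
    ultimately have "\<bar>1 - u\<bar> < s0"
      using reach_bounds[of "\<sigma> A m'"] \<tau>(1) s0(1) unfolding u_def by linarith
    moreover have Cb: "C \<in> mball_of (Bd X) A0 (\<kappa> A0)"
      using \<sigma>_near_ball[OF m(2) C(1) _ A0 close(2)] C(2) by simp
    moreover have "u \<in> {0..1}" unfolding u_def by (rule time_in)
    ultimately have "near_in X c (\<Gamma> C A 1) (\<Gamma> C A u)" by (intro s0(2)[OF Cb Ab]) simp_all
    moreover have "a \<in> \<Gamma> C A 1" using \<Gamma>_end[OF A0 Cb Ab] a(1) by blast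
    ultimately obtain b where b: "b \<in> \<Gamma> C A u" "mdist X a b < c" unfolding near_in_def by blast
    have "b \<in> P m'" using P_I[OF C(1) AB(1), of m'] C(2) b(1) unfolding u_def by auto
    moreover have "mdist X z b < 2 * c"
      using mdist_triangle[of z X a b] zX a b(2) \<open>b \<in> P m'\<close> P_sub bounded_hyperspaceD(2)[OF AB(1)] by force
    ultimately show ?thesis by blast
  qed
qed

text \<open>Near a point of the copy of the hyperspace only short paths contribute. This gives continuity
  of the retraction at such points as well as boundedness of its values.\<close>

lemma P_near_point:
  assumes m: "m \<in> mspace M - e ` H" and A0: "A0 \<in> H" and close: "mdist M m (e A0) < \<kappa> A0 / 5"
    and near: "\<And>A B s. A \<in> mball_of (Bd X) A0 (\<kappa> A0) \<Longrightarrow> B \<in> mball_of (Bd X) A0 (\<kappa> A0) \<Longrightarrow>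
        mdist (Bd X) A B < 10 * mdist M m (e A0) \<Longrightarrow> s \<in> {0..1} \<Longrightarrow> near_in X c (\<Gamma> A B s) A"
    and c: "0 < c"
  shows "near_in X (c + 5 * mdist M m (e A0)) (P m) A0"
  unfolding near_in_def
proof
  fix z assume z: "z \<in> P m"
  obtain A B where AB: "A \<in> H" "B \<in> H" "\<sigma> A m \<le> 2"
    and zin: "z \<in> \<Gamma> A B (min (rise (\<sigma> A m)) (reach (\<sigma> B m)))" using z by (rule P_E)
  define s where "s = min (rise (\<sigma> A m)) (reach (\<sigma> B m))"
  have zs: "z \<in> \<Gamma> A B s" using zin unfolding s_def .
  have zX: "z \<in> mspace X" using z P_sub by blast
  have ss: "s \<in> {0..1}" unfolding s_def by (rule time_in)
  have A4: "\<sigma> A m < 4" using AB(3) by simp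
  have Ab: "A \<in> mball_of (Bd X) A0 (\<kappa> A0)" by (rule \<sigma>_near_ball[OF m AB(1) A4 A0 close])
  have "\<exists>a\<in>A. mdist X z a < c"
  proof (cases "\<sigma> B m < 4")
    case True
    have Bb: "B \<in> mball_of (Bd X) A0 (\<kappa> A0)" by (rule \<sigma>_near_ball[OF m AB(2) True A0 close])
    have "mdist (Bd X) A B \<le> mdist (Bd X) A A0 + mdist (Bd X) A0 B"
      using AB A0 by (intro mdist_triangle) auto
    then have "mdist (Bd X) A B < 10 * mdist M m (e A0)"
      using \<sigma>_near[OF m AB(1) A4 A0] \<sigma>_near[OF m AB(2) True A0] mdist_commute[of "Bd X" A A0] by linarith
    then show ?thesis using near[OF Ab Bb _ ss] zs unfolding near_in_def by blast
  next
    case False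
    then have "s = 0" using rise_bounds(1)[of "\<sigma> A m"] unfolding s_def reach_def by simp
    then show ?thesis using zs zX c unfolding \<open>s = 0\<close> \<Gamma>_start[OF AB(1,2)] by (intro bexI[of _ z]) auto
  qed
  then obtain a where a: "a \<in> A" "mdist X z a < c" by blast
  have "near_in X (5 * mdist M m (e A0)) A A0"
    using near_in_of_mdist_Bd(2)[OF A0 AB(1) \<sigma>_near[OF m AB(1) A4 A0]] .
  then obtain b where b: "b \<in> A0" "mdist X a b < 5 * mdist M m (e A0)" using a(1) unfolding near_in_def by blast
  have "mdist X z b < c + 5 * mdist M m (e A0)"
    using mdist_triangle[of z X a b] zX a b bounded_hyperspaceD(2)[OF AB(1)] bounded_hyperspaceD(2)[OF A0] by force
  then show "\<exists>b\<in>A0. mdist X z b < c + 5 * mdist M m (e A0)" using b(1) by blast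
qed

lemma point_near_P:
  assumes m: "m \<in> mspace M - e ` H" and A0: "A0 \<in> H"
  shows "near_in X (5 * mdist M m (e A0)) A0 (P m)"
proof -
  obtain C where C: "C \<in> H" "\<sigma> C m < 3/2" using ex_close_member[OF m] .
  have "near_in X (5 * mdist M m (e A0)) A0 C"
    using \<sigma>_near[OF m C(1) _ A0] C(2) by (intro near_in_of_mdist_Bd(1)[OF A0 C(1)]) simp
  moreover have "C \<subseteq> P m" using \<Gamma>_contains[of C C] P_I[OF C(1) C(1), of m] C(2) by fastforce
  ultimately show ?thesis by (rule near_in_mono[OF _ order_refl subset_refl])
qed

text \<open>For \<open>m\<close> in this neighbourhood of the copy, all sets of relative distance less than \<open>4\<close> lie in
  a region of control: their distance from \<open>A0\<close> is less than five times that of \<open>m\<close> from \<open>e A0\<close>.\<close>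

definition U :: "'m set" where "U = (\<Union>A0\<in>H. mball_of M (e A0) (\<kappa> A0 / 5))"

definition R :: "'m \<Rightarrow> 'm" where
  "R m = (if m \<in> e ` H then m else e (mtopology_of X closure_of P m))"

lemma closure_P_in_H:
  assumes "m \<in> U - e ` H"
  shows "mtopology_of X closure_of P m \<in> H"
proof -
  obtain A0 where A0: "A0 \<in> H" "mdist M (e A0) m < \<kappa> A0 / 5" and mM: "m \<in> mspace M"
    using assms unfolding U_def by auto
  have m: "m \<in> mspace M - e ` H" and close: "mdist M m (e A0) < \<kappa> A0 / 5"
    using assms mM A0(2) by (auto simp: mdist_commute)
  have "near_in X (1 + 5 * mdist M m (e A0)) (P m) A0"
    by (rule P_near_point[OF m A0(1) close]) (auto intro: \<Gamma>_bounded[OF A0(1)])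
  then have "\<exists>a\<in>A0. mdist X z a \<le> 1 + 5 * mdist M m (e A0)" if "z \<in> P m" for z
    using that unfolding near_in_def by (meson less_imp_le)
  then have "bounded_in X (P m)"
    by (rule bounded_in_neighbourhood[OF bounded_hyperspaceD(4)[OF A0(1)] P_sub])
  moreover have "P m \<noteq> {}"
    using point_near_P[OF m A0(1)] bounded_hyperspaceD(1)[OF A0(1)] unfolding near_in_def by blast
  ultimately show ?thesis by (rule closure_of_in_bounded_hyperspace)
qed

lemma mdist_closure_le:
  assumes "near_in X c S T" "near_in X c T S" "S \<subseteq> mspace X" "T \<subseteq> mspace X" "0 < c"
  shows "mdist (Bd X) (mtopology_of X closure_of S) (mtopology_of X closure_of T) \<le> 2 * c"
proof (rule mdist_Bd_le_of_near_in)
  have *: "near_in X (2 * c) (mtopology_of X closure_of S) (mtopology_of X closure_of T)"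
    if "near_in X c S T" "S \<subseteq> mspace X" "T \<subseteq> mspace X" for S T
  proof -
    have "near_in X (c + c) (mtopology_of X closure_of S) T"
      by (rule near_in_trans[OF near_in_closure_of[OF assms(5)] that(1)])
        (use that closure_of_subset_topspace[of "mtopology_of X" S] in auto)
    then show ?thesis
      by (rule near_in_mono) (use that(3) closure_of_subset[of T "mtopology_of X"] in auto)
  qed
  show "near_in X (2 * c) (mtopology_of X closure_of S) (mtopology_of X closure_of T)"
    "near_in X (2 * c) (mtopology_of X closure_of T) (mtopology_of X closure_of S)"
    using * assms by auto
qed (use assms in simp)

lemma e_in_U: "e ` H \<subseteq> U"
  unfolding U_def using e_in \<kappa> by auto

lemma R_in: "m \<in> U \<Longrightarrow> R m \<in> e ` H"
  unfolding R_def using closure_P_in_H by auto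

lemma R_continuous:
  assumes m: "m \<in> U" and c: "0 < c"
  shows "\<exists>d>0. \<forall>m'\<in>U. mdist M m m' < d \<longrightarrow> mdist M (R m) (R m') < c"
proof (cases "m \<in> e ` H")
  case True
  then obtain A0 where A0: "A0 \<in> H" "m = e A0" by blast
  have c8: "0 < c / 8" using c by simp
  obtain \<delta> where \<delta>: "0 < \<delta>" "\<forall>A\<in>mball_of (Bd X) A0 (\<kappa> A0). \<forall>B\<in>mball_of (Bd X) A0 (\<kappa> A0). \<forall>s\<in>{0..1}.
          mdist (Bd X) A B < \<delta> \<longrightarrow> near_in X (c / 8) (\<Gamma> A B s) A"
    using \<Gamma>_small[OF A0(1) c8] by (elim exE conjE)
  define d where "d = min (min (\<delta> / 10) (c / 40)) (\<kappa> A0 / 5)"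
  have d: "0 < d" "10 * d \<le> \<delta>" "5 * d \<le> c / 8" "d \<le> \<kappa> A0 / 5"
    using \<delta>(1) c \<kappa>[OF A0(1)] unfolding d_def by auto
  have "mdist M (R m) (R m') < c" if m': "m' \<in> U" "mdist M m m' < d" for m'
  proof (cases "m' \<in> e ` H")
    case True
    then show ?thesis using m'(2) \<open>m \<in> e ` H\<close> d(1,3) c unfolding R_def by simp
  next
    case False
    have m'o: "m' \<in> mspace M - e ` H" using m'(1) False unfolding U_def by auto
    have t: "mdist M m' (e A0) < d" using m'(2) unfolding A0(2) by (simp add: mdist_commute)
    have near1: "near_in X (c / 8 + 5 * mdist M m' (e A0)) (P m') A0"
    proof (rule P_near_point[OF m'o A0(1) _ _ c8])
      show "mdist M m' (e A0) < \<kappa> A0 / 5" using t d(4) by linarith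
      fix A B s assume "A \<in> mball_of (Bd X) A0 (\<kappa> A0)" "B \<in> mball_of (Bd X) A0 (\<kappa> A0)"
        "mdist (Bd X) A B < 10 * mdist M m' (e A0)" "s \<in> {0..1::real}"
      moreover from this(3) have "mdist (Bd X) A B < \<delta>" using t d(2) by linarith
      ultimately show "near_in X (c / 8) (\<Gamma> A B s) A" using \<delta>(2) by blast
    qed
    have near2: "near_in X (5 * mdist M m' (e A0)) A0 (P m')" by (rule point_near_P[OF m'o A0(1)])
    have n1: "near_in X (c / 4) (P m') A0" by (rule near_in_mono[OF near1]) (use t d(3) in auto)
    have n2: "near_in X (c / 4) A0 (P m')" by (rule near_in_mono[OF near2]) (use t d(3) c in auto)
    have "mdist (Bd X) (mtopology_of X closure_of A0) (mtopology_of X closure_of P m') \<le> 2 * (c / 4)"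
      by (rule mdist_closure_le[OF n2 n1 bounded_hyperspaceD(2)[OF A0(1)] P_sub]) (use c in simp)
    moreover have "mtopology_of X closure_of A0 = A0"
      using bounded_hyperspaceD(3)[OF A0(1)] by (rule closure_of_closedin)
    moreover have "mdist M (R m) (R m') = mdist (Bd X) A0 (mtopology_of X closure_of P m')"
      using e_iso[OF A0(1) closure_P_in_H[of m']] m'(1) False A0 unfolding R_def by simp
    ultimately show ?thesis using c by simp
  qed
  then show ?thesis using d(1) by blast
next
  case False
  obtain A0 where A0: "A0 \<in> H" "mdist M (e A0) m < \<kappa> A0 / 5" and mM: "m \<in> mspace M"
    using m unfolding U_def by auto
  have mo: "m \<in> mspace M - e ` H" and close: "mdist M m (e A0) < \<kappa> A0 / 5"
    using False mM A0(2) by (auto simp: mdist_commute)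
  have c8: "0 < c / 8" using c by simp
  obtain s0 where s0: "0 < s0" "\<forall>A\<in>mball_of (Bd X) A0 (\<kappa> A0). \<forall>B\<in>mball_of (Bd X) A0 (\<kappa> A0).
      \<forall>s\<in>{0..1}. \<forall>t\<in>{0..1}. \<bar>s - t\<bar> < s0 \<longrightarrow> near_in X (c / 8) (\<Gamma> A B s) (\<Gamma> A B t)"
    using \<Gamma>_continuous[OF A0(1) c8] by (elim exE conjE)
  define \<tau> where "\<tau> = min (s0 / 2) 1"
  have \<tau>: "0 < \<tau>" "2 * \<tau> \<le> s0" "\<tau> \<le> 1" using s0(1) unfolding \<tau>_def by auto
  obtain \<rho> where \<rho>: "0 < \<rho>" "\<rho> \<le> D m" "\<And>m' A. m' \<in> mspace M \<Longrightarrow> mdist M m m' < \<rho> \<Longrightarrow> A \<in> H \<Longrightarrow>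
    \<bar>\<sigma> A m - \<sigma> A m'\<bar> < \<tau>" using \<sigma>_equicontinuous[OF mo \<tau>(1)] by blast
  define d where "d = min \<rho> (\<kappa> A0 / 5 - mdist M m (e A0))"
  have d: "0 < d" "d \<le> \<rho>" "d \<le> \<kappa> A0 / 5 - mdist M m (e A0)" using \<rho>(1) close unfolding d_def by auto
  have "mdist M (R m) (R m') < c" if m': "m' \<in> U" "mdist M m m' < d" for m'
  proof -
    have m'M: "m' \<in> mspace M" using m'(1) unfolding U_def by auto
    have "m' \<notin> e ` H"
    proof
      assume "m' \<in> e ` H"
      then obtain A where "A \<in> H" "m' = e A" by blast
      then have "D m \<le> mdist M m m'" using D_le by blast
      then show False using m'(2) d(2) \<rho>(2) by linarith
    qed
    then have m'o: "m' \<in> mspace M - e ` H" using m'M by blast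
    have close': "mdist M m' (e A0) < \<kappa> A0 / 5"
      using mdist_triangle[OF m'M mM e_in[OF A0(1)]] m'(2) d(3) mdist_commute[of M m m'] by linarith
    have \<sigma>\<sigma>: "\<bar>\<sigma> A m - \<sigma> A m'\<bar> < \<tau>" if "A \<in> H" for A using \<rho>(3)[OF m'M _ that] m'(2) d(2) by linarith
    have n1: "near_in X (2 * (c / 8)) (P m) (P m')"
      by (rule P_near_P[OF mo m'o A0(1) close close' s0(1) s0(2)[rule_format] \<tau>(2,3) \<sigma>\<sigma> c8])
    have \<sigma>\<sigma>': "\<bar>\<sigma> A m' - \<sigma> A m\<bar> < \<tau>" if "A \<in> H" for A using \<sigma>\<sigma>[OF that] by linarith
    have n2: "near_in X (2 * (c / 8)) (P m') (P m)"
      by (rule P_near_P[OF m'o mo A0(1) close' close s0(1) s0(2)[rule_format] \<tau>(2,3) \<sigma>\<sigma>' c8])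
    have "mdist (Bd X) (mtopology_of X closure_of P m) (mtopology_of X closure_of P m') \<le> 2 * (2 * (c / 8))"
      by (rule mdist_closure_le[OF n1 n2 P_sub P_sub]) (use c in simp)
    moreover have "mdist M (R m) (R m') =
        mdist (Bd X) (mtopology_of X closure_of P m) (mtopology_of X closure_of P m')"
      using e_iso[OF closure_P_in_H[of m] closure_P_in_H[of m']] m m'(1) False \<open>m' \<notin> e ` H\<close>
      unfolding R_def by simp
    ultimately show ?thesis using c by simp
  qed
  then show ?thesis using d(1) by blast
qed

lemma retraction:
  "openin (mtopology_of M) U" "e ` H \<subseteq> U" "e ` H retract_of_space subtopology (mtopology_of M) U"
proof -
  have "openin (mtopology_of M) (mball_of M x r)" for x r
    unfolding mtopology_of_def mball_of_def by (rule Metric_space.openin_mball[OF Metric_space_mspace_mdist])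
  then show "openin (mtopology_of M) U" unfolding U_def by blast
  show eU: "e ` H \<subseteq> U" by (rule e_in_U)
  have UM: "U \<subseteq> mspace M" unfolding U_def by auto
  have RU: "R m \<in> U" if "m \<in> U" for m using R_in[OF that] eU by blast
  have cont: "continuous_map (mtopology_of (submetric M U)) (mtopology_of (submetric M U)) R"
  proof (rule continuous_map_metricI)
    show "R m \<in> mspace (submetric M U)" if "m \<in> mspace (submetric M U)" for m
      using RU that UM by auto
    fix m and c :: real assume "m \<in> mspace (submetric M U)" "0 < c"
    then obtain d where "0 < d" "\<forall>m'\<in>U. mdist M m m' < d \<longrightarrow> mdist M (R m) (R m') < c"
      using R_continuous[of m c] by auto
    then show "\<exists>d>0. \<forall>m'\<in>mspace (submetric M U). mdist (submetric M U) m m' < d \<longrightarrow>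
        mdist (submetric M U) (R m) (R m') < c" by auto
  qed
  have sub: "e ` H \<subseteq> topspace (subtopology (mtopology_of M) U)" using eU UM by auto
  have "continuous_map (subtopology (mtopology_of M) U)
      (subtopology (subtopology (mtopology_of M) U) (e ` H)) R"
    using cont R_in unfolding mtopology_of_submetric continuous_map_in_subtopology by auto
  moreover have "\<forall>m\<in>e ` H. R m = m" unfolding R_def by simp
  ultimately show "e ` H retract_of_space subtopology (mtopology_of M) U"
    using sub unfolding retract_of_space_def by blast
qed

end

context hyperspace_paths
begin

theorem ANR_over_Bd: "ANR_over TYPE('m) (Bd X)"
  unfolding ANR_over_def mspace_Bd
proof (intro allI impI)
  fix M :: "'m metric" and e
  assume h: "isometric_embedding (Bd X) M e \<and> closedin (mtopology_of M) (e ` bounded_hyperspace X)"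
  show "\<exists>U. openin (mtopology_of M) U \<and> e ` bounded_hyperspace X \<subseteq> U \<and>
      e ` bounded_hyperspace X retract_of_space subtopology (mtopology_of M) U"
  proof (cases "bounded_hyperspace X = {}")
    case True
    then show ?thesis by (intro exI[of _ "{}"]) (simp add: retract_of_space_def)
  next
    case False
    interpret hyperspace_extension X \<Gamma> \<kappa> M e
    proof
      show "e A \<in> mspace M" if "A \<in> bounded_hyperspace X" for A
        using h that unfolding isometric_embedding_def by auto
      show "mdist M (e A) (e B) = mdist (Bd X) A B"
        if "A \<in> bounded_hyperspace X" "B \<in> bounded_hyperspace X" for A B
        using h that unfolding isometric_embedding_def by auto
    qed (use h False in auto)
    show ?thesis using retraction by blast
  qed
qed

end

section \<open>Paths of sets from traces of points\<close>

lemma trace_domain_dense: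
  fixes d :: real
  assumes d: "0 < d"
  defines "Q \<equiv> (\<lambda>r. d * r) ` ({0..1} \<inter> \<rat>)"
  shows "countable Q" "Q \<subseteq> {0..d}" "{0, d} \<subseteq> Q" "{0..d} \<subseteq> closure Q"
proof -
  show "countable Q" unfolding Q_def by (intro countable_image countable_Int2 countable_rat)
  show "Q \<subseteq> {0..d}" unfolding Q_def using d by (auto simp: mult_le_cancel_left1)
  have "d * 0 \<in> Q" "d * 1 \<in> Q" unfolding Q_def by (intro imageI; simp)+
  then show "{0, d} \<subseteq> Q" by simp
  show "{0..d} \<subseteq> closure Q"
  proof
    fix z assume z: "z \<in> {0..d}"
    show "z \<in> closure Q"
      unfolding closure_approachable
    proof (intro allI impI)
      fix e :: real assume e: "0 < e"
      define w where "w = z / d"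
      have w: "0 \<le> w" "w \<le> 1" using z d unfolding w_def by auto
      have "0 < e / d" using e d by simp
      then have "max 0 (w - e / d) < min 1 (w + e / d)" using w by (auto simp: max_def min_def)
      then obtain r where r: "r \<in> \<rat>" "max 0 (w - e / d) < r" "r < min 1 (w + e / d)"
        using Rats_dense_in_real by blast
      have "w - e / d < r" "r < w + e / d" using r by auto
      then have "d * (w - e / d) < d * r" "d * r < d * (w + e / d)"
        using mult_strict_left_mono[OF _ d] by blast+
      moreover have "d * (w - e / d) = z - e" "d * (w + e / d) = z + e"
        using d unfolding w_def by (simp_all add: algebra_simps)
      ultimately have "dist (d * r) z < e" by (simp add: dist_real_def)
      moreover have "d * r \<in> Q" unfolding Q_def using r by auto
      ultimately show "\<exists>y\<in>Q. dist y z < e" by blast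
    qed
  qed
qed

definition trace_domain :: "real \<Rightarrow> real set" where
  "trace_domain d = (\<lambda>r. d * r) ` ({0..1} \<inter> \<rat>)"

lemma trace_domain:
  assumes "0 \<le> d"
  shows "countable (trace_domain d)" "trace_domain d \<subseteq> {0..d}" "{0, d} \<subseteq> trace_domain d"
    "{0..d} \<subseteq> closure (trace_domain d)"
proof -
  have "countable (trace_domain d) \<and> trace_domain d \<subseteq> {0..d} \<and> {0, d} \<subseteq> trace_domain d \<and>
    {0..d} \<subseteq> closure (trace_domain d)"
  proof (cases "d = 0")
    case True
    have "(0::real) \<in> {0..1} \<inter> \<rat>" by simp
    then have "{0..1} \<inter> \<rat> \<noteq> ({} :: real set)" by blast
    then have "trace_domain d = {0}" unfolding True trace_domain_def by (simp add: image_constant_conv)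
    then show ?thesis using True by simp
  next
    case False
    then show ?thesis using trace_domain_dense[of d] assms unfolding trace_domain_def by auto
  qed
  then show "countable (trace_domain d)" "trace_domain d \<subseteq> {0..d}" "{0, d} \<subseteq> trace_domain d"
    "{0..d} \<subseteq> closure (trace_domain d)" by blast+
qed

text \<open>Shortening the time from \<open>s\<close> to \<open>t\<close> cuts off the parameters above \<open>t * d\<close>; parameters slightly
  below \<open>t * d\<close> replace them.\<close>

lemma trace_domain_push:
  assumes d: "0 \<le> d" "d < 1" and q: "q \<in> trace_domain d" "q \<le> s * d"
    and t: "0 \<le> t" "t \<le> 1" and st: "\<bar>s - t\<bar> < c / 2"
  obtains q' where "q' \<in> trace_domain d" "q' \<le> t * d" "\<bar>q - q'\<bar> < c"
proof -
  have c: "0 < c" using st abs_ge_zero[of "s - t"] by linarith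
  show thesis
  proof (cases "q \<le> t * d")
    case True
    then show thesis using q c by (intro that[of q]) auto
  next
    case above: False
    show thesis
  proof (cases "t = 0")
    case True
    have "0 \<le> q" using q(1) trace_domain(2)[OF d(1)] by auto
    moreover have "s * d \<le> \<bar>s\<bar> * 1" using d by (intro mult_mono) auto
    ultimately have "\<bar>q - 0\<bar> < c" using q(2) st c unfolding True by simp
    then show thesis using trace_domain(3)[OF d(1)] True by (intro that[of 0]) auto
  next
    case False
    then have "max 0 (t - c / 2) < t" using t c by simp
    then obtain r where r: "r \<in> \<rat>" "max 0 (t - c / 2) < r" "r < t" using Rats_dense_in_real by blast
    have dr: "d * r \<le> t * d" using r(3) d(1) by (simp add: mult.commute mult_left_mono)
    have "d * r \<in> trace_domain d" unfolding trace_domain_def using r t by auto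
    moreover have "\<bar>q - d * r\<bar> < c"
    proof -
      have "d * r \<le> q" using dr above by linarith
      have "(t - r) * d \<le> (t - r) * 1" using r(3) d by (intro mult_left_mono) auto
      moreover have "(s - t) * d \<le> \<bar>s - t\<bar> * 1" using d by (intro mult_mono) auto
      moreover have "q - d * r \<le> (s - t) * d + (t - r) * d" using q(2) by (simp add: algebra_simps)
      ultimately have "q - d * r \<le> \<bar>s - t\<bar> + (t - r)" by simp
      then show ?thesis using \<open>d * r \<le> q\<close> st r(2) by simp
    qed
    ultimately show thesis by (intro that[OF _ dr])
  qed
  qed
qed

text \<open>The moduli of the traces depend on the bounded set, but a single trace has to be chosen for each
  pair of points. It is taken from the smallest ball with integral radius that contains the pair; a
  given bounded set meets only finitely many of these balls.\<close>

lemma trace_family: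
  assumes tr: "\<And>B. bounded_in X B \<Longrightarrow> uniformly_locally_trace_equiconnected_at X B"
  obtains F :: "'a \<Rightarrow> 'a \<Rightarrow> real \<Rightarrow> 'a" where
    "\<And>a b. a \<in> mspace X \<Longrightarrow> b \<in> mspace X \<Longrightarrow> F a b 0 = a"
    "\<And>a b q. a \<in> mspace X \<Longrightarrow> b \<in> mspace X \<Longrightarrow> q \<in> trace_domain (mdist X a b) \<Longrightarrow> F a b q \<in> mspace X"
    "\<And>S. bounded_in X S \<Longrightarrow> \<exists>\<epsilon>0>0.
       (\<forall>a\<in>S. \<forall>b\<in>S. mdist X a b < \<epsilon>0 \<longrightarrow> F a b (mdist X a b) = b) \<and>
       (\<forall>e>0. \<exists>s>0. \<forall>a\<in>S. \<forall>b\<in>S. mdist X a b < \<epsilon>0 \<longrightarrow>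
          (\<forall>q\<in>trace_domain (mdist X a b). \<forall>q'\<in>trace_domain (mdist X a b).
             \<bar>q - q'\<bar> < s \<longrightarrow> mdist X (F a b q) (F a b q') < e))"
proof (cases "mspace X = {}")
  case True
  show thesis
  proof (rule that[of "\<lambda>a b q. a"])
    fix S assume "bounded_in X S"
    then have "S = {}" using bounded_in_subset_mspace[of X S] True by simp
    then show "\<exists>\<epsilon>0>0. (\<forall>a\<in>S. \<forall>b\<in>S. mdist X a b < \<epsilon>0 \<longrightarrow> a = b) \<and>
       (\<forall>e>0. \<exists>s>0. \<forall>a\<in>S. \<forall>b\<in>S. mdist X a b < \<epsilon>0 \<longrightarrow>
          (\<forall>q\<in>trace_domain (mdist X a b). \<forall>q'\<in>trace_domain (mdist X a b).
             \<bar>q - q'\<bar> < s \<longrightarrow> mdist X a a < e))"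
      by (simp add: gt_ex)
  qed (use True in simp_all)
next
  case False
  then obtain x0 where x0: "x0 \<in> mspace X" by blast
  define S where "S n = {z \<in> mspace X. mdist X x0 z \<le> real n}" for n
  define trc where "trc \<omega> a b f \<longleftrightarrow> f 0 = a \<and> f (mdist X a b) = b \<and>
      (\<forall>q\<in>trace_domain (mdist X a b). f q \<in> mspace X) \<and>
      (\<forall>q\<in>trace_domain (mdist X a b). \<forall>q'\<in>trace_domain (mdist X a b). \<forall>t>0.
         \<bar>q - q'\<bar> \<le> t \<longrightarrow> mdist X (f q) (f q') \<le> \<omega> t)"
    for \<omega> :: "real \<Rightarrow> real" and a b and f :: "real \<Rightarrow> 'a"
  have "\<forall>n. \<exists>p. 0 < fst p \<and> continuity_modulus (snd p) \<and>
      (\<forall>a\<in>S n. \<forall>b\<in>S n. mdist X a b < fst p \<longrightarrow> (\<exists>f. trc (snd p) a b f))"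
  proof
    fix n
    have "bounded_in X (S n)" by (rule bounded_inI[OF _ x0, of _ "real n"]) (auto simp: S_def)
    from tr[OF this] obtain \<epsilon>0 \<omega> where e0: "0 < \<epsilon>0" and om: "continuity_modulus \<omega>"
      and trace: "\<forall>x\<in>S n. \<forall>y\<in>S n. mdist X x y < \<epsilon>0 \<longrightarrow>
           (\<forall>Q. countable Q \<and> Q \<subseteq> {0..mdist X x y} \<and> {0..mdist X x y} \<subseteq> closure Q \<and>
                {0, mdist X x y} \<subseteq> Q \<longrightarrow>
              (\<exists>f. uniformly_continuous_map (submetric euclidean_metric Q) X f \<and>
                   f 0 = x \<and> f (mdist X x y) = y \<and>
                   (\<forall>t>0. modulus_of (submetric euclidean_metric Q) X f t \<le> ennreal (\<omega> t))))"
      unfolding uniformly_locally_trace_equiconnected_at_def by (elim exE conjE)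
    have "\<exists>f. trc \<omega> a b f" if ab: "a \<in> S n" "b \<in> S n" "mdist X a b < \<epsilon>0" for a b
    proof -
      let ?Q = "trace_domain (mdist X a b)"
      have "countable ?Q \<and> ?Q \<subseteq> {0..mdist X a b} \<and> {0..mdist X a b} \<subseteq> closure ?Q \<and> {0, mdist X a b} \<subseteq> ?Q"
        by (intro conjI trace_domain mdist_nonneg)
      with ab(3) have "\<exists>f. uniformly_continuous_map (submetric euclidean_metric ?Q) X f \<and>
          f 0 = a \<and> f (mdist X a b) = b \<and>
          (\<forall>t>0. modulus_of (submetric euclidean_metric ?Q) X f t \<le> ennreal (\<omega> t))"
        by (rule trace[THEN bspec, OF ab(1), THEN bspec, OF ab(2), THEN mp, THEN spec, THEN mp])
      then obtain f where f: "uniformly_continuous_map (submetric euclidean_metric ?Q) X f"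
          "f 0 = a" "f (mdist X a b) = b"
          "\<forall>t>0. modulus_of (submetric euclidean_metric ?Q) X f t \<le> ennreal (\<omega> t)" by (elim exE conjE)
      have "f q \<in> mspace X" if "q \<in> ?Q" for q
        using uniformly_continuous_map_funspace[OF f(1)] that by auto
      moreover have "mdist X (f q) (f q') \<le> \<omega> t"
        if "q \<in> ?Q" "q' \<in> ?Q" "0 < t" "\<bar>q - q'\<bar> \<le> t" for q q' t
      proof (rule modulus_ofD[where P = "submetric euclidean_metric ?Q" and t = t])
        show "modulus_of (submetric euclidean_metric ?Q) X f t \<le> ennreal (\<omega> t)" using f(4) that(3) by blast
      qed (use that continuity_modulus_pos[OF om that(3)] in \<open>simp_all add: dist_real_def\<close>)
      ultimately show ?thesis using f(2,3) unfolding trc_def by (intro exI[of _ f]) simp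
    qed
    then show "\<exists>p. 0 < fst p \<and> continuity_modulus (snd p) \<and>
      (\<forall>a\<in>S n. \<forall>b\<in>S n. mdist X a b < fst p \<longrightarrow> (\<exists>f. trc (snd p) a b f))"
      using e0 om by (intro exI[of _ "(\<epsilon>0, \<omega>)"]) simp
  qed
  from choice[OF this] obtain p :: "nat \<Rightarrow> real \<times> (real \<Rightarrow> real)" where p:
    "\<forall>n. 0 < fst (p n) \<and> continuity_modulus (snd (p n)) \<and>
      (\<forall>a\<in>S n. \<forall>b\<in>S n. mdist X a b < fst (p n) \<longrightarrow> (\<exists>f. trc (snd (p n)) a b f))" ..
  define \<epsilon> where "\<epsilon> n = fst (p n)" for n
  define \<omega> where "\<omega> n = snd (p n)" for n
  have eps: "0 < \<epsilon> n" and om: "continuity_modulus (\<omega> n)"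
    and trace: "a \<in> S n \<Longrightarrow> b \<in> S n \<Longrightarrow> mdist X a b < \<epsilon> n \<Longrightarrow> \<exists>f. trc (\<omega> n) a b f" for n a b
    using p unfolding \<epsilon>_def \<omega>_def by blast+
  define rank where "rank a b = nat \<lceil>max (mdist X x0 a) (mdist X x0 b)\<rceil>" for a b
  have rank: "a \<in> S (rank a b)" "b \<in> S (rank a b)" if "a \<in> mspace X" "b \<in> mspace X" for a b
  proof -
    have "max (mdist X x0 a) (mdist X x0 b) \<le> real (rank a b)" unfolding rank_def by (rule real_nat_ceiling_ge)
    then show "a \<in> S (rank a b)" "b \<in> S (rank a b)" using that unfolding S_def by auto
  qed
  have rank_le: "rank a b \<le> N" if "a \<in> S N" "b \<in> S N" for a b N
  proof -
    have "max (mdist X x0 a) (mdist X x0 b) \<le> real N" using that unfolding S_def by simp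
    then show ?thesis unfolding rank_def by (simp add: nat_le_iff ceiling_le_iff)
  qed
  define F where "F a b = (if mdist X a b < \<epsilon> (rank a b) then SOME f. trc (\<omega> (rank a b)) a b f else (\<lambda>q. a))"
    for a b
  have F: "trc (\<omega> (rank a b)) a b (F a b)"
    if "a \<in> mspace X" "b \<in> mspace X" "mdist X a b < \<epsilon> (rank a b)" for a b
    using someI_ex[OF trace[OF rank[OF that(1,2)] that(3)]] that(3) unfolding F_def by simp
  show thesis
  proof (rule that[of F])
    show "F a b 0 = a" if "a \<in> mspace X" "b \<in> mspace X" for a b
      using F[OF that] unfolding trc_def F_def by (cases "mdist X a b < \<epsilon> (rank a b)") auto
    show "F a b q \<in> mspace X" if "a \<in> mspace X" "b \<in> mspace X" "q \<in> trace_domain (mdist X a b)" for a b q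
      using F[OF that(1,2)] that unfolding trc_def F_def by (cases "mdist X a b < \<epsilon> (rank a b)") auto
    fix T assume T: "bounded_in X T"
    obtain r where r: "\<And>z. z \<in> T \<Longrightarrow> mdist X x0 z \<le> r" using bounded_inE[OF T x0] by blast
    obtain N :: nat where "r \<le> real N" using real_arch_simple by blast
    then have TS: "z \<in> S N" "z \<in> mspace X" if "z \<in> T" for z
      using r[OF that] that bounded_in_subset_mspace[OF T] unfolding S_def by force+
    define \<epsilon>0 where "\<epsilon>0 = Min (\<epsilon> ` {..N})"
    have e0: "0 < \<epsilon>0" "n \<le> N \<Longrightarrow> \<epsilon>0 \<le> \<epsilon> n" for n unfolding \<epsilon>0_def using eps by (auto simp: Min_gr_iff)
    have FT: "trc (\<omega> (rank a b)) a b (F a b)" if "a \<in> T" "b \<in> T" "mdist X a b < \<epsilon>0" for a b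
      using F[OF TS(2)[OF that(1)] TS(2)[OF that(2)]] that(3)
        e0(2)[OF rank_le[OF TS(1)[OF that(1)] TS(1)[OF that(2)]]] by linarith
    show "\<exists>\<epsilon>0>0. (\<forall>a\<in>T. \<forall>b\<in>T. mdist X a b < \<epsilon>0 \<longrightarrow> F a b (mdist X a b) = b) \<and>
       (\<forall>e>0. \<exists>s>0. \<forall>a\<in>T. \<forall>b\<in>T. mdist X a b < \<epsilon>0 \<longrightarrow>
          (\<forall>q\<in>trace_domain (mdist X a b). \<forall>q'\<in>trace_domain (mdist X a b).
             \<bar>q - q'\<bar> < s \<longrightarrow> mdist X (F a b q) (F a b q') < e))"
    proof (rule exI[of _ \<epsilon>0], intro conjI e0(1) ballI impI allI)
      show "F a b (mdist X a b) = b" if "a \<in> T" "b \<in> T" "mdist X a b < \<epsilon>0" for a b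
        using FT[OF that] unfolding trc_def by blast
      fix e :: real assume e: "0 < e"
      have "\<forall>n. \<exists>t>0. \<omega> n t < e" using continuity_modulus_small[OF om e] by metis
      from choice[OF this] obtain h :: "nat \<Rightarrow> real" where h: "\<forall>n. 0 < h n \<and> \<omega> n (h n) < e" ..
      define s where "s = Min (h ` {..N})"
      have s: "0 < s" "n \<le> N \<Longrightarrow> s \<le> h n" for n unfolding s_def using h by (auto simp: Min_gr_iff)
      have "mdist X (F a b q) (F a b q') < e"
        if "a \<in> T" "b \<in> T" "mdist X a b < \<epsilon>0" "q \<in> trace_domain (mdist X a b)"
          "q' \<in> trace_domain (mdist X a b)" "\<bar>q - q'\<bar> < s" for a b q q'
      proof -
        define n where "n = rank a b"
        have "n \<le> N" unfolding n_def using rank_le TS(1) that(1,2) by blast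
        then have "\<bar>q - q'\<bar> \<le> h n" using s(2) that(6) by force
        then have "mdist X (F a b q) (F a b q') \<le> \<omega> n (h n)"
          using FT[OF that(1-3)] that(4,5) h unfolding trc_def n_def by blast
        then show ?thesis using h by (meson order_le_less_trans)
      qed
      then show "\<exists>s>0. \<forall>a\<in>T. \<forall>b\<in>T. mdist X a b < \<epsilon>0 \<longrightarrow>
          (\<forall>q\<in>trace_domain (mdist X a b). \<forall>q'\<in>trace_domain (mdist X a b).
             \<bar>q - q'\<bar> < s \<longrightarrow> mdist X (F a b q) (F a b q') < e)"
        using s(1) by (intro exI[of _ s] conjI ballI impI)
    qed
  qed
qed

text \<open>At time \<open>s\<close> the path from \<open>A\<close> to \<open>B\<close> consists of \<open>A\<close> and of the initial parts, up to the
  fraction \<open>s\<close> of their domains, of the traces between points of \<open>A\<close> and \<open>B\<close> whose distance is at most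
  twice the Hausdorff distance. The factor two ensures that every point of \<open>B\<close> is the end of
  such a trace, and for \<open>A = B\<close> only constant traces remain.\<close>

theorem ANR_over_Bd_of_trace_equiconnected:
  assumes tr: "\<And>B. bounded_in X B \<Longrightarrow> uniformly_locally_trace_equiconnected_at X B"
  shows "ANR_over TYPE('m) (Bd X)"
proof (rule trace_family)
  show "uniformly_locally_trace_equiconnected_at X B" if "bounded_in X B" for B by (rule tr[OF that])
  fix F :: "'a \<Rightarrow> 'a \<Rightarrow> real \<Rightarrow> 'a"
  assume F0: "\<And>a b. a \<in> mspace X \<Longrightarrow> b \<in> mspace X \<Longrightarrow> F a b 0 = a" and
    Fm: "\<And>a b q. a \<in> mspace X \<Longrightarrow> b \<in> mspace X \<Longrightarrow> q \<in> trace_domain (mdist X a b) \<Longrightarrow> F a b q \<in> mspace X" and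
    Fb: "\<And>S. bounded_in X S \<Longrightarrow> \<exists>\<epsilon>0>0.
       (\<forall>a\<in>S. \<forall>b\<in>S. mdist X a b < \<epsilon>0 \<longrightarrow> F a b (mdist X a b) = b) \<and>
       (\<forall>e>0. \<exists>s>0. \<forall>a\<in>S. \<forall>b\<in>S. mdist X a b < \<epsilon>0 \<longrightarrow>
          (\<forall>q\<in>trace_domain (mdist X a b). \<forall>q'\<in>trace_domain (mdist X a b).
             \<bar>q - q'\<bar> < s \<longrightarrow> mdist X (F a b q) (F a b q') < e))"
  (* A itself is included, so that the family starts at A even if no point of B is close enough. *)
  define \<Gamma> where "\<Gamma> A B s = A \<union> {F a b q | a b q. a \<in> A \<and> b \<in> B \<and> mdist X a b \<le> 2 * mdist (Bd X) A B \<and>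
      q \<in> trace_domain (mdist X a b) \<and> q \<le> s * mdist X a b}" for A B s
  let ?H = "bounded_hyperspace X"
  have \<Gamma>I: "F a b q \<in> \<Gamma> A B s" if "a \<in> A" "b \<in> B" "mdist X a b \<le> 2 * mdist (Bd X) A B"
      "q \<in> trace_domain (mdist X a b)" "q \<le> s * mdist X a b" for A B s a b q
    unfolding \<Gamma>_def using that by blast
  have local: "\<exists>k>0. controlled_paths X \<Gamma> (mball_of (Bd X) A0 k)" if A0: "A0 \<in> ?H" for A0
  proof -
    define S where "S = {z \<in> mspace X. \<exists>a\<in>A0. mdist X z a \<le> 1}"
    have "bounded_in X S"
      by (rule bounded_in_neighbourhood[OF bounded_hyperspaceD(4)[OF A0], of _ 1]) (auto simp: S_def)
    from Fb[OF this] obtain \<epsilon>0 where e0: "0 < \<epsilon>0"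
      and Fend: "\<forall>a\<in>S. \<forall>b\<in>S. mdist X a b < \<epsilon>0 \<longrightarrow> F a b (mdist X a b) = b"
      and Fcont: "\<forall>e>0. \<exists>s>0. \<forall>a\<in>S. \<forall>b\<in>S. mdist X a b < \<epsilon>0 \<longrightarrow>
          (\<forall>q\<in>trace_domain (mdist X a b). \<forall>q'\<in>trace_domain (mdist X a b).
             \<bar>q - q'\<bar> < s \<longrightarrow> mdist X (F a b q) (F a b q') < e)" by (elim exE conjE)
    define modulus where "modulus e c \<longleftrightarrow> (\<forall>a\<in>S. \<forall>b\<in>S. mdist X a b < \<epsilon>0 \<longrightarrow>
          (\<forall>q\<in>trace_domain (mdist X a b). \<forall>q'\<in>trace_domain (mdist X a b).
             \<bar>q - q'\<bar> < c \<longrightarrow> mdist X (F a b q) (F a b q') < e))" for e c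
    have modulusE: "\<exists>c>0. modulus e c" if "0 < e" for e
      using Fcont[THEN spec, THEN mp, OF that] unfolding modulus_def .
    obtain c1 where c1: "0 < c1" "modulus 1 c1" using modulusE[OF zero_less_one] by blast
    (* Traces between points of two sets in the ball of radius k have length less than 4 * k. *)
    define k where "k = min (min (1/4) (\<epsilon>0 / 4)) (c1 / 4)"
    have k: "0 < k" "k \<le> 1/4" "4 * k \<le> \<epsilon>0" "4 * k \<le> c1" using e0 c1(1) unfolding k_def by auto
    have ball: "A \<in> ?H" "A \<subseteq> S" if A: "A \<in> mball_of (Bd X) A0 k" for A
    proof -
      show AH: "A \<in> ?H" using A by simp
      have "near_in X k A A0" using A near_in_of_mdist_Bd(2)[OF A0 AH] by simp
      then have "near_in X 1 A A0" by (rule near_in_mono) (use k in auto)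
      then have "\<exists>a\<in>A0. mdist X z a \<le> 1" if "z \<in> A" for z
        using that unfolding near_in_def by (meson less_imp_le)
      then show "A \<subseteq> S" unfolding S_def using bounded_hyperspaceD(2)[OF AH] by blast
    qed
    have diam: "mdist (Bd X) A B < 2 * k"
      if "A \<in> mball_of (Bd X) A0 k" "B \<in> mball_of (Bd X) A0 k" for A B
    proof -
      have "mdist (Bd X) A B \<le> mdist (Bd X) A A0 + mdist (Bd X) A0 B"
        using that A0 by (intro mdist_triangle) auto
      then show ?thesis using that mdist_commute[of "Bd X" A A0] by simp
    qed
    have short: "mdist X a b < \<epsilon>0" "mdist X a b < 1"
      if "A \<in> mball_of (Bd X) A0 k" "B \<in> mball_of (Bd X) A0 k" "mdist X a b \<le> 2 * mdist (Bd X) A B" for A B a b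
      using diam[OF that(1,2)] that(3) k by linarith+
    have end_contains: "B \<subseteq> \<Gamma> A B 1" if AB: "A \<in> mball_of (Bd X) A0 k" "B \<in> mball_of (Bd X) A0 k" for A B
    proof
      fix b assume b: "b \<in> B"
      have "\<exists>a\<in>A. mdist X a b \<le> 2 * mdist (Bd X) A B"
      proof (cases "mdist (Bd X) A B = 0")
        case True
        then have "A = B" using ball(1)[OF AB(1)] ball(1)[OF AB(2)] by simp
        then show ?thesis using b bounded_hyperspaceD(2)[OF ball(1)[OF AB(2)]] by (intro bexI[of _ b]) auto
      next
        case False
        then have "mdist (Bd X) A B < 2 * mdist (Bd X) A B" using mdist_nonneg[of "Bd X" A B] by linarith
        from near_in_of_mdist_Bd(2)[OF ball(1)[OF AB(1)] ball(1)[OF AB(2)] this]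
        obtain a where "a \<in> A" "mdist X b a < 2 * mdist (Bd X) A B" using b unfolding near_in_def by blast
        then show ?thesis using mdist_commute[of X b a] by (intro bexI[of _ a]) auto
      qed
      then obtain a where a: "a \<in> A" "mdist X a b \<le> 2 * mdist (Bd X) A B" by blast
      have "F a b (mdist X a b) = b"
        using Fend a(1) b ball(2)[OF AB(1)] ball(2)[OF AB(2)] short(1)[OF AB a(2)] by blast
      moreover have "F a b (mdist X a b) \<in> \<Gamma> A B 1"
        using trace_domain(3)[of "mdist X a b"] by (intro \<Gamma>I a b) auto
      ultimately show "b \<in> \<Gamma> A B 1" by simp
    qed
    have continuous: "\<exists>s0>0. \<forall>A\<in>mball_of (Bd X) A0 k. \<forall>B\<in>mball_of (Bd X) A0 k. \<forall>s\<in>{0..1}.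
        \<forall>t\<in>{0..1}. \<bar>s - t\<bar> < s0 \<longrightarrow> near_in X e (\<Gamma> A B s) (\<Gamma> A B t)" if e: "0 < e" for e
    proof -
      obtain c where c: "0 < c" and Fc: "modulus e c" using modulusE[OF e] by blast
      have "near_in X e (\<Gamma> A B s) (\<Gamma> A B t)"
        if AB: "A \<in> mball_of (Bd X) A0 k" "B \<in> mball_of (Bd X) A0 k" and t: "t \<in> {0..1}" and st: "\<bar>s - t\<bar> < c / 2"
        for A B s t
        unfolding near_in_def
      proof
        fix z assume "z \<in> \<Gamma> A B s"
        then consider "z \<in> A" | a b q where "z = F a b q" "a \<in> A" "b \<in> B"
            "mdist X a b \<le> 2 * mdist (Bd X) A B" "q \<in> trace_domain (mdist X a b)" "q \<le> s * mdist X a b"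
          unfolding \<Gamma>_def by blast
        then show "\<exists>y\<in>\<Gamma> A B t. mdist X z y < e"
        proof cases
          case 1
          then show ?thesis
            using e bounded_hyperspaceD(2)[OF ball(1)[OF AB(1)]] unfolding \<Gamma>_def by (intro bexI[of _ z]) auto
        next
          case 2
          have tt: "0 \<le> t" "t \<le> 1" using t by auto
          obtain q' where q': "q' \<in> trace_domain (mdist X a b)" "q' \<le> t * mdist X a b" "\<bar>q - q'\<bar> < c"
            using trace_domain_push[OF mdist_nonneg short(2)[OF AB 2(4)] 2(5,6) tt st] .
          have "mdist X z (F a b q') < e"
            using Fc[unfolded modulus_def] 2 q'(1,3) ball(2)[OF AB(1)] ball(2)[OF AB(2)] short(1)[OF AB 2(4)] by blast
          then show ?thesis using \<Gamma>I[OF 2(2,3,4) q'(1,2)] by blast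
        qed
      qed
      then show ?thesis using c by (intro exI[of _ "c / 2"] conjI ballI impI) simp_all
    qed
    have small: "near_in X e (\<Gamma> A B s) A"
      if AB: "A \<in> mball_of (Bd X) A0 k" "B \<in> mball_of (Bd X) A0 k"
        and d: "mdist (Bd X) A B < c / 2" and Fc: "modulus e c" and e: "0 < e"
      for A B s e c
      unfolding near_in_def
    proof
      fix z assume "z \<in> \<Gamma> A B s"
      then consider "z \<in> A" | a b q where "z = F a b q" "a \<in> A" "b \<in> B"
          "mdist X a b \<le> 2 * mdist (Bd X) A B" "q \<in> trace_domain (mdist X a b)"
        unfolding \<Gamma>_def by blast
      then show "\<exists>y\<in>A. mdist X z y < e"
      proof cases
        case 1
        then show ?thesis
          using e bounded_hyperspaceD(2)[OF ball(1)[OF AB(1)]] by (intro bexI[of _ z]) auto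
      next
        case 2
        have "q \<in> {0..mdist X a b}" using 2(5) trace_domain(2)[of "mdist X a b"] by auto
        then have "\<bar>q - 0\<bar> < c" using 2(4) d by auto
        moreover have "0 \<in> trace_domain (mdist X a b)" using trace_domain(3)[of "mdist X a b"] by simp
        ultimately have "mdist X z (F a b 0) < e"
          using Fc[unfolded modulus_def] 2 ball(2)[OF AB(1)] ball(2)[OF AB(2)] short(1)[OF AB 2(4)] by blast
        moreover have "F a b 0 = a"
          using 2 bounded_hyperspaceD(2)[OF ball(1)[OF AB(1)]] bounded_hyperspaceD(2)[OF ball(1)[OF AB(2)]]
          by (intro F0) auto
        ultimately show ?thesis using 2(2) by auto
      qed
    qed
    have "controlled_paths X \<Gamma> (mball_of (Bd X) A0 k)"
      unfolding controlled_paths_def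
    proof (intro conjI ballI allI impI)
      fix A B assume AB: "A \<in> mball_of (Bd X) A0 k" "B \<in> mball_of (Bd X) A0 k"
      show "B \<subseteq> \<Gamma> A B 1" by (rule end_contains[OF AB])
      show "near_in X 1 (\<Gamma> A B s) A" for s
        by (rule small[OF AB _ c1(2)]) (use diam[OF AB] k(4) in simp_all)
    next
      fix e :: real assume e: "0 < e"
      show "\<exists>s0>0. \<forall>A\<in>mball_of (Bd X) A0 k. \<forall>B\<in>mball_of (Bd X) A0 k. \<forall>s\<in>{0..1}.
          \<forall>t\<in>{0..1}. \<bar>s - t\<bar> < s0 \<longrightarrow> near_in X e (\<Gamma> A B s) (\<Gamma> A B t)" by (rule continuous[OF e])
      obtain c where c: "0 < c" "modulus e c" using modulusE[OF e] by blast
      show "\<exists>\<delta>>0. \<forall>A\<in>mball_of (Bd X) A0 k. \<forall>B\<in>mball_of (Bd X) A0 k. \<forall>s\<in>{0..1}.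
          mdist (Bd X) A B < \<delta> \<longrightarrow> near_in X e (\<Gamma> A B s) A"
        by (rule exI[of _ "c / 2"]) (use c(1) small[OF _ _ _ c(2) e] in simp)
    qed
    then show ?thesis using k(1) by blast
  qed
  then have "\<forall>A0\<in>?H. \<exists>k. 0 < k \<and> controlled_paths X \<Gamma> (mball_of (Bd X) A0 k)" by blast
  from bchoice[OF this] obtain \<kappa> :: "'a set \<Rightarrow> real" where
    \<kappa>: "\<forall>A0\<in>?H. 0 < \<kappa> A0 \<and> controlled_paths X \<Gamma> (mball_of (Bd X) A0 (\<kappa> A0))" ..
  interpret hyperspace_paths X \<Gamma> \<kappa>
  proof
    show "A \<subseteq> \<Gamma> A B s" for A B s unfolding \<Gamma>_def by blast
    fix A B assume AB: "A \<in> ?H" "B \<in> ?H"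
    have m: "A \<subseteq> mspace X" "B \<subseteq> mspace X" using bounded_hyperspaceD(2) AB by blast+
    show "\<Gamma> A B s \<subseteq> mspace X" for s unfolding \<Gamma>_def using m Fm by blast
    have "F a b q \<in> A" if "a \<in> A" "b \<in> B" "q \<in> trace_domain (mdist X a b)" "q \<le> 0" for a b q
    proof -
      have "q = 0" using trace_domain(2)[of "mdist X a b"] that(3,4) by (auto simp: subset_iff)
      moreover have "F a b 0 = a" using that(1,2) m by (intro F0) auto
      ultimately show ?thesis using that(1) by simp
    qed
    then show "\<Gamma> A B 0 = A" unfolding \<Gamma>_def by auto
  qed (use \<kappa> in blast)+
  show "ANR_over TYPE('m) (Bd X)" by (rule ANR_over_Bd)
qed

section \<open>Absolute neighbourhood retracts are locally path connected\<close>

definition bounded_functions :: "('b \<Rightarrow> real) set" where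
  "bounded_functions = {f. \<exists>K. \<forall>w. \<bar>f w\<bar> \<le> K}"

text \<open>For an unbounded difference the supremum is an arbitrary real number; the maximum with \<open>0\<close>
  keeps the distance nonnegative there.\<close>

definition sup_dist :: "('b \<Rightarrow> real) \<Rightarrow> ('b \<Rightarrow> real) \<Rightarrow> real" where
  "sup_dist f g = max 0 (SUP w. \<bar>f w - g w\<bar>)"

lemma sup_dist_le:
  assumes "\<And>w. \<bar>f w - g w\<bar> \<le> c"
  shows "sup_dist f g \<le> c"
proof -
  have "0 \<le> c" using assms[of undefined] by linarith
  moreover have "(SUP w. \<bar>f w - g w\<bar>) \<le> c" using assms by (intro cSUP_least) auto
  ultimately show ?thesis unfolding sup_dist_def by simp
qed

lemma le_sup_dist:
  assumes "f \<in> bounded_functions" "g \<in> bounded_functions"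
  shows "\<bar>f w - g w\<bar> \<le> sup_dist f g"
proof -
  obtain K L where K: "\<And>w. \<bar>f w\<bar> \<le> K" and L: "\<And>w. \<bar>g w\<bar> \<le> L"
    using assms unfolding bounded_functions_def by blast
  have "\<bar>f w - g w\<bar> \<le> K + L" for w using K[of w] L[of w] by linarith
  then have "\<bar>f w - g w\<bar> \<le> (SUP w. \<bar>f w - g w\<bar>)"
    by (intro cSUP_upper bdd_aboveI[of _ "K + L"]) auto
  then show ?thesis unfolding sup_dist_def by simp
qed

lemma Metric_space_bounded_functions: "Metric_space bounded_functions sup_dist"
proof
  fix f g h :: "'b \<Rightarrow> real"
  show "0 \<le> sup_dist f g" unfolding sup_dist_def by simp
  show "sup_dist f g = sup_dist g f" unfolding sup_dist_def by (simp add: abs_minus_commute)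
  assume f: "f \<in> bounded_functions" and g: "g \<in> bounded_functions"
  show "sup_dist f g = 0 \<longleftrightarrow> f = g"
  proof
    assume "sup_dist f g = 0"
    then have "f w = g w" for w using le_sup_dist[OF f g, of w] by simp
    then show "f = g" by blast
  next
    assume "f = g" then show "sup_dist f g = 0" unfolding sup_dist_def by simp
  qed
  assume h: "h \<in> bounded_functions"
  show "sup_dist f h \<le> sup_dist f g + sup_dist g h"
  proof (rule sup_dist_le)
    fix w show "\<bar>f w - h w\<bar> \<le> sup_dist f g + sup_dist g h"
      using le_sup_dist[OF f g, of w] le_sup_dist[OF g h, of w] by linarith
  qed
qed

lemma segment_bounded_functions:
  assumes "f \<in> bounded_functions" "g \<in> bounded_functions"
  shows "(\<lambda>w. (1 - t) * f w + t * g w) \<in> bounded_functions"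
proof -
  obtain K L where K: "\<And>w. \<bar>f w\<bar> \<le> K" and L: "\<And>w. \<bar>g w\<bar> \<le> L"
    using assms unfolding bounded_functions_def by blast
  have "\<bar>(1 - t) * f w + t * g w\<bar> \<le> \<bar>1 - t\<bar> * K + \<bar>t\<bar> * L" for w
  proof -
    have "\<bar>(1 - t) * f w + t * g w\<bar> \<le> \<bar>1 - t\<bar> * \<bar>f w\<bar> + \<bar>t\<bar> * \<bar>g w\<bar>"
      by (metis abs_mult abs_triangle_ineq)
    also have "\<dots> \<le> \<bar>1 - t\<bar> * K + \<bar>t\<bar> * L" using K L by (intro add_mono mult_left_mono) auto
    finally show ?thesis .
  qed
  then show ?thesis unfolding bounded_functions_def by blast
qed

text \<open>The half space \<open>C\<close> of the bounded functions that are positive at \<open>z0\<close>, with the part \<open>Z\<close> of its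
  boundary added.\<close>

locale half_space =
  fixes Z :: "('b \<Rightarrow> real) set" and z0 :: 'b
  assumes Z: "Z \<subseteq> bounded_functions" and Z0: "\<And>f. f \<in> Z \<Longrightarrow> f z0 = 0"
begin

definition C :: "('b \<Rightarrow> real) set" where "C = {f \<in> bounded_functions. 0 < f z0} \<union> Z"

definition M :: "('b \<Rightarrow> real) metric" where "M = metric (C, sup_dist)"

lemma C_sub: "C \<subseteq> bounded_functions" unfolding C_def using Z by blast

lemma Metric_space_C: "Metric_space C sup_dist"
  by (rule Metric_space.subspace[OF Metric_space_bounded_functions C_sub])

lemma mspace_M [simp]: "mspace M = C"
  unfolding M_def by (rule Metric_space.mspace_metric[OF Metric_space_C])

lemma mdist_M [simp]: "mdist M = sup_dist"
  unfolding M_def by (rule Metric_space.mdist_metric[OF Metric_space_C])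

lemma height_nonneg: "f \<in> C \<Longrightarrow> 0 \<le> f z0"
  using Z0[of f] unfolding C_def by auto

lemma closedin_Z: "closedin (mtopology_of M) Z"
proof -
  have "openin (mtopology_of M) (C - Z)"
    unfolding openin_mtopology_of
  proof (intro conjI ballI)
    show "C - Z \<subseteq> mspace M" by auto
    fix f assume f: "f \<in> C - Z"
    then have fz: "0 < f z0" unfolding C_def by auto
    have "g \<in> C - Z" if g: "g \<in> C" "sup_dist f g < f z0" for g
    proof -
      have "\<bar>f z0 - g z0\<bar> \<le> sup_dist f g" using f g C_sub by (intro le_sup_dist) auto
      then have "0 < g z0" using g(2) by linarith
      then show ?thesis using g(1) Z0[of g] by auto
    qed
    then show "\<exists>r>0. \<forall>y\<in>mspace M. mdist M f y < r \<longrightarrow> y \<in> C - Z" using fz by auto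
  qed
  moreover have "Z \<subseteq> C" unfolding C_def by blast
  ultimately show ?thesis unfolding closedin_def by simp
qed

lemma segment_path:
  assumes f: "f \<in> C" and h: "h \<in> bounded_functions" "0 < h z0" and r: "sup_dist f h < r"
  obtains p where "path_connectedin (mtopology_of M) p" "f \<in> p" "h \<in> p" "\<And>g. g \<in> p \<Longrightarrow> sup_dist f g < r"
proof -
  have fb: "f \<in> bounded_functions" using f C_sub by blast
  define q where "q t = (\<lambda>w. (1 - t) * f w + t * h w)" for t :: real
  have qC: "q t \<in> C" if "t \<in> {0..1}" for t
  proof (cases "t = 0")
    case True
    then show ?thesis using f unfolding q_def by simp
  next
    case False
    then have "0 < t * h z0" "0 \<le> (1 - t) * f z0" using that h(2) height_nonneg[OF f] by auto
    then have "0 < q t z0" unfolding q_def by linarith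
    then show ?thesis using segment_bounded_functions[OF fb h(1), of t] unfolding C_def q_def by blast
  qed
  have qd: "sup_dist (q s) (q t) \<le> \<bar>s - t\<bar> * sup_dist f h" for s t
  proof (rule sup_dist_le)
    fix w
    have "q s w - q t w = (t - s) * (f w - h w)" unfolding q_def by (simp add: algebra_simps)
    then have "\<bar>q s w - q t w\<bar> = \<bar>s - t\<bar> * \<bar>f w - h w\<bar>" by (simp add: abs_mult abs_minus_commute)
    also have "\<dots> \<le> \<bar>s - t\<bar> * sup_dist f h" by (intro mult_left_mono le_sup_dist fb h) auto
    finally show "\<bar>q s w - q t w\<bar> \<le> \<bar>s - t\<bar> * sup_dist f h" .
  qed
  have nonneg: "0 \<le> sup_dist f h" using le_sup_dist[OF fb h(1), of z0] by linarith
  have "continuous_map (mtopology_of (submetric euclidean_metric {0..1})) (mtopology_of M) q"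
  proof (rule continuous_map_metricI)
    show "q t \<in> mspace M" if "t \<in> mspace (submetric euclidean_metric {0..1})" for t using qC that by simp
    fix t e :: real assume "0 < e"
    define d where "d = e / (sup_dist f h + 1)"
    have d: "0 < d" "d * (sup_dist f h + 1) = e" using \<open>0 < e\<close> nonneg unfolding d_def by auto
    have "sup_dist (q t) (q s) < e" if "dist t s < d" for s
    proof -
      have "sup_dist (q t) (q s) \<le> \<bar>t - s\<bar> * sup_dist f h" by (rule qd)
      also have "\<dots> \<le> d * sup_dist f h" using that nonneg by (intro mult_right_mono) (auto simp: dist_real_def)
      also have "\<dots> < e" using d by (simp add: distrib_left)
      finally show ?thesis .
    qed
    then show "\<exists>d>0. \<forall>y\<in>mspace (submetric euclidean_metric {0..1}).
        mdist (submetric euclidean_metric {0..1}) t y < d \<longrightarrow> mdist M (q t) (q y) < e"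
      using d(1) by auto
  qed
  then have "pathin (mtopology_of M) q"
    unfolding pathin_def mtopology_of_submetric mtopology_of_euclidean .
  then have "path_connectedin (mtopology_of M) (q ` {0..1})" by (rule path_connectedin_path_image)
  moreover have "q 0 = f" "q 1 = h" unfolding q_def by auto
  then have "f \<in> q ` {0..1}" "h \<in> q ` {0..1}" by force+
  moreover have "sup_dist f g < r" if g: "g \<in> q ` {0..1}" for g
  proof -
    obtain t where t: "t \<in> {0..1}" "g = q t" using g by blast
    have "sup_dist (q 0) (q t) \<le> \<bar>0 - t\<bar> * sup_dist f h" by (rule qd)
    also have "\<dots> \<le> 1 * sup_dist f h" using t(1) nonneg by (intro mult_right_mono) auto
    finally show ?thesis using r unfolding t(2) \<open>q 0 = f\<close> by simp
  qed
  ultimately show thesis by (rule that)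
qed

text \<open>Two nearby functions are joined by segments through their midpoint, lifted at the
  coordinate \<open>z0\<close>: away from the ends these segments lie in the open half space.\<close>

lemma locally_path_connected: "locally_path_connected_space (mtopology_of M)"
  unfolding locally_path_connected_space_im_kleinen
proof (intro allI impI)
  fix V f assume V: "openin (mtopology_of M) V \<and> f \<in> V"
  then have fC: "f \<in> C" using openin_subset[of "mtopology_of M" V] by auto
  obtain r where r: "0 < r" "\<forall>g\<in>mspace M. mdist M f g < r \<longrightarrow> g \<in> V"
    using V unfolding openin_mtopology_of by blast
  interpret Metric_space C sup_dist by (rule Metric_space_C)
  have "\<exists>P. path_connectedin (mtopology_of M) P \<and> P \<subseteq> V \<and> f \<in> P \<and> g \<in> P"
    if g: "g \<in> C" "sup_dist f g < r / 4" for g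
  proof -
    have fb: "f \<in> bounded_functions" "g \<in> bounded_functions" using fC g(1) C_sub by auto
    define c where "c w = (if w = z0 then r / 4 else 0)" for w
    have c: "0 \<le> c w" "c w \<le> r / 4" "c z0 = r / 4" for w using r(1) unfolding c_def by auto
    define h where "h w = f w / 2 + g w / 2 + c w" for w
    obtain K L where K: "\<And>w. \<bar>f w\<bar> \<le> K" and L: "\<And>w. \<bar>g w\<bar> \<le> L"
      using fb unfolding bounded_functions_def by blast
    have "\<bar>h w\<bar> \<le> K + L + r" for w
      using K[of w] L[of w] c(1,2)[of w] r(1) unfolding h_def by linarith
    then have hb: "h \<in> bounded_functions" unfolding bounded_functions_def by blast
    have hz: "0 < h z0" using height_nonneg[OF fC] height_nonneg[OF g(1)] r(1) c(3) unfolding h_def by linarith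
    have fh: "sup_dist f h < r / 2" "sup_dist g h < r / 2"
    proof -
      have "\<bar>f w - h w\<bar> \<le> 3 * r / 8 \<and> \<bar>g w - h w\<bar> \<le> 3 * r / 8" for w
        using le_sup_dist[OF fb, of w] g(2) r(1) c(1,2)[of w] unfolding h_def by linarith
      then have "sup_dist f h \<le> 3 * r / 8" "sup_dist g h \<le> 3 * r / 8" by (blast intro: sup_dist_le)+
      then show "sup_dist f h < r / 2" "sup_dist g h < r / 2" using r(1) by linarith+
    qed
    obtain p where p: "path_connectedin (mtopology_of M) p" "f \<in> p" "h \<in> p"
        "\<And>u. u \<in> p \<Longrightarrow> sup_dist f u < r / 2" using segment_path[OF fC hb hz fh(1)] by blast
    obtain q where q: "path_connectedin (mtopology_of M) q" "g \<in> q" "h \<in> q"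
        "\<And>u. u \<in> q \<Longrightarrow> sup_dist g u < r / 2" using segment_path[OF g(1) hb hz fh(2)] by blast
    have pC: "p \<subseteq> C" "q \<subseteq> C"
      using path_connectedin_subset_topspace[OF p(1)] path_connectedin_subset_topspace[OF q(1)] by auto
    have "path_connectedin (mtopology_of M) (\<Union>{p, q})"
      by (rule path_connectedin_Union) (use p q in auto)
    moreover have "\<Union>{p, q} \<subseteq> V"
    proof
      fix u assume "u \<in> \<Union>{p, q}"
      then have "sup_dist f u < r \<and> u \<in> C"
      proof (elim UnionE insertE emptyE)
        fix A assume "u \<in> A" "A = p" then show ?thesis using p(4)[of u] pC r(1) by auto
      next
        fix A assume A: "u \<in> A" "A = q"
        have "sup_dist f u \<le> sup_dist f g + sup_dist g u" using A pC fC g(1) by (intro triangle) auto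
        then show ?thesis using q(4)[of u] A g(2) r(1) pC by auto
      qed
      then show "u \<in> V" using r(2) by simp
    qed
    ultimately show ?thesis using p(2) q(2) by (intro exI[of _ "\<Union>{p, q}"]) auto
  qed
  moreover have "openin (mtopology_of M) (mball f (r / 4))"
    unfolding M_def mtopology_of by (rule openin_mball)
  moreover have "f \<in> mball f (r / 4)" using fC r(1) by simp
  moreover have "mball f (r / 4) \<subseteq> V" using r by auto
  ultimately show "\<exists>W. openin (mtopology_of M) W \<and> f \<in> W \<and> W \<subseteq> V \<and>
      (\<forall>g\<in>W. \<exists>P. path_connectedin (mtopology_of M) P \<and> P \<subseteq> V \<and> f \<in> P \<and> g \<in> P)"
    by (intro exI[of _ "mball f (r / 4)"]) auto
qed

end

text \<open>The Kuratowski embedding is extended by \<open>0\<close> to all labels outside \<open>Y\<close>, in particular to the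
  spare label \<open>z0\<close>. Local path connectedness passes to the open neighbourhood \<open>U\<close> and then to its
  retract.\<close>

theorem locally_path_connected_of_ANR_over:
  fixes Y :: "'b metric"
  assumes anr: "ANR_over TYPE('b \<Rightarrow> real) Y" and z0: "z0 \<notin> mspace Y"
  shows "locally_path_connected_space (mtopology_of Y)"
proof (cases "mspace Y = {}")
  case True
  have "x \<notin> V" if "openin (mtopology_of Y) V" for V x
    using openin_subset[OF that] True by auto
  then show ?thesis unfolding locally_path_connected_space_im_kleinen by blast
next
  case False
  then obtain y0 where y0: "y0 \<in> mspace Y" by blast
  define k where "k y = (\<lambda>w. if w \<in> mspace Y then mdist Y y w - mdist Y y0 w else 0)" for y
  have kb: "k y \<in> bounded_functions" if y: "y \<in> mspace Y" for y
  proof -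
    have "\<bar>k y w\<bar> \<le> mdist Y y y0" for w
      using mdist_triangle[of y Y y0 w] mdist_triangle[of y0 Y y w] mdist_commute[of Y y y0] y y0
      unfolding k_def by auto
    then show ?thesis unfolding bounded_functions_def by blast
  qed
  have iso: "sup_dist (k y) (k y') = mdist Y y y'" if y: "y \<in> mspace Y" "y' \<in> mspace Y" for y y'
  proof (rule order_antisym)
    show "sup_dist (k y) (k y') \<le> mdist Y y y'"
    proof (rule sup_dist_le)
      fix w show "\<bar>k y w - k y' w\<bar> \<le> mdist Y y y'"
        using mdist_triangle[of y Y y' w] mdist_triangle[of y' Y y w] mdist_commute[of Y y y'] y
        unfolding k_def by auto
    qed
    have "\<bar>k y y' - k y' y'\<bar> \<le> sup_dist (k y) (k y')" by (rule le_sup_dist[OF kb kb]) (use y in auto)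
    then show "mdist Y y y' \<le> sup_dist (k y) (k y')" using y unfolding k_def by simp
  qed
  interpret half_space "k ` mspace Y" z0
    by standard (use kb z0 in \<open>auto simp: k_def\<close>)
  have kC: "k y \<in> C" if "y \<in> mspace Y" for y unfolding C_def using that by blast
  have "isometric_embedding Y M k" unfolding isometric_embedding_def using kC iso by auto
  with anr closedin_Z obtain U where U: "openin (mtopology_of M) U" "k ` mspace Y \<subseteq> U"
      "k ` mspace Y retract_of_space subtopology (mtopology_of M) U"
    unfolding ANR_over_def by blast
  then obtain r where r: "continuous_map (subtopology (mtopology_of M) U)
        (subtopology (subtopology (mtopology_of M) U) (k ` mspace Y)) r"
      "\<forall>f\<in>k ` mspace Y. r f = f"
    unfolding retract_of_space_def by blast
  have UC: "U \<subseteq> C" using openin_subset[OF U(1)] by simp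
  define i where "i = inv_into (mspace Y) k"
  have "inj_on k (mspace Y)"
  proof (rule inj_onI)
    fix y y' assume y: "y \<in> mspace Y" "y' \<in> mspace Y" "k y = k y'"
    then have "mdist Y y y' = 0" using iso[OF y(1,2)] iso[OF y(1) y(1)] by simp
    then show "y = y'" using y by simp
  qed
  then have ik: "i (k y) = y" if "y \<in> mspace Y" for y unfolding i_def using that by (rule inv_into_f_f)
  have kY: "k ` mspace Y \<subseteq> C" using kC by blast
  have subeq: "subtopology (subtopology (mtopology_of M) U) (k ` mspace Y) =
      mtopology_of (submetric M (k ` mspace Y))"
    using U(2) by (simp add: mtopology_of_submetric subtopology_subtopology Int_absorb1)
  have "continuous_map (mtopology_of (submetric M (k ` mspace Y))) (mtopology_of Y) i"
  proof (rule continuous_map_metricI)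
    fix f and e :: real assume f: "f \<in> mspace (submetric M (k ` mspace Y))"
    then show "i f \<in> mspace Y" using ik by auto
    assume e: "0 < e"
    have "mdist Y (i f) (i g) = sup_dist f g" if "g \<in> k ` mspace Y" for g
      using f that ik iso by auto
    then show "\<exists>d>0. \<forall>g\<in>mspace (submetric M (k ` mspace Y)). mdist (submetric M (k ` mspace Y)) f g < d \<longrightarrow>
        mdist Y (i f) (i g) < e" using e by auto
  qed
  then have "continuous_map (subtopology (mtopology_of M) U) (mtopology_of Y) (i \<circ> r)"
    using r(1) unfolding subeq by (intro continuous_map_compose)
  moreover have "continuous_map (mtopology_of Y) (mtopology_of (submetric M U)) k"
  proof (rule continuous_map_metricI)
    show "k y \<in> mspace (submetric M U)" if "y \<in> mspace Y" for y using that U(2) kC by auto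
    fix y and e :: real assume "y \<in> mspace Y" "0 < e"
    then show "\<exists>d>0. \<forall>y'\<in>mspace Y. mdist Y y y' < d \<longrightarrow> mdist (submetric M U) (k y) (k y') < e"
      using iso by auto
  qed
  ultimately have "retraction_maps (subtopology (mtopology_of M) U) (mtopology_of Y) (i \<circ> r) k"
    unfolding retraction_maps_def mtopology_of_submetric using r(2) ik by simp
  then have "retraction_map (subtopology (mtopology_of M) U) (mtopology_of Y) (i \<circ> r)"
    unfolding retraction_map_def by blast
  then show ?thesis
    by (rule locally_path_connected_space_retraction_map_image)
      (rule locally_path_connected_space_open_subset[OF locally_path_connected U(1)])
qed

section \<open>Local path connectedness gives chains\<close>

text \<open>The points of \<open>U\<close> that are linked to \<open>x\<close> and those that are not form two open sets.\<close>

lemma connectedin_linked: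
  assumes C: "connectedin (mtopology_of Y) S" "x \<in> S" "y \<in> S" and U: "openin (mtopology_of Y) U" "S \<subseteq> U"
    and eta: "0 < \<eta>"
  shows "\<exists>l. linked Y \<eta> l U x y"
proof -
  have UY: "U \<subseteq> mspace Y" using openin_subset[OF U(1)] by simp
  define A where "A = {z \<in> U. \<exists>l. linked Y \<eta> l U x z}"
  have step: "\<exists>r>0. \<forall>w\<in>mspace Y. mdist Y z w < r \<longrightarrow> w \<in> U \<and> (w \<in> A \<longleftrightarrow> z \<in> A)" if z: "z \<in> U" for z
  proof -
    obtain r where r: "0 < r" "\<forall>w\<in>mspace Y. mdist Y z w < r \<longrightarrow> w \<in> U"
      using U(1) z unfolding openin_mtopology_of by blast
    have "w \<in> U \<and> (w \<in> A \<longleftrightarrow> z \<in> A)" if w: "w \<in> mspace Y" "mdist Y z w < min r \<eta>" for w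
    proof -
      have wU: "w \<in> U" using r(2) w by simp
      have zw: "linked Y \<eta> 1 U z w" by (rule linked_step) (use wU z UY w in auto)
      have "w \<in> A" if "z \<in> A" using that linked_trans[OF _ zw] wU unfolding A_def by blast
      moreover have "z \<in> A" if "w \<in> A" using that linked_trans[OF _ linked_sym[OF zw]] z unfolding A_def by blast
      ultimately show ?thesis using wU by blast
    qed
    then show ?thesis using r(1) eta by (intro exI[of _ "min r \<eta>"]) auto
  qed
  have "openin (mtopology_of Y) A"
    unfolding openin_mtopology_of
  proof (intro conjI ballI)
    show "A \<subseteq> mspace Y" unfolding A_def using UY by blast
    fix z assume z: "z \<in> A"
    then obtain r where "0 < r" "\<forall>w\<in>mspace Y. mdist Y z w < r \<longrightarrow> w \<in> U \<and> (w \<in> A \<longleftrightarrow> z \<in> A)"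
      using step[of z] unfolding A_def by auto
    then show "\<exists>r>0. \<forall>w\<in>mspace Y. mdist Y z w < r \<longrightarrow> w \<in> A" using z by (intro exI[of _ r]) simp
  qed
  moreover have "openin (mtopology_of Y) (U - A)"
    unfolding openin_mtopology_of
  proof (intro conjI ballI)
    show "U - A \<subseteq> mspace Y" using UY by blast
    fix z assume z: "z \<in> U - A"
    then obtain r where "0 < r" "\<forall>w\<in>mspace Y. mdist Y z w < r \<longrightarrow> w \<in> U \<and> (w \<in> A \<longleftrightarrow> z \<in> A)"
      using step[of z] by auto
    then show "\<exists>r>0. \<forall>w\<in>mspace Y. mdist Y z w < r \<longrightarrow> w \<in> U - A" using z by (intro exI[of _ r]) simp
  qed
  moreover have "x \<in> A" unfolding A_def using C(2) U(2) UY linked_refl[of x U Y \<eta> 0] by auto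
  ultimately have "(U - A) \<inter> S = {}"
    using C(1,2) U(2) unfolding connectedin by blast
  then show ?thesis using C(3) U(2) unfolding A_def by blast
qed

theorem locally_chain_connected_of_locally_path_connected:
  assumes "locally_path_connected_space (mtopology_of Y)"
  shows "locally_chain_connected Y"
  unfolding locally_chain_connected_def locally_chain_connected_at_iff
proof (intro ballI allI impI)
  fix x0 and \<epsilon> :: real assume x0: "x0 \<in> mspace Y" and eps: "0 < \<epsilon>"
  have U: "openin (mtopology_of Y) (mball_of Y x0 \<epsilon>)"
    unfolding mtopology_of_def mball_of_def by (rule Metric_space.openin_mball[OF Metric_space_mspace_mdist])
  have "x0 \<in> mball_of Y x0 \<epsilon>" using x0 eps by simp
  with U have "openin (mtopology_of Y) (mball_of Y x0 \<epsilon>) \<and> x0 \<in> mball_of Y x0 \<epsilon>" ..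
  from assms[unfolded locally_path_connected_space_im_kleinen, THEN spec, THEN spec, THEN mp, OF this]
  obtain V where V: "openin (mtopology_of Y) V" "x0 \<in> V" "\<forall>x\<in>V. \<exists>C. path_connectedin (mtopology_of Y) C \<and>
      C \<subseteq> mball_of Y x0 \<epsilon> \<and> x0 \<in> C \<and> x \<in> C" by (elim exE conjE)
  obtain \<delta> where d: "0 < \<delta>" "\<forall>x\<in>mspace Y. mdist Y x0 x < \<delta> \<longrightarrow> x \<in> V"
    using V(1,2) unfolding openin_mtopology_of by blast
  have "\<exists>l. linked Y \<eta> l (mball_of Y x0 \<epsilon>) x0 x"
    if "0 < \<eta>" "x \<in> mspace Y" "mdist Y x x0 < \<delta>" for \<eta> x
  proof -
    have "x \<in> V" using d(2) that(2,3) by (simp add: mdist_commute)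
    then obtain C where "path_connectedin (mtopology_of Y) C" "C \<subseteq> mball_of Y x0 \<epsilon>" "x0 \<in> C" "x \<in> C"
      using V(3) by blast
    then show ?thesis
      using connectedin_linked[OF path_connectedin_imp_connectedin _ _ U _ that(1)] by blast
  qed
  then show "\<exists>\<delta>>0. \<forall>\<eta>>0. \<forall>x\<in>mspace Y. mdist Y x x0 < \<delta> \<longrightarrow> (\<exists>l. linked Y \<eta> l (mball_of Y x0 \<epsilon>) x0 x)"
    using d(1) by (intro exI[of _ \<delta>] conjI allI ballI impI)
qed

lemma locally_chain_connected_at_subset:
  assumes "locally_chain_connected_at Y Y1" "Y0 \<subseteq> Y1"
  shows "locally_chain_connected_at Y Y0"
  unfolding locally_chain_connected_at_def
proof (intro ballI allI impI)
  fix x0 and \<epsilon> :: real assume "x0 \<in> Y0" "0 < \<epsilon>"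
  then have x0: "x0 \<in> Y1" using assms(2) by blast
  obtain \<delta> where d: "0 < \<delta>" "\<forall>\<eta>>0. \<forall>x\<in>Y1. mdist Y x x0 < \<delta> \<longrightarrow>
      (\<exists>l c. chain_in Y \<eta> l x0 x c \<and> diameter_in Y (c ` {0..l}) < \<epsilon>)"
    using assms(1)[unfolded locally_chain_connected_at_def, THEN bspec, OF x0, THEN spec, THEN mp,
        OF \<open>0 < \<epsilon>\<close>] by (elim exE conjE)
  show "\<exists>\<delta>>0. \<forall>\<eta>>0. \<forall>x\<in>Y0. mdist Y x x0 < \<delta> \<longrightarrow>
      (\<exists>l c. chain_in Y \<eta> l x0 x c \<and> diameter_in Y (c ` {0..l}) < \<epsilon>)"
    by (rule exI[of _ \<delta>], intro conjI d(1) allI impI ballI,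
        rule d(2)[THEN spec, THEN mp, THEN bspec, THEN mp]) (use assms(2) in auto)
qed

section \<open>The equivalences\<close>

theorem corollary1:
  fixes X :: "'a metric"
  shows "(ANR_over TYPE('a set \<Rightarrow> real) (Bd X) \<longrightarrow> ANR_over TYPE('m) (Bd X)) \<and>
    (ANR_over TYPE('a set \<Rightarrow> real) (Bd X) \<longleftrightarrow>
       locally_path_connected_space (mtopology_of (Bd X))) \<and>
    (locally_path_connected_space (mtopology_of (Bd X)) \<longleftrightarrow>
       locally_chain_connected (Bd X)) \<and>
    (locally_chain_connected (Bd X) \<longleftrightarrow>
       locally_chain_connected_at (Bd X) (mspace (Bd X) \<inter> D0 X)) \<and>
    (locally_chain_connected_at (Bd X) (mspace (Bd X) \<inter> D0 X) \<longleftrightarrow>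
       (\<forall>B. bounded_in X B \<longrightarrow> uniformly_locally_chain_equiconnected_at X B)) \<and>
    ((\<forall>B. bounded_in X B \<longrightarrow> uniformly_locally_chain_equiconnected_at X B) \<longleftrightarrow>
       (\<forall>B. bounded_in X B \<longrightarrow> uniformly_locally_trace_equiconnected_at X B))"
proof -
  have spare: "{} \<notin> mspace (Bd X)" using bounded_hyperspaceD(1)[of "{}" X] by auto
  have h12: "locally_path_connected_space (mtopology_of (Bd X))"
    if "ANR_over TYPE('a set \<Rightarrow> real) (Bd X)"
    by (rule locally_path_connected_of_ANR_over[OF that spare])
  have h23: "locally_chain_connected (Bd X)" if "locally_path_connected_space (mtopology_of (Bd X))"
    by (rule locally_chain_connected_of_locally_path_connected[OF that])
  have h34: "locally_chain_connected_at (Bd X) (mspace (Bd X) \<inter> D0 X)" if "locally_chain_connected (Bd X)"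
    by (rule locally_chain_connected_at_subset[OF that[unfolded locally_chain_connected_def]]) simp
  have h45: "\<forall>B. bounded_in X B \<longrightarrow> uniformly_locally_chain_equiconnected_at X B"
    if "locally_chain_connected_at (Bd X) (mspace (Bd X) \<inter> D0 X)"
    by (intro allI impI chain_equiconnected_of_discretely_chain_connected)
      (use that in simp_all)
  have h56: "\<forall>B. bounded_in X B \<longrightarrow> uniformly_locally_trace_equiconnected_at X B"
    if "\<forall>B. bounded_in X B \<longrightarrow> uniformly_locally_chain_equiconnected_at X B"
    by (intro allI impI trace_equiconnected_of_chain_equiconnected that[rule_format])
  have 61: "ANR_over TYPE('n) (Bd X)"
    if "\<forall>B. bounded_in X B \<longrightarrow> uniformly_locally_trace_equiconnected_at X B"
    by (rule ANR_over_Bd_of_trace_equiconnected) (rule that[rule_format])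
  have h61: "ANR_over TYPE('a set \<Rightarrow> real) (Bd X)"
    if "\<forall>B. bounded_in X B \<longrightarrow> uniformly_locally_trace_equiconnected_at X B"
    by (rule ANR_over_Bd_of_trace_equiconnected) (rule that[rule_format])
  have h61m: "ANR_over TYPE('m) (Bd X)"
    if "\<forall>B. bounded_in X B \<longrightarrow> uniformly_locally_trace_equiconnected_at X B"
    by (rule ANR_over_Bd_of_trace_equiconnected) (rule that[rule_format])
  show ?thesis
    by (intro conjI impI iffI)
      (erule h61m[OF h56[OF h45[OF h34[OF h23[OF h12]]]]],
        erule h12, erule h61[OF h56[OF h45[OF h34[OF h23]]]],
        erule h23, erule h12[OF h61[OF h56[OF h45[OF h34]]]],
        erule h34, erule h23[OF h12[OF h61[OF h56[OF h45]]]],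
        erule h45, erule h34[OF h23[OF h12[OF h61[OF h56]]]],
        erule h56, erule h45[OF h34[OF h23[OF h12[OF h61]]]])
qed

end
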